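(* Let $\mathcal G=(V,E)$ be a finite directed and strongly connected graph and let $i_0,j_0$ be two distinct vertices. Assume that the graph is endowed with positive weights $(\alpha(e))_{e\in E}$ such that $\operatorname{div}(\alpha)=\gamma(\delta_{i_0}-\delta_{j_0})$ for some $\gamma\in\mathbb R$. Let $\omega$ be a random environment with law $\mathbb P^{(\alpha)}$ (the Dirichlet environment on $\mathcal G$ with parameters $\alpha$), and let $\beta_{i_0},\beta_{j_0}$ be two independent random variables, independent of $\omega$, with Gamma laws $\Gamma(\alpha(i_0),1)$ and $\Gamma(\alpha(j_0),1)$ respectively. Set $$H_+=\beta_{i_0}\,\mathsf P^\omega_{i_0}(H_{j_0}<H^+_{i_0}),\qquad H_-=\beta_{j_0}\,\mathsf P^\omega_{j_0}(H_{i_0}<H^+_{j_0}),\qquad \Gamma=\sqrt{H_+H_-},\qquad e^S=\sqrt{\frac{H_+}{H_-}}.$$ Then, conditionally on $\Gamma$, $S$ is a random variable with density $$\frac{1}{2K_\gamma(2\Gamma)}\,e^{\gamma s-2\Gamma\cosh(s)}\,ds$$ on $\mathbb R$, where $K_\gamma$ is the modified Bessel function of the second kind with index $\gamma$. Otherwise stated, conditionally on $\Gamma$, $e^S$ has the generalized inverse Gaussian law with parameters $(\gamma,2\Gamma,2\Gamma)$. In particular, if $\gamma=0$, then $S$ and $-S$ have the same law, and $H_+$ and $H_-$ have the same law.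
   Context: For a directed graph $\mathcal G=(V,E)$ and a directed edge $e=(x,y)\in E$, $\underline e=x$ is the tail and $\overline e=y$ the head. The graph is strongly connected if for any two vertices $x,y$ there is a directed path from $x$ to $y$. For $a\in\mathbb R^E$, $\operatorname{div}(a)(x)=\sum_{e:\underline e=x}a(e)-\sum_{e:\overline e=x}a(e)$, and $\delta_x$ is the indicator function of $x$ on $V$. For a vertex $x$, $\alpha(x)=\sum_{e:\underline e=x}\alpha(e)$. An environment is $\omega\in(0,1]^E$ with $\sum_{y:(x,y)\in E}\omega(x,y)=1$ for all $x\in V$; $\mathsf P^\omega_{x}$ is the law of the Markov chain $(X_n)_{n\ge0}$ on $V$ started at $x$ with transition probabilities $\omega$. The Dirichlet law $\mathcal D(a_1,\dots,a_k)$ ($a_i>0$) is the law of $(W_1/\Sigma,\dots,W_k/\Sigma)$ with $W_i$ independent of law $\Gamma(a_i,1)$ and $\Sigma=\sum_i W_i$. The Dirichlet environment $\mathbb P^{(\alpha)}$ is the law under which the vectors $(\omega(e))_{\underline e=x}$, $x\in V$, are independent with laws $\mathcal D(\alpha(e),\underline e=x)$. $\Gamma(a,1)$ is the Gamma law with density $x^{a-1}e^{-x}/\Gamma(a)$ on $(0,\infty)$. Hitting and return times: $H_x=\inf\{n\ge0:X_n=x\}$, $H_x^+=\inf\{n\ge1: X_{n-1}\ne x,\ X_n=x\}$. $K_\gamma(x)=\frac12\int_{-\infty}^{\infty}e^{\gamma t}e^{-x\cosh t}\,dt$ for $x>0$. The generalized inverse Gaussian law with parameters $(p,a,b)$ has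 density on $(0,\infty)$ proportional to $x^{p-1}\exp(-\tfrac12(ax+b/x))$.
   Formalization: The graph is assumed to have no loop at i_0 or j_0; with H_x^+ ignoring loop steps the claim fails otherwise: for edges (i_0,j_0), (j_0,i_0), (i_0,i_0) of weights a, b, c the conditional index is a+c-b, not gamma=a-b. *)

theory Defs
  imports "HOL-Probability.Probability" "Graph_Theory.Graph_Theory"
begin

text \<open>
  Directed graphs are pair digraphs: arcs are pairs of vertices, so there are no parallel arcs, but
  loops are allowed.
\<close>

definition divergence :: "('v, 'e) pre_digraph \<Rightarrow> ('e \<Rightarrow> real) \<Rightarrow> 'v \<Rightarrow> real" where
  "divergence G a x = (\<Sum>e\<in>out_arcs G x. a e) - (\<Sum>e\<in>in_arcs G x. a e)"

definition vertex_weight :: "('v, 'e) pre_digraph \<Rightarrow> ('e \<Rightarrow> real) \<Rightarrow> 'v \<Rightarrow> real" where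
  "vertex_weight G a x = (\<Sum>e\<in>out_arcs G x. a e)"


subsection \<open>Gamma and Dirichlet laws\<close>

definition gamma_density :: "real \<Rightarrow> real \<Rightarrow> real" where
  "gamma_density a x = (if 0 < x then x powr (a - 1) * exp (- x) / Gamma a else 0)"

definition gamma_law :: "real \<Rightarrow> real measure" where
  "gamma_law a = density lborel (\<lambda>x. ennreal (gamma_density a x))"

definition dirichlet_law :: "'i set \<Rightarrow> ('i \<Rightarrow> real) \<Rightarrow> ('i \<Rightarrow> real) measure" where
  "dirichlet_law I a =
     distr (PiM I (\<lambda>i. gamma_law (a i))) (PiM I (\<lambda>_. borel))
       (\<lambda>W. \<lambda>i\<in>I. W i / (\<Sum>j\<in>I. W j))"

text \<open>
  The arcs are partitioned by their tails. A family of vectors, one for each vertex x and indexed by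
  the arcs with tail x, is drawn from the product of the Dirichlet laws and glued to one function on
  the arcs.
\<close>

definition dirichlet_environment ::
    "'v pair_pre_digraph \<Rightarrow> ('v \<times> 'v \<Rightarrow> real) \<Rightarrow> ('v \<times> 'v \<Rightarrow> real) measure" where
  "dirichlet_environment G a =
     distr (PiM (pverts G) (\<lambda>x. dirichlet_law (out_arcs G x) a)) (PiM (parcs G) (\<lambda>_. borel))
       (\<lambda>\<eta>. \<lambda>e\<in>parcs G. \<eta> (fst e) e)"


subsection \<open>Markov chain in an environment\<close>

definition environment :: "'v pair_pre_digraph \<Rightarrow> ('v \<times> 'v \<Rightarrow> real) \<Rightarrow> bool" where
  "environment G \<omega> \<longleftrightarrow>
     (\<forall>e\<in>parcs G. 0 < \<omega> e \<and> \<omega> e \<le> 1) \<and> (\<forall>x\<in>pverts G. (\<Sum>e\<in>out_arcs G x. \<omega> e) = 1)"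

text \<open>
  A function drawn from the Dirichlet environment law is an environment only almost surely. The
  second branch, on which the chain does not move, keeps everything defined and measurable on the
  exceptional null set.
\<close>

definition transition :: "'v pair_pre_digraph \<Rightarrow> ('v \<times> 'v \<Rightarrow> real) \<Rightarrow> 'v \<Rightarrow> 'v pmf" where
  "transition G \<omega> x =
     (if environment G \<omega> \<and> x \<in> pverts G
      then embed_pmf (\<lambda>y. if (x, y) \<in> parcs G then \<omega> (x, y) else 0)
      else return_pmf x)"

text \<open>Conditional law of the state at time n, given the states h at the times before n.\<close>

definition chain_kernel ::
    "'v pair_pre_digraph \<Rightarrow> ('v \<times> 'v \<Rightarrow> real) \<Rightarrow> 'v \<Rightarrow> nat \<Rightarrow> (nat \<Rightarrow> 'v) \<Rightarrow> 'v measure" where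
  "chain_kernel G \<omega> x n h =
     measure_pmf (case n of 0 \<Rightarrow> return_pmf x | Suc m \<Rightarrow> transition G \<omega> (h m))"

text \<open>
  The law on trajectories with these kernels, by the Ionescu-Tulcea extension theorem; see
  \<open>emeasure_chain_law\<close> for its values on cylinders.
\<close>

definition chain_law ::
    "'v pair_pre_digraph \<Rightarrow> ('v \<times> 'v \<Rightarrow> real) \<Rightarrow> 'v \<Rightarrow> (nat \<Rightarrow> 'v) measure" where
  "chain_law G \<omega> x =
     projective_family.lim UNIV
       (Ionescu_Tulcea.CI (chain_kernel G \<omega> x) (\<lambda>_. count_space UNIV)) (\<lambda>_. count_space UNIV)"

lemma Ionescu_Tulcea_chain_kernel:
  "Ionescu_Tulcea (chain_kernel G \<omega> x) (\<lambda>_. count_space UNIV)"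
proof (rule Ionescu_Tulcea.intro)
  fix n
  show "chain_kernel G \<omega> x n \<in>
          measurable (PiM {0..<n} (\<lambda>_. count_space UNIV)) (subprob_algebra (count_space UNIV))"
  proof (cases n)
    case 0
    have "(\<lambda>h :: nat \<Rightarrow> 'a. measure_pmf (return_pmf x)) \<in>
        measurable (PiM {0..<n} (\<lambda>_. count_space UNIV)) (subprob_algebra (count_space UNIV))"
      by (intro measurable_const) (simp add: space_subprob_algebra measure_pmf.subprob_space_axioms)
    with 0 show ?thesis
      by (simp add: chain_kernel_def[abs_def])
  next
    case (Suc m)
    have "(\<lambda>h. h m) \<in> measurable (PiM {0..<Suc m} (\<lambda>_. count_space UNIV)) (count_space UNIV)"
      by measurable
    moreover have "(\<lambda>y. measure_pmf (transition G \<omega> y)) \<in>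
        measurable (count_space UNIV) (subprob_algebra (count_space UNIV))"
      by (auto simp: measurable_count_space_eq1 space_subprob_algebra measure_pmf.subprob_space_axioms)
    ultimately have "(\<lambda>h. measure_pmf (transition G \<omega> (h m))) \<in>
        measurable (PiM {0..<Suc m} (\<lambda>_. count_space UNIV)) (subprob_algebra (count_space UNIV))"
      by (rule measurable_compose)
    with Suc show ?thesis
      by (simp add: chain_kernel_def[abs_def])
  qed
next
  fix n h
  show "prob_space (chain_kernel G \<omega> x n h)"
    by (simp add: chain_kernel_def measure_pmf.prob_space_axioms)
qed

lemma pmf_transition:
  assumes "pair_fin_digraph G" "environment G \<omega>" "x \<in> pverts G"
  shows "pmf (transition G \<omega> x) y = (if (x, y) \<in> parcs G then \<omega> (x, y) else 0)"
proof -
  interpret pair_fin_digraph G by fact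
  let ?f = "\<lambda>y. if (x, y) \<in> parcs G then \<omega> (x, y) else 0"
  have nonneg: "0 \<le> ?f y" for y
    using assms(2) by (auto simp: environment_def less_imp_le)
  have img: "out_arcs G x = Pair x ` {y. (x, y) \<in> parcs G}"
    by (auto simp: out_arcs_def)
  have fin: "finite {y. (x, y) \<in> parcs G}"
    using finite_imageI[OF pair_finite_arcs, of snd] by (rule rev_finite_subset) force
  have "(\<integral>\<^sup>+y. ennreal (?f y) \<partial>count_space UNIV) = (\<Sum>y\<in>{y. (x, y) \<in> parcs G}. ennreal (?f y))"
    by (rule nn_integral_count_space'[OF fin]) auto
  also have "\<dots> = ennreal (\<Sum>y\<in>{y. (x, y) \<in> parcs G}. ?f y)"
    by (intro sum_ennreal nonneg)
  also have "(\<Sum>y\<in>{y. (x, y) \<in> parcs G}. ?f y) = (\<Sum>e\<in>out_arcs G x. \<omega> e)"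
    unfolding img by (subst sum.reindex) (auto simp: inj_on_def intro!: sum.cong)
  also have "\<dots> = 1"
    using assms(2,3) by (auto simp: environment_def)
  finally have "(\<integral>\<^sup>+y. ennreal (?f y) \<partial>count_space UNIV) = 1"
    by simp
  from pmf_embed_pmf[of ?f, OF nonneg this, of y] assms(2,3) show ?thesis
    by (simp add: transition_def)
qed

lemma emeasure_chain_law:
  "emeasure (chain_law G \<omega> x) {X. \<forall>k\<le>n. X k = xs k} =
     (if xs 0 = x then \<Prod>k<n. ennreal (pmf (transition G \<omega> (xs k)) (xs (Suc k))) else 0)"
proof -
  interpret IT: Ionescu_Tulcea "chain_kernel G \<omega> x" "\<lambda>_. count_space UNIV"
    by (rule Ionescu_Tulcea_chain_kernel)
  let ?M = "\<lambda>_. count_space UNIV :: 'a measure"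
  let ?A = "\<lambda>n. PiE {0..<n} (\<lambda>k. {xs k})"
  let ?u = "\<lambda>_ :: nat. undefined :: 'a"
  have A: "?A n \<in> sets (PiM {0..<n} ?M)" for n
    by (rule sets_PiM_I_finite) auto
  have u: "?u \<in> space (PiM {0..<0} ?M)"
    by (simp add: space_PiM)
  have step: "emeasure (IT.C 0 (Suc n) ?u) (?A (Suc n)) =
      (\<integral>\<^sup>+h. emeasure (chain_kernel G \<omega> x n h) {xs n} * indicator (?A n) h \<partial>IT.C 0 n ?u)" for n
  proof -
    have "emeasure (IT.C 0 (Suc n) ?u) (?A (Suc n)) =
        (\<integral>\<^sup>+h. emeasure (IT.eP n h) (?A (Suc n)) \<partial>IT.C 0 n ?u)"
      using A[of "Suc n"] IT.prob_space_C[OF u, of n] IT.measurable_C[of 0 n] IT.sets_C[OF u, of n]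
        IT.measurable_eP[of n]
      by (simp, subst emeasure_bind[where N = "PiM {0..<Suc n} ?M"])
        (auto simp: prob_space.not_empty cong: measurable_cong_sets)
    also have "\<dots> = (\<integral>\<^sup>+h. emeasure (chain_kernel G \<omega> x n h) {xs n} * indicator (?A n) h \<partial>IT.C 0 n ?u)"
    proof (rule nn_integral_cong)
      fix h assume "h \<in> space (IT.C 0 n ?u)"
      then have h: "h \<in> space (PiM {0..<n} ?M)"
        using IT.space_C[OF u, of n] by simp
      then have "h(n := y) \<in> ?A (Suc n) \<longleftrightarrow> h \<in> ?A n \<and> y = xs n" for y
        by (auto simp: PiE_iff space_PiM extensional_def less_Suc_eq)
      then have "(\<lambda>y. h(n := y)) -` ?A (Suc n) \<inter> space (count_space UNIV) =
          (if h \<in> ?A n then {xs n} else {})"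
        by (auto simp del: PiE_iff)
      with IT.emeasure_eP[OF h A] show "emeasure (IT.eP n h) (?A (Suc n)) =
          emeasure (chain_kernel G \<omega> x n h) {xs n} * indicator (?A n) h"
        by simp
    qed
    finally show ?thesis .
  qed
  have cyl: "emeasure (IT.C 0 (Suc n) ?u) (?A (Suc n)) =
     (if xs 0 = x then \<Prod>k<n. ennreal (pmf (transition G \<omega> (xs k)) (xs (Suc k))) else 0)"
  proof (induction n)
    case 0
    have "emeasure (IT.C 0 (Suc 0) ?u) (?A (Suc 0)) = (\<integral>\<^sup>+h. indicator {xs 0} x \<partial>IT.C 0 0 ?u)"
      unfolding step by (rule nn_integral_cong) (auto simp: chain_kernel_def space_PiM)
    also have "\<dots> = indicator {xs 0} x"
      using prob_space.emeasure_space_1[OF IT.prob_space_C[OF u, of 0]] by simp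
    finally show ?case
      by (auto simp del: IT.C.simps)
  next
    case (Suc n)
    have "emeasure (IT.C 0 (Suc (Suc n)) ?u) (?A (Suc (Suc n))) =
       (\<integral>\<^sup>+h. ennreal (pmf (transition G \<omega> (xs n)) (xs (Suc n))) * indicator (?A (Suc n)) h
          \<partial>IT.C 0 (Suc n) ?u)"
      unfolding step[of "Suc n"]
      by (rule nn_integral_cong)
        (auto simp: chain_kernel_def emeasure_pmf_single PiE_iff split: split_indicator)
    also have "\<dots> = ennreal (pmf (transition G \<omega> (xs n)) (xs (Suc n))) *
        emeasure (IT.C 0 (Suc n) ?u) (?A (Suc n))"
      using A[of "Suc n"] IT.sets_C[OF u, of "Suc n"]
      by (subst nn_integral_cmult_indicator) (auto simp del: IT.C.simps)
    finally show ?case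
      unfolding Suc.IH by (auto simp: mult.commute simp del: IT.C.simps)
  qed
  have "{X. \<forall>k\<le>n. X k = xs k} = prod_emb UNIV ?M {0..<Suc n} (?A (Suc n))"
    by (auto simp: prod_emb_def space_PiM PiE_iff)
  then have "emeasure (chain_law G \<omega> x) {X. \<forall>k\<le>n. X k = xs k} =
      emeasure (IT.CI {0..<Suc n}) (?A (Suc n))"
    unfolding chain_law_def using IT.lim[OF _ A] by simp
  also have "\<dots> = emeasure (IT.C 0 (Suc n) ?u) (?A (Suc n))"
    using IT.emeasure_CI[OF order_refl A, of "Suc n"] A[THEN sets.sets_into_space]
    by (simp add: prod_emb_id del: IT.C.simps)
  finally show ?thesis
    using cyl by simp
qed


subsection \<open>Hitting times\<close>

text \<open>
  Both times are infinite if the set of times is empty. A step along a loop at x does not count as a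
  return to x.
\<close>

definition hitting_time :: "'v \<Rightarrow> (nat \<Rightarrow> 'v) \<Rightarrow> enat" where
  "hitting_time x X = Inf (enat ` {n. X n = x})"

definition return_time :: "'v \<Rightarrow> (nat \<Rightarrow> 'v) \<Rightarrow> enat" where
  "return_time x X = Inf (enat ` {n. 1 \<le> n \<and> X (n - 1) \<noteq> x \<and> X n = x})"

definition escape_prob :: "'v pair_pre_digraph \<Rightarrow> ('v \<times> 'v \<Rightarrow> real) \<Rightarrow> 'v \<Rightarrow> 'v \<Rightarrow> real" where
  "escape_prob G \<omega> x y = measure (chain_law G \<omega> x) {X. hitting_time y X < return_time x X}"


subsection \<open>Conditional laws\<close>

text \<open>
  A regular version of the law of X given Y is the kernel that maps y to \<open>\<kappa> y\<close>. Taking for A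
  the whole line shows that \<open>\<kappa> (Y w)\<close> has total mass 1 for almost every w.
\<close>

definition conditional_law ::
    "'w measure \<Rightarrow> ('w \<Rightarrow> real) \<Rightarrow> ('w \<Rightarrow> real) \<Rightarrow> (real \<Rightarrow> real measure) \<Rightarrow> bool" where
  "conditional_law M Y X \<kappa> \<longleftrightarrow>
     Y \<in> borel_measurable M \<and> X \<in> borel_measurable M \<and>
     (\<forall>A\<in>sets borel. AE w in M.
        real_cond_exp M (vimage_algebra (space M) Y borel) (\<lambda>w. indicator A (X w)) w =
          measure (\<kappa> (Y w)) A)"

definition bessel_K :: "real \<Rightarrow> real \<Rightarrow> real" where
  "bessel_K \<gamma> x = (1 / 2) * (\<integral>t. exp (\<gamma> * t) * exp (- x * cosh t) \<partial>lborel)"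

definition gig_law :: "real \<Rightarrow> real \<Rightarrow> real \<Rightarrow> real measure" where
  "gig_law p a b =
     (let f = (\<lambda>x. if 0 < x then x powr (p - 1) * exp (- (1 / 2) * (a * x + b / x)) else 0)
      in density lborel (\<lambda>x. ennreal (f x / (\<integral>y. f y \<partial>lborel))))"

end

theory Submission
  imports Defs
begin

text \<open>
  Replace each row of the environment by independent Gamma variables \<open>W\<close> on the arcs; this leaves
  \<open>(Hp, Hm)\<close> unchanged in law, since a Gamma variable times an independent Dirichlet vector has
  independent Gamma entries. The measure with density proportional to the product of
  \<open>W(e) powr \<alpha>(e)\<close> with respect to the product of \<open>dW(e) / W(e)\<close> is quasi-invariant under the gauge
  transformations \<open>W(x, y) \<mapsto> exp (u x - u y) * W(x, y)\<close>, with a factor given by the divergence of \<open>\<alpha>\<close>.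
  This quasi-invariance survives the elimination (Schur complement) of a vertex \<open>x\<close>: choose \<open>u x\<close>,
  depending on \<open>W\<close>, so that the exit rate of \<open>x\<close> does not change. When only \<open>i0\<close> and \<open>j0\<close> are left, the
  matrix entries are \<open>Hp\<close> and \<open>Hm\<close>, and the gauge acts by \<open>(Hp, Hm) \<mapsto> (exp t * Hp, exp (- t) * Hm)\<close>,
  that is by a translation of \<open>S\<close> at fixed \<open>\<Gamma>\<close>. Hence \<open>exp (2 * \<Gamma> * cosh S - \<gamma> * S)\<close> times the law of
  \<open>(\<Gamma>, S)\<close> is invariant under translations of \<open>S\<close>.
\<close>

subsection \<open>The Gamma and Dirichlet laws\<close>

text \<open>The obstacle is that \<open>u x\<close> has to depend on the weights, while
  quasi-invariance is known only for constant gauges. At an eliminated \<open>x\<close> the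
  divergence vanishes, so the one-parameter flow of gauges supported at \<open>x\<close> preserves
  the reweighted measure. The time needed to restore the exit rate is constant along the orbits of
  this flow, and the logarithm of the exit rate runs along each orbit at unit speed; under these two
  conditions a state-dependent time is as harmless as a constant one. The link with the chain is
  harmonic: the probability h of reaching j0 before i0 is harmonic off i0 and j0, eliminating a
  vertex where h is harmonic leaves the weighted Laplacian of h elsewhere unchanged, and with two
  vertices left that Laplacian at i0 is the entry (i0, j0). Multiplying a row by a positive constant
  does not disturb harmonicity, so Gamma variables may be attached to all vertices although only
  those at i0 and j0 appear in the result. The Bessel normalisation comes from averaging the
  translation identity in S against a probability kernel.\<close>

lemma nn_integral_exp_substitution:
  fixes f :: "real \<Rightarrow> ennreal"
  assumes [measurable]: "f \<in> borel_measurable borel"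
  shows "(\<integral>\<^sup>+x. f x * indicator {0<..} x \<partial>lborel) = (\<integral>\<^sup>+r. f (exp r) * ennreal (exp r) \<partial>lborel)"
proof -
  \<comment> \<open>Exhaustion of the half line by the images of compact intervals of the logarithm;
    \<open>Suc n\<close> keeps even the first interval nondegenerate.\<close>
  let ?I = "\<lambda>n. {exp (- real (Suc n))..exp (real (Suc n))}"
  let ?J = "\<lambda>n. {- real (Suc n)..real (Suc n)}"
  have sub: "(\<integral>\<^sup>+x. f x * indicator (?I n) x \<partial>lborel) =
      (\<integral>\<^sup>+r. f (exp r) * ennreal (exp r) * indicator (?J n) r \<partial>lborel)" for n
    by (intro nn_integral_substitution_aux) (auto intro!: derivative_eq_intros continuous_intros)
  have "(\<lambda>n. \<integral>\<^sup>+x. f x * indicator (?I n) x \<partial>lborel) \<longlonglongrightarrow> (\<integral>\<^sup>+x. f x * indicator {0<..} x \<partial>lborel)"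
  proof (rule nn_integral_LIMSEQ)
    show "incseq (\<lambda>n x. f x * indicator (?I n) x)"
    proof (intro incseq_SucI le_funI mult_left_mono)
      fix n and x :: real
      have "exp (- real (Suc (Suc n))) \<le> exp (- real (Suc n))" "exp (real (Suc n)) \<le> exp (real (Suc (Suc n)))"
        by auto
      then show "indicator (?I n) x \<le> (indicator (?I (Suc n)) x :: ennreal)"
        by (auto simp: indicator_def simp del: of_nat_Suc exp_le_cancel_iff intro: order_trans)
    qed simp
    fix x :: real
    show "(\<lambda>n. f x * indicator (?I n) x) \<longlonglongrightarrow> f x * indicator {0<..} x"
    proof (rule tendsto_eventually)
      obtain m :: nat where m: "\<bar>ln x\<bar> \<le> real m"
        using real_arch_simple by blast
      show "eventually (\<lambda>n. f x * indicator (?I n) x = f x * indicator {0<..} x) sequentially"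
        using eventually_ge_at_top[of m]
      proof eventually_elim
        case (elim n)
        have "x \<in> ?I n \<longleftrightarrow> 0 < x"
        proof
          assume "0 < x"
          have "- real (Suc n) \<le> ln x" "ln x \<le> real (Suc n)" using m elim by linarith+
          with \<open>0 < x\<close> show "x \<in> ?I n"
            by (metis atLeastAtMost_iff exp_le_cancel_iff exp_ln)
        next
          assume "x \<in> ?I n" then show "0 < x"
            by (meson atLeastAtMost_iff exp_gt_zero less_le_trans)
        qed
        then show ?case by (simp add: indicator_def)
      qed
    qed
  qed auto
  moreover have "(\<lambda>n. \<integral>\<^sup>+r. f (exp r) * ennreal (exp r) * indicator (?J n) r \<partial>lborel)
      \<longlonglongrightarrow> (\<integral>\<^sup>+r. f (exp r) * ennreal (exp r) \<partial>lborel)"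
  proof (rule nn_integral_LIMSEQ)
    show "incseq (\<lambda>n r. f (exp r) * ennreal (exp r) * indicator (?J n) r)"
      by (intro incseq_SucI le_funI mult_left_mono) (auto simp: indicator_def)
    fix r :: real
    show "(\<lambda>n. f (exp r) * ennreal (exp r) * indicator (?J n) r) \<longlonglongrightarrow> f (exp r) * ennreal (exp r)"
    proof (rule tendsto_eventually)
      obtain m :: nat where m: "\<bar>r\<bar> \<le> real m"
        using real_arch_simple by blast
      show "eventually (\<lambda>n. f (exp r) * ennreal (exp r) * indicator (?J n) r =
          f (exp r) * ennreal (exp r)) sequentially"
        using eventually_ge_at_top[of m]
        by eventually_elim (use m in \<open>auto simp: indicator_def\<close>)
    qed
  qed auto
  ultimately show ?thesis
    unfolding sub by (rule LIMSEQ_unique)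
qed

lemma nn_integral_lborel_shift:
  fixes f :: "real \<Rightarrow> ennreal"
  assumes "f \<in> borel_measurable borel"
  shows "(\<integral>\<^sup>+r. f (c + r) \<partial>lborel) = (\<integral>\<^sup>+r. f r \<partial>lborel)"
  using nn_integral_real_affine[OF assms, of 1 c] by simp

lemma nn_integral_lborel_reflect:
  fixes f :: "real \<Rightarrow> ennreal"
  assumes "f \<in> borel_measurable borel"
  shows "(\<integral>\<^sup>+r. f (c - r) \<partial>lborel) = (\<integral>\<^sup>+r. f r \<partial>lborel)"
  using nn_integral_real_affine[OF assms, of "-1" c] by simp

lemma borel_measurable_gamma_density [measurable]: "gamma_density a \<in> borel_measurable borel"
  unfolding gamma_density_def[abs_def] by measurable

lemma sets_gamma_law [measurable_cong, simp]: "sets (gamma_law a) = sets borel"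
  by (simp add: gamma_law_def)

lemma space_gamma_law [simp]: "space (gamma_law a) = UNIV"
  by (simp add: gamma_law_def)

text \<open>The Jacobian exp r raises the power \<open>a - 1\<close> to \<open>a\<close>. In the
  coordinate r a scaling by exp s is a translation by s, so the invariance of Lebesgue measure can
  be used.\<close>

lemma nn_integral_gamma_law:
  assumes [measurable]: "f \<in> borel_measurable borel" and a: "0 < a"
  shows "(\<integral>\<^sup>+x. f x \<partial>gamma_law a) =
    (\<integral>\<^sup>+r. f (exp r) * ennreal (exp (a * r - exp r) / Gamma a) \<partial>lborel)"
proof -
  have "(\<integral>\<^sup>+x. f x \<partial>gamma_law a) = (\<integral>\<^sup>+x. ennreal (gamma_density a x) * f x \<partial>lborel)"
    unfolding gamma_law_def by (rule nn_integral_density) auto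
  also have "\<dots> = (\<integral>\<^sup>+x. (ennreal (gamma_density a x) * f x) * indicator {0<..} x \<partial>lborel)"
    by (intro nn_integral_cong) (auto simp: gamma_density_def indicator_def)
  also have "\<dots> = (\<integral>\<^sup>+r. (ennreal (gamma_density a (exp r)) * f (exp r)) * ennreal (exp r) \<partial>lborel)"
    by (rule nn_integral_exp_substitution) measurable
  also have "\<dots> = (\<integral>\<^sup>+r. f (exp r) * ennreal (exp (a * r - exp r) / Gamma a) \<partial>lborel)"
  proof (rule nn_integral_cong)
    fix r :: real
    have "gamma_density a (exp r) * exp r = exp (a * r - exp r) / Gamma a"
      by (simp add: gamma_density_def powr_def field_simps flip: exp_add exp_diff)
    moreover have "0 \<le> gamma_density a (exp r)"
      using a by (simp add: gamma_density_def)
    ultimately have "ennreal (gamma_density a (exp r)) * ennreal (exp r) = ennreal (exp (a * r - exp r) / Gamma a)"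
      by (simp flip: ennreal_mult')
    then show "(ennreal (gamma_density a (exp r)) * f (exp r)) * ennreal (exp r) =
        f (exp r) * ennreal (exp (a * r - exp r) / Gamma a)"
      by (metis mult.assoc mult.commute)
  qed
  finally show ?thesis .
qed

lemma prob_space_gamma_law:
  assumes a: "0 < a"
  shows "prob_space (gamma_law a)"
proof
  let ?f = "\<lambda>t::real. if t \<in> {0..} then t powr (a - 1) / exp t else 0"
  have "(?f has_integral Gamma a) UNIV"
    using Gamma_integral_real[OF a] by (simp only: has_integral_restrict_UNIV)
  then have 1: "(\<integral>\<^sup>+t. ennreal (?f t) \<partial>lborel) = ennreal (Gamma a)"
    by (intro nn_integral_has_integral_lborel) auto
  have gp: "Gamma a > 0"
    using Gamma_real_pos[OF a] .
  have "ennreal (gamma_density a t) = ennreal (1 / Gamma a) * ennreal (?f t)" for t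
    using gp by (subst ennreal_mult'[symmetric]) (auto simp: gamma_density_def exp_minus divide_inverse)
  then have "emeasure (gamma_law a) (space (gamma_law a)) = (\<integral>\<^sup>+t. ennreal (1 / Gamma a) * ennreal (?f t) \<partial>lborel)"
    by (simp add: gamma_law_def emeasure_density)
  also have "\<dots> = ennreal (1 / Gamma a) * ennreal (Gamma a)"
    by (subst nn_integral_cmult) (simp_all only: 1, measurable)
  also have "\<dots> = 1"
    using gp by (simp flip: ennreal_mult')
  finally show "emeasure (gamma_law a) (space (gamma_law a)) = 1" .
qed

lemma AE_gamma_law_pos: "AE x in gamma_law a. 0 < x"
  unfolding gamma_law_def by (subst AE_density) (auto simp: gamma_density_def)

text \<open>Reweighting by exp x cancels exp (- x) in the density and leaves a multiple of x powr a
  * dx / x, which is homogeneous of degree \<open>a\<close> under scaling.\<close>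

lemma nn_integral_gamma_law_scale:
  assumes [measurable]: "f \<in> borel_measurable borel" and a: "0 < a"
  shows "(\<integral>\<^sup>+x. f (exp s * x) * ennreal (exp (x - exp s * x)) \<partial>gamma_law a) =
    ennreal (exp (- a * s)) * (\<integral>\<^sup>+x. f x \<partial>gamma_law a)"
proof -
  \<comment> \<open>The shift \<open>r - s\<close> in the power term comes from writing the
    integrand as a function of s + r.\<close>
  let ?h = "\<lambda>r. f (exp r) * ennreal (exp (a * (r - s) - exp r) / Gamma a)"
  have "(\<integral>\<^sup>+x. f (exp s * x) * ennreal (exp (x - exp s * x)) \<partial>gamma_law a) =
      (\<integral>\<^sup>+r. ?h (s + r) \<partial>lborel)"
    using a by (subst nn_integral_gamma_law[OF _ a], measurable, intro nn_integral_cong)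
      (simp add: mult.assoc exp_add exp_diff algebra_simps flip: ennreal_mult')
  also have "\<dots> = (\<integral>\<^sup>+r. ?h r \<partial>lborel)"
    by (rule nn_integral_lborel_shift) measurable
  also have "\<dots> = (\<integral>\<^sup>+r. ennreal (exp (- a * s)) * (f (exp r) * ennreal (exp (a * r - exp r) / Gamma a)) \<partial>lborel)"
  proof (rule nn_integral_cong)
    fix r :: real
    have "exp (a * (r - s) - exp r) / Gamma a = exp (- a * s) * (exp (a * r - exp r) / Gamma a)"
      by (simp add: algebra_simps flip: exp_add)
    then show "?h r = ennreal (exp (- a * s)) * (f (exp r) * ennreal (exp (a * r - exp r) / Gamma a))"
      by (simp add: ennreal_mult' mult.left_commute del: times_divide_eq_right)
  qed
  also have "\<dots> = ennreal (exp (- a * s)) * (\<integral>\<^sup>+x. f x \<partial>gamma_law a)"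
    using a by (subst nn_integral_cmult, measurable, subst nn_integral_gamma_law) auto
  finally show ?thesis .
qed

lemma sigma_finite_gamma_law: "sigma_finite_measure (gamma_law a)"
  unfolding gamma_law_def by (subst sigma_finite_measure.sigma_finite_iff_density_finite[OF lborel.sigma_finite_measure_axioms]) auto

lemma product_sigma_finite_gamma_law: "product_sigma_finite (\<lambda>i. gamma_law (a i))"
  by (intro product_sigma_finite.intro sigma_finite_gamma_law)

lemma sets_PiM_gamma_law [measurable_cong, simp]:
  "sets (PiM I (\<lambda>i. gamma_law (a i))) = sets (PiM I (\<lambda>_. borel))"
  by (intro sets_PiM_cong) auto

lemma prob_space_PiM_gamma_law:
  assumes "\<And>i. i \<in> I \<Longrightarrow> 0 < a i"
  shows "prob_space (PiM I (\<lambda>i. gamma_law (a i)))"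
  using assms by (intro prob_space_PiM prob_space_gamma_law)

lemma AE_PiM_gamma_law_pos:
  assumes "finite I" "\<And>i. i \<in> I \<Longrightarrow> 0 < a i"
  shows "AE W in PiM I (\<lambda>i. gamma_law (a i)). \<forall>i\<in>I. 0 < W i"
  using assms by (intro AE_finite_allI AE_PiM_component AE_gamma_law_pos prob_space_gamma_law)

text \<open>Coordinates are scaled by different factors and \<open>F\<close> need not be a product.
  The reweighted and rescaled measure \<open>D\<close> is therefore identified with \<open>N\<close>
  on boxes, where the integral splits into one-dimensional scalings, and only then integrated
  against \<open>F\<close>.\<close>

lemma nn_integral_PiM_gamma_law_scale:
  assumes I [simp]: "finite I" and a: "\<And>i. i \<in> I \<Longrightarrow> 0 < a i"
    and F [measurable]: "F \<in> borel_measurable (PiM I (\<lambda>_. borel))"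
  defines "N \<equiv> PiM I (\<lambda>i. gamma_law (a i))"
  shows "(\<integral>\<^sup>+W. F (\<lambda>i\<in>I. exp (v i) * W i) * ennreal (exp (\<Sum>i\<in>I. W i - exp (v i) * W i)) \<partial>N) =
    ennreal (exp (- (\<Sum>i\<in>I. a i * v i))) * (\<integral>\<^sup>+W. F W \<partial>N)"
proof -
  interpret product_sigma_finite "\<lambda>i. gamma_law (a i)"
    by (rule product_sigma_finite_gamma_law)
  have [measurable_cong, simp]: "sets N = sets (PiM I (\<lambda>_. borel))"
    by (simp add: N_def)
  let ?s = "\<lambda>W. \<lambda>i\<in>I. exp (v i) * W i"
  let ?p = "\<lambda>W. \<Prod>i\<in>I. ennreal (exp (W i - exp (v i) * W i)) * ennreal (exp (a i * v i))"
  have p: "?p W = ennreal (exp (\<Sum>i\<in>I. W i - exp (v i) * W i)) * ennreal (exp (\<Sum>i\<in>I. a i * v i))" for W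
    by (simp add: prod.distrib exp_sum prod_ennreal)
  define D where "D = distr (density N ?p) (PiM I (\<lambda>_. borel)) ?s"
  have "D = N"
    unfolding N_def
  proof (rule PiM_eqI)
    fix A assume A: "\<And>i. i \<in> I \<Longrightarrow> A i \<in> sets (gamma_law (a i))"
    then have [measurable]: "\<And>i. i \<in> I \<Longrightarrow> A i \<in> sets borel" by simp
    have [measurable]: "PiE I A \<in> sets (PiM I (\<lambda>_. borel))"
      by (rule sets_PiM_I_finite) auto
    have "emeasure D (PiE I A) = emeasure (density N ?p) (?s -` PiE I A \<inter> space N)"
      unfolding D_def by (subst emeasure_distr) auto
    also have "\<dots> = (\<integral>\<^sup>+W. ?p W * indicator (?s -` PiE I A \<inter> space N) W \<partial>N)"
    proof (rule emeasure_density)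
      have "?s \<in> measurable N (PiM I (\<lambda>_. borel))" by measurable
      then show "?s -` PiE I A \<inter> space N \<in> sets N" by (rule measurable_sets) fact
    qed measurable
    also have "\<dots> = (\<integral>\<^sup>+W. (\<Prod>i\<in>I. (\<lambda>w. indicator (A i) (exp (v i) * w) * ennreal (exp (w - exp (v i) * w)) *
         ennreal (exp (a i * v i))) (W i)) \<partial>N)"
    proof (rule nn_integral_cong)
      fix W assume W: "W \<in> space N"
      have "indicator (?s -` PiE I A \<inter> space N) W = (\<Prod>i\<in>I. indicator (A i) (exp (v i) * W i) :: ennreal)"
      proof (cases "\<forall>i\<in>I. exp (v i) * W i \<in> A i")
        case True then show ?thesis using W by simp
      next
        case False
        then have "(\<Prod>i\<in>I. indicator (A i) (exp (v i) * W i) :: ennreal) = 0"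
          by (intro prod_zero) (auto simp: indicator_def)
        moreover have "?s W \<notin> PiE I A" using False by auto
        ultimately show ?thesis by simp
      qed
      then show "?p W * indicator (?s -` PiE I A \<inter> space N) W =
        (\<Prod>i\<in>I. (\<lambda>w. indicator (A i) (exp (v i) * w) * ennreal (exp (w - exp (v i) * w)) *
         ennreal (exp (a i * v i))) (W i))"
        by (simp add: prod.distrib mult_ac)
    qed
    also have "\<dots> = (\<Prod>i\<in>I. \<integral>\<^sup>+w. indicator (A i) (exp (v i) * w) * ennreal (exp (w - exp (v i) * w)) *
         ennreal (exp (a i * v i)) \<partial>gamma_law (a i))"
      unfolding N_def by (rule product_nn_integral_prod) auto
    also have "\<dots> = (\<Prod>i\<in>I. emeasure (gamma_law (a i)) (A i))"
    proof (rule prod.cong[OF refl])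
      fix i assume i: "i \<in> I"
      note A[OF i, simplified, measurable]
      have "(\<integral>\<^sup>+w. indicator (A i) (exp (v i) * w) * ennreal (exp (w - exp (v i) * w)) *
           ennreal (exp (a i * v i)) \<partial>gamma_law (a i)) =
         (ennreal (exp (- a i * v i)) * (\<integral>\<^sup>+w. indicator (A i) w \<partial>gamma_law (a i))) * ennreal (exp (a i * v i))"
        using a[OF i] by (subst nn_integral_gamma_law_scale[symmetric]) (auto simp: nn_integral_multc)
      also have "\<dots> = emeasure (gamma_law (a i)) (A i) * (ennreal (exp (- a i * v i)) * ennreal (exp (a i * v i)))"
        by (simp add: mult_ac)
      also have "ennreal (exp (- a i * v i)) * ennreal (exp (a i * v i)) = 1"
        by (simp flip: ennreal_mult' exp_add)
      finally show "(\<integral>\<^sup>+w. indicator (A i) (exp (v i) * w) * ennreal (exp (w - exp (v i) * w)) *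
           ennreal (exp (a i * v i)) \<partial>gamma_law (a i)) = emeasure (gamma_law (a i)) (A i)"
        by simp
    qed
    finally show "emeasure D (PiE I A) = (\<Prod>i\<in>I. emeasure (gamma_law (a i)) (A i))" .
  qed (auto simp: D_def)
  have "(\<integral>\<^sup>+W. F W \<partial>N) = (\<integral>\<^sup>+W. F W \<partial>D)"
    using \<open>D = N\<close> by simp
  also have "\<dots> = (\<integral>\<^sup>+W. F (?s W) \<partial>density N ?p)"
    unfolding D_def by (rule nn_integral_distr) auto
  also have "\<dots> = (\<integral>\<^sup>+W. ?p W * F (?s W) \<partial>N)"
    by (rule nn_integral_density) auto
  also have "\<dots> = (\<integral>\<^sup>+W. ennreal (exp (\<Sum>i\<in>I. a i * v i)) *
      (F (?s W) * ennreal (exp (\<Sum>i\<in>I. W i - exp (v i) * W i))) \<partial>N)"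
    unfolding p by (intro nn_integral_cong) (simp add: mult_ac)
  also have "\<dots> = ennreal (exp (\<Sum>i\<in>I. a i * v i)) *
      (\<integral>\<^sup>+W. F (?s W) * ennreal (exp (\<Sum>i\<in>I. W i - exp (v i) * W i)) \<partial>N)"
    by (rule nn_integral_cmult) auto
  finally show ?thesis
    by (simp add: mult.assoc[symmetric] flip: ennreal_mult' exp_add)
qed

section \<open>Dirichlet laws and their mixture with a Gamma total\<close>

lemma sets_dirichlet_law [measurable_cong, simp]: "sets (dirichlet_law I a) = sets (PiM I (\<lambda>_. borel))"
  by (simp add: dirichlet_law_def)

lemma prob_space_dirichlet_law:
  assumes "finite I" "\<And>i. i \<in> I \<Longrightarrow> 0 < a i"
  shows "prob_space (dirichlet_law I a)"
  unfolding dirichlet_law_def using assms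
  by (intro prob_space.prob_space_distr prob_space_PiM_gamma_law) measurable

lemma AE_dirichlet_law:
  assumes I: "finite I" "I \<noteq> {}" and a: "\<And>i. i \<in> I \<Longrightarrow> 0 < a i"
  shows "AE \<eta> in dirichlet_law I a. (\<forall>i\<in>I. 0 < \<eta> i \<and> \<eta> i \<le> 1) \<and> (\<Sum>i\<in>I. \<eta> i) = 1"
proof -
  have posW: "AE W in PiM I (\<lambda>i. gamma_law (a i)). \<forall>i\<in>I. 0 < W i"
    using I(1) a by (rule AE_PiM_gamma_law_pos)
  have "AE W in PiM I (\<lambda>i. gamma_law (a i)).
      (\<forall>i\<in>I. 0 < (\<lambda>i\<in>I. W i / (\<Sum>j\<in>I. W j)) i \<and> (\<lambda>i\<in>I. W i / (\<Sum>j\<in>I. W j)) i \<le> 1) \<and>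
      (\<Sum>i\<in>I. (\<lambda>i\<in>I. W i / (\<Sum>j\<in>I. W j)) i) = 1"
    using posW
  proof eventually_elim
    case (elim W)
    then have pos: "0 < (\<Sum>j\<in>I. W j)"
      using I by (intro sum_pos) auto
    moreover have "W i \<le> (\<Sum>j\<in>I. W j)" if "i \<in> I" for i
      using I that elim by (intro member_le_sum) (auto intro: less_imp_le)
    ultimately show ?case
      using elim by (auto simp flip: sum_divide_distrib)
  qed
  moreover have "(\<lambda>W. \<lambda>i\<in>I. W i / (\<Sum>j\<in>I. W j)) \<in>
      measurable (PiM I (\<lambda>i. gamma_law (a i))) (PiM I (\<lambda>_. borel))"
    by measurable
  moreover have "{\<eta> \<in> space (PiM I (\<lambda>_. borel)). (\<forall>i\<in>I. 0 < \<eta> i \<and> \<eta> i \<le> 1) \<and> (\<Sum>i\<in>I. \<eta> i) = 1} \<in>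
      sets (PiM I (\<lambda>_. borel :: real measure))"
    using I(1) by measurable
  ultimately show ?thesis
    unfolding dirichlet_law_def by (simp only: AE_distr_iff)
qed

text \<open>Polar coordinates on the simplex are avoided. With b = exp r, the translation r = ln (T
  W) + s turns the argument of \<open>F\<close> into exp s * W; for fixed s the Gamma scaling moves
  exp s from the argument of \<open>F\<close> to the density of b; integrating that density over s
  gives 1.\<close>

lemma nn_integral_gamma_dirichlet:
  assumes I: "finite I" "I \<noteq> {}" and a: "\<And>i. i \<in> I \<Longrightarrow> 0 < a i"
    and F [measurable]: "F \<in> borel_measurable (PiM I (\<lambda>_. borel))"
  shows "(\<integral>\<^sup>+b. \<integral>\<^sup>+\<eta>. F (\<lambda>i\<in>I. b * \<eta> i) \<partial>dirichlet_law I a \<partial>gamma_law (\<Sum>i\<in>I. a i)) =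
    (\<integral>\<^sup>+W. F W \<partial>PiM I (\<lambda>i. gamma_law (a i)))"
proof -
  have posW: "AE W in PiM I (\<lambda>i. gamma_law (a i)). \<forall>i\<in>I. 0 < W i"
    using I(1) a by (rule AE_PiM_gamma_law_pos)
  define N where "N = PiM I (\<lambda>i. gamma_law (a i))"
  define A where "A = (\<Sum>i\<in>I. a i)"
  define T where "T W = (\<Sum>i\<in>I. W i)" for W :: "'a \<Rightarrow> real"
  define c where "c r = ennreal (exp (A * r - exp r) / Gamma A)" for r
  have A: "0 < A"
    unfolding A_def using I a by (intro sum_pos) auto
  have [measurable_cong, simp]: "sets N = sets (PiM I (\<lambda>_. borel))"
    by (simp add: N_def)
  interpret N: prob_space N
    unfolding N_def using a by (rule prob_space_PiM_gamma_law)
  interpret NL: pair_sigma_finite N lborel ..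
  have [measurable]: "T \<in> borel_measurable (PiM I (\<lambda>_. borel))"
    unfolding T_def[abs_def] by measurable
  have [measurable]: "c \<in> borel_measurable borel"
    unfolding c_def[abs_def] by measurable
  have c1: "(\<integral>\<^sup>+r. c r \<partial>lborel) = 1"
    using nn_integral_gamma_law[of "\<lambda>_. 1", OF _ A] prob_space.emeasure_space_1[OF prob_space_gamma_law[OF A]]
    by (simp add: c_def)
  have "(\<integral>\<^sup>+b. \<integral>\<^sup>+\<eta>. F (\<lambda>i\<in>I. b * \<eta> i) \<partial>dirichlet_law I a \<partial>gamma_law A) =
      (\<integral>\<^sup>+b. \<integral>\<^sup>+W. F (\<lambda>i\<in>I. b * (W i / T W)) \<partial>N \<partial>gamma_law A)"
  proof (rule nn_integral_cong)
    fix b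
    have "(\<lambda>\<eta>. F (\<lambda>i\<in>I. b * \<eta> i)) \<in> borel_measurable (PiM I (\<lambda>_. borel))"
      by measurable
    then show "(\<integral>\<^sup>+\<eta>. F (\<lambda>i\<in>I. b * \<eta> i) \<partial>dirichlet_law I a) = (\<integral>\<^sup>+W. F (\<lambda>i\<in>I. b * (W i / T W)) \<partial>N)"
      unfolding dirichlet_law_def N_def[symmetric] T_def[symmetric]
      by (subst nn_integral_distr) (auto simp: T_def cong: restrict_cong)
  qed
  also have "\<dots> = (\<integral>\<^sup>+r. (\<integral>\<^sup>+W. F (\<lambda>i\<in>I. exp r * (W i / T W)) \<partial>N) * c r \<partial>lborel)"
    unfolding c_def using A by (subst nn_integral_gamma_law) auto
  also have "\<dots> = (\<integral>\<^sup>+r. (\<integral>\<^sup>+W. F (\<lambda>i\<in>I. exp r * (W i / T W)) * c r \<partial>N) \<partial>lborel)"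
    by (intro nn_integral_cong nn_integral_multc[symmetric]) measurable
  also have "\<dots> = (\<integral>\<^sup>+W. (\<integral>\<^sup>+r. F (\<lambda>i\<in>I. exp r * (W i / T W)) * c r \<partial>lborel) \<partial>N)"
    by (rule NL.Fubini') measurable
  also have "\<dots> = (\<integral>\<^sup>+W. (\<integral>\<^sup>+s. F (\<lambda>i\<in>I. exp s * W i) * c (ln (T W) + s) \<partial>lborel) \<partial>N)"
  proof (rule nn_integral_cong_AE)
    show "AE W in N. (\<integral>\<^sup>+r. F (\<lambda>i\<in>I. exp r * (W i / T W)) * c r \<partial>lborel) =
        (\<integral>\<^sup>+s. F (\<lambda>i\<in>I. exp s * W i) * c (ln (T W) + s) \<partial>lborel)"
      using posW[folded N_def]
    proof eventually_elim
      case (elim W)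
      then have pos: "0 < T W"
        unfolding T_def using I by (intro sum_pos) auto
      have "(\<integral>\<^sup>+r. F (\<lambda>i\<in>I. exp r * (W i / T W)) * c r \<partial>lborel) =
          (\<integral>\<^sup>+s. F (\<lambda>i\<in>I. exp (ln (T W) + s) * (W i / T W)) * c (ln (T W) + s) \<partial>lborel)"
        by (rule nn_integral_lborel_shift[symmetric]) measurable
      also have "\<dots> = (\<integral>\<^sup>+s. F (\<lambda>i\<in>I. exp s * W i) * c (ln (T W) + s) \<partial>lborel)"
        using pos by (intro nn_integral_cong) (simp add: exp_add)
      finally show ?case .
    qed
  qed
  also have "\<dots> = (\<integral>\<^sup>+s. (\<integral>\<^sup>+W. F (\<lambda>i\<in>I. exp s * W i) * c (ln (T W) + s) \<partial>N) \<partial>lborel)"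
    by (rule NL.Fubini'[symmetric]) measurable
  also have "\<dots> = (\<integral>\<^sup>+s. (\<integral>\<^sup>+W. F W * c (ln (T W) - s) \<partial>N) \<partial>lborel)"
  proof (rule nn_integral_cong)
    fix s :: real
    \<comment> \<open>The term exp (- s) * T W becomes T W at exp s * W and cancels the T W of the
      reweighting, which leaves \<open>c (ln (T W) + s)\<close>.\<close>
    define K where "K W = F W * ennreal (exp (A * ln (T W) - exp (- s) * T W) / Gamma A)" for W
    have [measurable]: "K \<in> borel_measurable (PiM I (\<lambda>_. borel))"
      unfolding K_def[abs_def] by measurable
    have pos: "AE W in N. 0 < T W"
      using posW[folded N_def]
      by eventually_elim (use I in \<open>auto simp: T_def intro!: sum_pos\<close>)
    have "(\<integral>\<^sup>+W. F (\<lambda>i\<in>I. exp s * W i) * c (ln (T W) + s) \<partial>N) =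
        (\<integral>\<^sup>+W. K (\<lambda>i\<in>I. exp s * W i) * ennreal (exp (\<Sum>i\<in>I. W i - exp s * W i)) \<partial>N)"
    proof (rule nn_integral_cong_AE)
      show "AE W in N. F (\<lambda>i\<in>I. exp s * W i) * c (ln (T W) + s) =
          K (\<lambda>i\<in>I. exp s * W i) * ennreal (exp (\<Sum>i\<in>I. W i - exp s * W i))"
        using pos
      proof eventually_elim
        case (elim W)
        have sT: "T (\<lambda>i\<in>I. exp s * W i) = exp s * T W"
          by (simp add: T_def sum_distrib_left)
        have sum: "(\<Sum>i\<in>I. W i - exp s * W i) = T W - exp s * T W"
          by (simp add: T_def sum_distrib_left sum_subtractf)
        have "exp (- s) * (exp s * T W) = T W" "exp (ln (T W) + s) = exp s * T W" "ln (exp s * T W) = ln (T W) + s"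
          using elim by (simp_all add: ln_mult exp_add exp_minus)
        then have "A * (ln (T W) + s) - exp (ln (T W) + s) =
            (A * ln (exp s * T W) - exp (- s) * (exp s * T W)) + (T W - exp s * T W)"
          by simp
        then have eq: "exp (A * (ln (T W) + s) - exp (ln (T W) + s)) / Gamma A =
            exp (A * ln (exp s * T W) - exp (- s) * (exp s * T W)) / Gamma A * exp (T W - exp s * T W)"
          by (simp only: exp_add) simp
        show ?case
          unfolding K_def sT sum c_def eq by (simp only: ennreal_mult''[OF exp_ge_zero] mult.assoc)
      qed
    qed
    also have "\<dots> = ennreal (exp (- (\<Sum>i\<in>I. a i * s))) * (\<integral>\<^sup>+W. K W \<partial>N)"
      unfolding N_def by (rule nn_integral_PiM_gamma_law_scale[OF I(1) a]) auto
    also have "\<dots> = (\<integral>\<^sup>+W. ennreal (exp (- (A * s))) * K W \<partial>N)"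
      unfolding A_def sum_distrib_right by (rule nn_integral_cmult[symmetric]) auto
    also have "\<dots> = (\<integral>\<^sup>+W. F W * c (ln (T W) - s) \<partial>N)"
    proof (rule nn_integral_cong_AE)
      show "AE W in N. ennreal (exp (- (A * s))) * K W = F W * c (ln (T W) - s)"
        using pos
      proof eventually_elim
        case (elim W)
        then have "exp (ln (T W) - s) = exp (- s) * T W"
          by (simp add: exp_diff exp_minus divide_inverse)
        then have "A * (ln (T W) - s) - exp (ln (T W) - s) = - (A * s) + (A * ln (T W) - exp (- s) * T W)"
          by (simp add: algebra_simps)
        then have eq: "exp (A * (ln (T W) - s) - exp (ln (T W) - s)) / Gamma A =
            exp (- (A * s)) * (exp (A * ln (T W) - exp (- s) * T W) / Gamma A)"
          by (simp only: exp_add) simp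
        show ?case
          unfolding K_def c_def eq by (simp only: ennreal_mult'[OF exp_ge_zero] mult.left_commute)
      qed
    qed
    finally show "(\<integral>\<^sup>+W. F (\<lambda>i\<in>I. exp s * W i) * c (ln (T W) + s) \<partial>N) =
        (\<integral>\<^sup>+W. F W * c (ln (T W) - s) \<partial>N)" .
  qed
  also have "\<dots> = (\<integral>\<^sup>+W. (\<integral>\<^sup>+s. F W * c (ln (T W) - s) \<partial>lborel) \<partial>N)"
    by (rule NL.Fubini') measurable
  also have "\<dots> = (\<integral>\<^sup>+W. F W \<partial>N)"
    by (intro nn_integral_cong) (simp add: nn_integral_cmult nn_integral_lborel_reflect c1)
  finally show ?thesis
    unfolding N_def A_def .
qed

subsection \<open>Gauge transformations and vertex elimination\<close>

text \<open>
  Insert \<open>1 = \<integral>k (\<tau> x + s) ds\<close> for a probability density \<open>k\<close>. By Tonelli and the invariance under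
  constant times, the left-hand side becomes an integral that does not involve \<open>c\<close>.
\<close>

lemma nn_integral_flow_twist:
  fixes g :: "real \<times> 'a \<Rightarrow> 'a" and S c \<tau> :: "'a \<Rightarrow> real"
  assumes N: "sigma_finite_measure N"
    and [measurable]: "g \<in> measurable (borel \<Otimes>\<^sub>M N) N"
      "S \<in> borel_measurable N" "c \<in> borel_measurable N" "\<tau> \<in> borel_measurable N"
    and flow: "\<And>s t x. x \<in> space N \<Longrightarrow> g (s, g (t, x)) = g (s + t, x)"
      "\<And>x. x \<in> space N \<Longrightarrow> g (0, x) = x"
    and c: "\<And>s x. x \<in> space N \<Longrightarrow> c (g (s, x)) = c x"
    and \<tau>: "AE x in N. \<forall>s. \<tau> (g (s, x)) = \<tau> x + s"
    and inv: "\<And>s F. F \<in> borel_measurable N \<Longrightarrow>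
      (\<integral>\<^sup>+x. F (g (s, x)) * ennreal (exp (S x - S (g (s, x)))) \<partial>N) = (\<integral>\<^sup>+x. F x \<partial>N)"
    and [measurable]: "G \<in> borel_measurable N"
  shows "(\<integral>\<^sup>+x. G (g (c x, x)) * ennreal (exp (S x - S (g (c x, x)))) \<partial>N) = (\<integral>\<^sup>+x. G x \<partial>N)"
proof -
  interpret sigma_finite_measure N by fact
  interpret NL: pair_sigma_finite N lborel ..
  define H where "H s x = G (g (s, x)) * ennreal (exp (S x - S (g (s, x))))" for s x
  define k :: "real \<Rightarrow> ennreal" where "k = indicator {0..1}"
  have [measurable]: "k \<in> borel_measurable borel"
    unfolding k_def by measurable
  have k1: "(\<integral>\<^sup>+s. k s \<partial>lborel) = 1"
    unfolding k_def by simp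
  \<comment> \<open>The right-hand side does not mention \<open>c\<close>, so the instances at the
    given time and at the constant time 0 can be compared.\<close>
  have twisted: "(\<integral>\<^sup>+x. H (c x) x \<partial>N) = (\<integral>\<^sup>+x. (\<integral>\<^sup>+s. H s x * k (\<tau> x) \<partial>lborel) \<partial>N)"
    if [measurable]: "c \<in> borel_measurable N" and c: "\<And>s x. x \<in> space N \<Longrightarrow> c (g (s, x)) = c x" for c
  proof -
    have "(\<integral>\<^sup>+x. H (c x) x \<partial>N) = (\<integral>\<^sup>+x. (\<integral>\<^sup>+s. H (c x) x * k (\<tau> x + s) \<partial>lborel) \<partial>N)"
      by (intro nn_integral_cong) (simp add: nn_integral_cmult nn_integral_lborel_shift k1)
    also have "\<dots> = (\<integral>\<^sup>+s. (\<integral>\<^sup>+x. H (c x) x * k (\<tau> x + s) \<partial>N) \<partial>lborel)"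
      unfolding H_def by (rule NL.Fubini'[symmetric]) measurable
    also have "\<dots> = (\<integral>\<^sup>+s. (\<integral>\<^sup>+x. H (c x - s) x * k (\<tau> x) \<partial>N) \<partial>lborel)"
    proof (rule nn_integral_cong)
      fix s :: real
      have gs: "g (s, x) \<in> space N" if "x \<in> space N" for x
        using measurable_space[of g "borel \<Otimes>\<^sub>M N" N "(s, x)"] that by (simp add: space_pair_measure)
      \<comment> \<open>Time s is undone: \<open>c\<close> is constant along the orbit, the flow
        property adds c x - s and s to c x, and the two exponential factors telescope through S (g
        (s, x)). Meanwhile \<open>\<tau>\<close> acts as a clock that has advanced by s.\<close>
      have "(\<integral>\<^sup>+x. H (c x) x * k (\<tau> x + s) \<partial>N) =
          (\<integral>\<^sup>+x. H (c (g (s, x)) - s) (g (s, x)) * k (\<tau> (g (s, x))) * ennreal (exp (S x - S (g (s, x)))) \<partial>N)"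
      proof (rule nn_integral_cong_AE)
        show "AE x in N. H (c x) x * k (\<tau> x + s) =
            H (c (g (s, x)) - s) (g (s, x)) * k (\<tau> (g (s, x))) * ennreal (exp (S x - S (g (s, x))))"
          using \<tau> AE_space
        proof eventually_elim
          case (elim x)
          then have "H (c (g (s, x)) - s) (g (s, x)) * ennreal (exp (S x - S (g (s, x)))) = H (c x) x"
            by (simp add: H_def c flow mult.assoc flip: ennreal_mult' exp_add)
          then show ?case
            using elim by (simp add: mult_ac)
        qed
      qed
      also have "\<dots> = (\<integral>\<^sup>+x. H (c x - s) x * k (\<tau> x) \<partial>N)"
        by (rule inv) (simp add: H_def)
      finally show "(\<integral>\<^sup>+x. H (c x) x * k (\<tau> x + s) \<partial>N) = (\<integral>\<^sup>+x. H (c x - s) x * k (\<tau> x) \<partial>N)" .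
    qed
    also have "\<dots> = (\<integral>\<^sup>+x. (\<integral>\<^sup>+s. H (c x - s) x * k (\<tau> x) \<partial>lborel) \<partial>N)"
      unfolding H_def by (rule NL.Fubini') measurable
    also have "\<dots> = (\<integral>\<^sup>+x. (\<integral>\<^sup>+s. H s x * k (\<tau> x) \<partial>lborel) \<partial>N)"
    proof (rule nn_integral_cong)
      fix x assume [simp]: "x \<in> space N"
      have "(\<lambda>s. H s x * k (\<tau> x)) \<in> borel_measurable borel"
        unfolding H_def by measurable
      from nn_integral_lborel_reflect[OF this, of "c x"]
      show "(\<integral>\<^sup>+s. H (c x - s) x * k (\<tau> x) \<partial>lborel) = (\<integral>\<^sup>+s. H s x * k (\<tau> x) \<partial>lborel)" .
    qed
    finally show ?thesis .
  qed
  have "(\<integral>\<^sup>+x. H (c x) x \<partial>N) = (\<integral>\<^sup>+x. H 0 x \<partial>N)"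
    using twisted[of c] twisted[of "\<lambda>_. 0"] c by simp
  also have "\<dots> = (\<integral>\<^sup>+x. G x \<partial>N)"
    by (intro nn_integral_cong) (simp add: H_def flow)
  finally show ?thesis
    by (simp add: H_def)
qed

definition gauge_transform :: "'v set \<Rightarrow> ('v \<Rightarrow> real) \<Rightarrow> ('v \<times> 'v \<Rightarrow> real) \<Rightarrow> 'v \<times> 'v \<Rightarrow> real" where
  "gauge_transform V u R = (\<lambda>e\<in>V \<times> V. exp (u (fst e) - u (snd e)) * R e)"

definition total :: "'v set \<Rightarrow> ('v \<times> 'v \<Rightarrow> real) \<Rightarrow> real" where
  "total V R = (\<Sum>e\<in>V \<times> V. R e)"

text \<open>The diagonal entry is left out: a loop at x does not move the chain, and gauge
  transformations fix diagonal entries.\<close>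

definition exit_rate :: "'v set \<Rightarrow> 'v \<Rightarrow> ('v \<times> 'v \<Rightarrow> real) \<Rightarrow> real" where
  "exit_rate V x R = (\<Sum>z\<in>V - {x}. R (x, z))"

text \<open>The matrix of jump rates of the chain watched outside x.\<close>

definition eliminate :: "'v set \<Rightarrow> 'v \<Rightarrow> ('v \<times> 'v \<Rightarrow> real) \<Rightarrow> 'v \<times> 'v \<Rightarrow> real" where
  "eliminate V x R = (\<lambda>(y, z)\<in>V \<times> V.
     if y = x \<or> z = x then 0 else R (y, z) + R (y, x) * R (x, z) / exit_rate V x R)"

definition laplacian :: "'v set \<Rightarrow> ('v \<times> 'v \<Rightarrow> real) \<Rightarrow> ('v \<Rightarrow> real) \<Rightarrow> 'v \<Rightarrow> real" where
  "laplacian V R p y = (\<Sum>z\<in>V. R (y, z) * (p z - p y))"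

text \<open>Strong connectivity in terms of cuts. Unlike paths, cuts pass directly through an
  elimination, and finitely many of them make this a measurable condition on R.\<close>

definition irreducible_on :: "'v set \<Rightarrow> ('v \<times> 'v \<Rightarrow> real) \<Rightarrow> bool" where
  "irreducible_on W R \<longleftrightarrow> (\<forall>A\<subseteq>W. A \<noteq> {} \<longrightarrow> A \<noteq> W \<longrightarrow> (\<exists>y\<in>A. \<exists>z\<in>W - A. 0 < R (y, z)))"

text \<open>
  That is, the measure \<open>exp (total V R) N(dR)\<close> is quasi-invariant under gauge transformations.
\<close>

definition gauge_covariant ::
    "'v set \<Rightarrow> ('v \<times> 'v \<Rightarrow> real) measure \<Rightarrow> (('v \<Rightarrow> real) \<Rightarrow> real) \<Rightarrow> bool" where
  "gauge_covariant V N \<theta> \<longleftrightarrow>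
     (\<forall>u. \<forall>F\<in>borel_measurable (PiM (V \<times> V) (\<lambda>_. borel)).
        (\<integral>\<^sup>+R. F (gauge_transform V u R) * ennreal (exp (total V R - total V (gauge_transform V u R))) \<partial>N) =
        ennreal (exp (- \<theta> u)) * (\<integral>\<^sup>+R. F R \<partial>N))"

section \<open>Algebra of gauge transformations and Schur complements\<close>

lemma exit_rate_gauge:
  assumes "x \<in> V"
  shows "exit_rate V x (gauge_transform V u R) = exp (u x) * (\<Sum>z\<in>V - {x}. exp (- u z) * R (x, z))"
  using assms unfolding exit_rate_def gauge_transform_def sum_distrib_left
  by (intro sum.cong) (simp_all add: exp_diff exp_minus divide_inverse)

text \<open>The value s at x enters every rate out of x as the same factor exp s. Hence the
  logarithm of a positive exit rate is a clock for the gauge flow at x, and a prescribed positive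
  exit rate is reached at exactly one time.\<close>

lemma exit_rate_gauge_upd:
  assumes "x \<in> V"
  shows "exit_rate V x (gauge_transform V (u(x := s)) R) = exp s * exit_rate V x (gauge_transform V (u(x := 0)) R)"
proof -
  have "(\<Sum>z\<in>V - {x}. exp (- (u(x := s)) z) * R (x, z)) = (\<Sum>z\<in>V - {x}. exp (- (u(x := 0)) z) * R (x, z))"
    by (intro sum.cong) auto
  then show ?thesis
    using assms by (simp add: exit_rate_gauge)
qed

lemma gauge_gauge: "gauge_transform V u (gauge_transform V v R) = gauge_transform V (\<lambda>x. u x + v x) R"
  by (auto simp: gauge_transform_def restrict_def fun_eq_iff algebra_simps simp flip: exp_add)

lemma gauge_const:
  assumes "R \<in> extensional (V \<times> V)"
  shows "gauge_transform V (\<lambda>_. a) R = R"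
  using assms by (auto simp: gauge_transform_def restrict_def fun_eq_iff extensional_def)

text \<open>The factors exp (- s) on R (y, x) and exp s on R (x, z) cancel in their product, so s is
  felt only through the exit rate in the denominator.\<close>

lemma eliminate_gauge:
  assumes x: "x \<in> V" and exit: "exit_rate V x (gauge_transform V (u(x := s)) R) = exit_rate V x R"
  shows "eliminate V x (gauge_transform V (u(x := s)) R) = gauge_transform V u (eliminate V x R)"
proof
  fix e :: "'a \<times> 'a"
  obtain y z where e: "e = (y, z)" by (cases e)
  show "eliminate V x (gauge_transform V (u(x := s)) R) e = gauge_transform V u (eliminate V x R) e"
  proof (cases "y \<in> V \<and> z \<in> V \<and> y \<noteq> x \<and> z \<noteq> x")
    case True
    then show ?thesis
      unfolding e eliminate_def exit using x
      by (simp add: gauge_transform_def exp_diff field_simps)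
  next
    case False
    then show ?thesis
      by (auto simp: e eliminate_def gauge_transform_def)
  qed
qed

text \<open>Elimination spreads R (y, x) over the columns z in the proportions R (x, z) /
  \<open>exit_rate V x R\<close>, so the row sums of y other than x are conserved and only row x is
  lost. A gauge that restores the exit rate leaves the lost amount unchanged, which keeps the
  exponents in \<open>gauge_covariant\<close> comparable.\<close>

lemma total_eliminate:
  assumes "finite V" "x \<in> V" "exit_rate V x R \<noteq> 0"
  shows "total V (eliminate V x R) = total V R - exit_rate V x R - R (x, x)"
proof -
  have row: "(\<Sum>z\<in>V. eliminate V x R (y, z)) = (\<Sum>z\<in>V. R (y, z))" if "y \<in> V - {x}" for y
  proof -
    have "(\<Sum>z\<in>V. eliminate V x R (y, z)) = (\<Sum>z\<in>V - {x}. eliminate V x R (y, z))"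
      using assms that by (subst sum.remove[of V x]) (auto simp: eliminate_def)
    also have "\<dots> = (\<Sum>z\<in>V - {x}. R (y, z) + R (y, x) * R (x, z) / exit_rate V x R)"
      using that by (intro sum.cong) (auto simp: eliminate_def)
    also have "\<dots> = (\<Sum>z\<in>V - {x}. R (y, z)) + R (y, x) * exit_rate V x R / exit_rate V x R"
      by (simp add: sum.distrib exit_rate_def sum_divide_distrib sum_distrib_left)
    also have "\<dots> = (\<Sum>z\<in>V. R (y, z))"
      using assms by (simp add: sum.remove[of V x "\<lambda>z. R (y, z)"])
    finally show ?thesis .
  qed
  have double: "total V R = (\<Sum>y\<in>V. \<Sum>z\<in>V. R (y, z))" for R
    by (simp add: total_def sum.cartesian_product)
  have "total V (eliminate V x R) = (\<Sum>y\<in>V - {x}. \<Sum>z\<in>V. eliminate V x R (y, z))"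
    unfolding double using assms
    by (subst sum.remove[of V x]) (auto simp: eliminate_def intro!: sum.neutral)
  also have "\<dots> = (\<Sum>y\<in>V - {x}. \<Sum>z\<in>V. R (y, z))"
    by (intro sum.cong row) auto
  also have "\<dots> = total V R - (\<Sum>z\<in>V. R (x, z))"
    using assms by (simp add: double[of R] sum.remove[of V x "\<lambda>y. \<Sum>z\<in>V. R (y, z)"])
  also have "(\<Sum>z\<in>V. R (x, z)) = exit_rate V x R + R (x, x)"
    using assms by (simp add: exit_rate_def sum.remove[of V x "\<lambda>z. R (x, z)"])
  finally show ?thesis by simp
qed

text \<open>Harmonicity makes p x the average of p over the exits from x, so sending the rate R (y,
  x) on to those exits still contributes R (y, x) * (p x - p y).\<close>

lemma laplacian_eliminate:
  assumes V: "finite V" "x \<in> V" and exit: "exit_rate V x R \<noteq> 0" and harm: "laplacian V R p x = 0"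
    and y: "y \<in> V" "y \<noteq> x"
  shows "laplacian V (eliminate V x R) p y = laplacian V R p y"
proof -
  have "laplacian V R p x = (\<Sum>z\<in>V - {x}. R (x, z) * (p z - p x))"
    using V by (simp add: laplacian_def sum.remove[of V x])
  then have 0: "(\<Sum>z\<in>V - {x}. R (x, z) * p z) = exit_rate V x R * p x"
    using harm by (simp add: exit_rate_def sum_distrib_right right_diff_distrib sum_subtractf)
  have "laplacian V (eliminate V x R) p y = (\<Sum>z\<in>V - {x}. eliminate V x R (y, z) * (p z - p y))"
    using V y by (simp add: laplacian_def sum.remove[of V x] eliminate_def)
  also have "\<dots> = (\<Sum>z\<in>V - {x}. R (y, z) * (p z - p y) + R (y, x) / exit_rate V x R * (R (x, z) * p z - R (x, z) * p y))"
    using y by (intro sum.cong) (auto simp: eliminate_def algebra_simps add_divide_distrib diff_divide_distrib)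
  also have "\<dots> = (\<Sum>z\<in>V - {x}. R (y, z) * (p z - p y)) +
      R (y, x) / exit_rate V x R * (exit_rate V x R * p x - exit_rate V x R * p y)"
    unfolding 0[symmetric]
    by (simp only: sum.distrib sum_distrib_left[symmetric] sum_subtractf sum_distrib_right[symmetric] exit_rate_def)
  also have "\<dots> = (\<Sum>z\<in>V - {x}. R (y, z) * (p z - p y)) + R (y, x) * (p x - p y)"
    using exit by (simp add: field_simps)
  also have "\<dots> = laplacian V R p y"
    using V by (simp add: laplacian_def sum.remove[of V x])
  finally show ?thesis .
qed

lemma eliminate_nonneg:
  assumes "\<forall>e\<in>V \<times> V. 0 \<le> R e" "x \<in> V"
  shows "\<forall>e\<in>V \<times> V. 0 \<le> eliminate V x R e"
  using assms by (auto simp: eliminate_def exit_rate_def intro!: add_nonneg_nonneg divide_nonneg_nonneg mult_nonneg_nonneg sum_nonneg)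

lemma exit_rate_pos:
  assumes "finite V" "W \<subseteq> V" "x \<in> W" "W \<noteq> {x}" "irreducible_on W R" "\<forall>e\<in>V \<times> V. 0 \<le> R e"
  shows "0 < exit_rate V x R"
proof -
  obtain z where "z \<in> W - {x}" "0 < R (x, z)"
    using assms unfolding irreducible_on_def by (metis empty_not_insert empty_subsetI insert_subset singletonD)
  then show ?thesis
    unfolding exit_rate_def using assms by (intro sum_pos2[of _ z]) auto
qed

text \<open>For a cut A of the smaller vertex set, both A and \<open>insert x A\<close> are cuts of
  W. Either one of the two crossing edges avoids x and survives, or the first enters x and the
  second leaves it, and then the detour through x has a positive rate.\<close>

lemma irreducible_on_eliminate:
  assumes V: "finite V" "W \<subseteq> V" "x \<in> W" "W \<noteq> {x}" and irr: "irreducible_on W R"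
    and nn: "\<forall>e\<in>V \<times> V. 0 \<le> R e"
  shows "irreducible_on (W - {x}) (eliminate V x R)"
  unfolding irreducible_on_def
proof (intro allI impI)
  fix A assume A: "A \<subseteq> W - {x}" "A \<noteq> {}" "A \<noteq> W - {x}"
  have exit: "0 < exit_rate V x R"
    using assms by (rule exit_rate_pos)
  have ge: "R (y, z) \<le> eliminate V x R (y, z)" "R (y, x) * R (x, z) / exit_rate V x R \<le> eliminate V x R (y, z)"
    if "y \<in> W - {x}" "z \<in> W - {x}" for y z
    using that V nn exit by (auto simp: eliminate_def subset_eq)
  from A have "A \<subseteq> W" "A \<noteq> W" "insert x A \<subseteq> W" "insert x A \<noteq> W" using V by auto
  then obtain y z y' z' where yz: "y \<in> A" "z \<in> W - A" "0 < R (y, z)"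
    and yz': "y' \<in> insert x A" "z' \<in> W - insert x A" "0 < R (y', z')"
    using irr A unfolding irreducible_on_def by (metis insert_not_empty)
  show "\<exists>y\<in>A. \<exists>z\<in>W - {x} - A. 0 < eliminate V x R (y, z)"
  proof (cases "z = x \<and> y' = x")
    case True
    then have "0 < R (y, x) * R (x, z') / exit_rate V x R"
      using yz yz' exit by simp
    also have "\<dots> \<le> eliminate V x R (y, z')"
      using yz yz' A by (intro ge) auto
    finally show ?thesis using yz yz' by blast
  next
    case False
    then consider "z \<noteq> x" | "y' \<in> A" using yz' by auto
    then show ?thesis
    proof cases
      case 1
      then have "R (y, z) \<le> eliminate V x R (y, z)"
        using yz A by (intro ge) auto
      with 1 yz show ?thesis by (intro bexI[of _ y] bexI[of _ z]) auto
    next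
      case 2
      then have "R (y', z') \<le> eliminate V x R (y', z')"
        using yz' A by (intro ge) auto
      with 2 yz' show ?thesis by (intro bexI[of _ y'] bexI[of _ z']) auto
    qed
  qed
qed

text \<open>Eliminated vertices stay in V with zero rows and columns, which keeps the index set
  constant under iteration. Harmonicity is asked of the original matrix only: by
  \<open>laplacian_eliminate\<close> it persists at the vertices still waiting in the list.\<close>

lemma fold_eliminate:
  assumes "finite V" "B \<union> set xs \<subseteq> V" "distinct xs" "B \<inter> set xs = {}" "B \<noteq> {}"
    "irreducible_on (B \<union> set xs) R" "\<forall>e\<in>V \<times> V. 0 \<le> R e"
  shows "irreducible_on B (fold (eliminate V) xs R)"
    and "\<And>y. y \<in> B \<Longrightarrow> (\<And>x. x \<in> set xs \<Longrightarrow> laplacian V R p x = 0) \<Longrightarrow>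
      laplacian V (fold (eliminate V) xs R) p y = laplacian V R p y"
proof -
  have "irreducible_on B (fold (eliminate V) xs R) \<and> (\<forall>y\<in>B. (\<forall>x\<in>set xs. laplacian V R p x = 0) \<longrightarrow>
      laplacian V (fold (eliminate V) xs R) p y = laplacian V R p y)"
    using assms(2-)
  proof (induction xs arbitrary: R)
    case (Cons x xs)
    let ?W = "B \<union> set (x # xs)"
    have W: "?W - {x} = B \<union> set xs" using Cons.prems by auto
    have ne: "?W \<noteq> {x}" using Cons.prems by auto
    have exit: "0 < exit_rate V x R"
      by (rule exit_rate_pos[of V ?W]) (use assms(1) Cons.prems ne in auto)
    have irr: "irreducible_on (B \<union> set xs) (eliminate V x R)"
      unfolding W[symmetric]
      by (rule irreducible_on_eliminate) (use assms(1) Cons.prems ne in auto)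
    have nn: "\<forall>e\<in>V \<times> V. 0 \<le> eliminate V x R e"
      by (rule eliminate_nonneg) (use Cons.prems in auto)
    have lap: "laplacian V (eliminate V x R) p y = laplacian V R p y"
      if "laplacian V R p x = 0" "y \<in> B \<union> set xs" for y
      using that exit Cons.prems assms(1) by (intro laplacian_eliminate) auto
    show ?case
      using Cons.IH[of "eliminate V x R"] Cons.prems irr nn lap by auto
  qed simp
  then show "irreducible_on B (fold (eliminate V) xs R)"
    and "\<And>y. y \<in> B \<Longrightarrow> (\<And>x. x \<in> set xs \<Longrightarrow> laplacian V R p x = 0) \<Longrightarrow>
      laplacian V (fold (eliminate V) xs R) p y = laplacian V R p y"
    by auto
qed

lemma eliminate_zero:
  assumes "x \<in> V" "a \<in> V"
  shows "a = x \<or> (\<forall>z\<in>V. R (a, z) = 0) \<Longrightarrow> z \<in> V \<Longrightarrow> eliminate V x R (a, z) = 0"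
    and "a = x \<or> (\<forall>z\<in>V. R (z, a) = 0) \<Longrightarrow> z \<in> V \<Longrightarrow> eliminate V x R (z, a) = 0"
  using assms by (auto simp: eliminate_def)

lemma fold_eliminate_zero:
  assumes "set xs \<subseteq> V" "a \<in> V" "z \<in> V"
  shows "a \<in> set xs \<or> (\<forall>z\<in>V. R (a, z) = 0) \<Longrightarrow> fold (eliminate V) xs R (a, z) = 0"
    and "a \<in> set xs \<or> (\<forall>z\<in>V. R (z, a) = 0) \<Longrightarrow> fold (eliminate V) xs R (z, a) = 0"
  using assms
proof (induction xs arbitrary: R)
  case (Cons x xs)
  {
    case 1
    then have "a \<in> set xs \<or> (\<forall>z\<in>V. eliminate V x R (a, z) = 0)"
      using eliminate_zero(1)[of x V a R] by auto
    then show ?case using Cons.IH(1)[of "eliminate V x R"] 1 by simp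
  next
    case 2
    then have "a \<in> set xs \<or> (\<forall>z\<in>V. eliminate V x R (z, a) = 0)"
      using eliminate_zero(2)[of x V a R] by auto
    then show ?case using Cons.IH(2)[of "eliminate V x R"] 2 by simp
  }
qed simp_all

section \<open>Measurability, and descent of quasi-invariance along eliminations\<close>

lemma measurable_gauge:
  "(\<lambda>(s, R). gauge_transform V (u(x := s)) R) \<in>
     measurable (borel \<Otimes>\<^sub>M PiM (V \<times> V) (\<lambda>_. borel)) (PiM (V \<times> V) (\<lambda>_. borel))"
proof -
  have "(\<lambda>s. (u(x := s)) y) \<in> borel_measurable borel" for y
    by (cases "y = x") auto
  note [measurable] = this
  show ?thesis
    unfolding gauge_transform_def by measurable
qed

lemma measurable_gauge_fixed [measurable]:
  "gauge_transform V u \<in> measurable (PiM (V \<times> V) (\<lambda>_. borel)) (PiM (V \<times> V) (\<lambda>_. borel))"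
  unfolding gauge_transform_def[abs_def] by measurable

lemma measurable_total [measurable]: "total V \<in> borel_measurable (PiM (V \<times> V) (\<lambda>_. borel))"
  unfolding total_def[abs_def] by measurable

lemma measurable_exit_rate [measurable]:
  "x \<in> V \<Longrightarrow> exit_rate V x \<in> borel_measurable (PiM (V \<times> V) (\<lambda>_. borel))"
  unfolding exit_rate_def[abs_def] by measurable

lemma measurable_eliminate [measurable]:
  assumes "x \<in> V"
  shows "eliminate V x \<in> measurable (PiM (V \<times> V) (\<lambda>_. borel)) (PiM (V \<times> V) (\<lambda>_. borel))"
  unfolding eliminate_def[abs_def]
proof (rule measurable_restrict)
  fix e assume "e \<in> V \<times> V"
  with assms show "(\<lambda>R. case e of (y, z) \<Rightarrow> if y = x \<or> z = x then 0
      else R (y, z) + R (y, x) * R (x, z) / exit_rate V x R) \<in> borel_measurable (PiM (V \<times> V) (\<lambda>_. borel))"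
    by (cases e) auto
qed

lemma measurable_fold_eliminate:
  assumes "set xs \<subseteq> V"
  shows "fold (eliminate V) xs \<in> measurable (PiM (V \<times> V) (\<lambda>_. borel)) (PiM (V \<times> V) (\<lambda>_. borel))"
  using assms by (induction xs) (auto intro!: measurable_comp measurable_eliminate simp: id_def[symmetric])

text \<open>As \<open>\<theta>\<close> ignores the value at x, the gauge flow at x preserves the
  reweighted measure. The gauge that is compatible with \<open>eliminate V x\<close> consists of the
  constant gauge \<open>u0\<close>, which vanishes at x, and then this flow for a random time;
  quasi-invariance treats the first and \<open>nn_integral_flow_twist\<close> the second.\<close>

lemma gauge_covariant_eliminate:
  assumes V: "finite V" "x \<in> V" and N: "sigma_finite_measure N"
    and sets [measurable_cong, simp]: "sets N = sets (PiM (V \<times> V) (\<lambda>_. borel))"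
    and cov: "gauge_covariant V N \<theta>" and \<theta>: "\<theta> (\<lambda>_. 0) = 0" "\<And>u s. \<theta> (u(x := s)) = \<theta> u"
    and pos: "AE R in N. (\<forall>e\<in>V \<times> V. 0 \<le> R e) \<and> 0 < exit_rate V x R"
  shows "gauge_covariant V (distr N (PiM (V \<times> V) (\<lambda>_. borel)) (eliminate V x)) \<theta>"
  unfolding gauge_covariant_def
proof (intro allI ballI)
  fix u :: "'a \<Rightarrow> real" and F :: "('a \<times> 'a \<Rightarrow> real) \<Rightarrow> ennreal"
  assume F [measurable]: "F \<in> borel_measurable (PiM (V \<times> V) (\<lambda>_. borel))"
  note [measurable] = measurable_eliminate[OF V(2)] measurable_exit_rate[OF V(2)]
  have space: "space N = extensional (V \<times> V)"
    using sets_eq_imp_space_eq[OF sets] by (simp add: space_PiM PiE_UNIV_domain PiE_def)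
  define g where "g = (\<lambda>(s, R). gauge_transform V ((\<lambda>_. 0)(x := s)) R)"
  define u0 where "u0 = u(x := 0)"
  \<comment> \<open>The argument will be weights already gauged by \<open>u0\<close>, hence the
    inverse gauge inside: the numerator is the exit rate before the gauge, which the flow has to
    restore.\<close>
  define c where "c R = ln (exit_rate V x (gauge_transform V (\<lambda>v. - u0 v) R) / exit_rate V x R)" for R
  define \<tau> where "\<tau> R = ln (exit_rate V x R)" for R
  define G where "G R = F (eliminate V x R)" for R
  define K where "K R = G (g (c R, R)) * ennreal (exp (total V R - total V (g (c R, R))))" for R
  have gm [measurable]: "g \<in> measurable (borel \<Otimes>\<^sub>M N) N"
    unfolding g_def using measurable_gauge[of V "\<lambda>_. 0" x] by (simp cong: measurable_cong_sets)
  have [measurable]: "c \<in> borel_measurable N" "\<tau> \<in> borel_measurable N" "G \<in> borel_measurable N"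
    "total V \<in> borel_measurable N"
    unfolding c_def \<tau>_def G_def by measurable
  have [measurable]: "K \<in> borel_measurable N"
    unfolding K_def by measurable
  have exit_g: "exit_rate V x (g (s, R)) = exp s * exit_rate V x R" for s R
  proof -
    have "exit_rate V x (gauge_transform V ((\<lambda>_. 0)(x := 0)) R) = exit_rate V x R"
      using V exit_rate_gauge[of x V "\<lambda>_. 0" R] by (simp add: exit_rate_def fun_upd_idem)
    then show ?thesis
      using exit_rate_gauge_upd[OF V(2), of "\<lambda>_. 0" s R] by (simp add: g_def)
  qed
  \<comment> \<open>Both exit rates in the quotient are multiplied by the same factor exp s along
    the flow.\<close>
  have c_g: "c (g (s, R)) = c R" for s R
  proof -
    have upd: "(\<lambda>v. - u0 v + ((\<lambda>_. 0)(x := s)) v) = (\<lambda>v. - u0 v)(x := s)"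
      "(\<lambda>v. - u0 v)(x := 0) = (\<lambda>v. - u0 v)"
      by (auto simp: u0_def)
    have "exit_rate V x (gauge_transform V (\<lambda>v. - u0 v) (g (s, R))) = exp s * exit_rate V x (gauge_transform V (\<lambda>v. - u0 v) R)"
      using exit_rate_gauge_upd[OF V(2), of "\<lambda>v. - u0 v" s R]
      unfolding g_def prod.case gauge_gauge upd .
    then show ?thesis
      by (simp add: c_def exit_g)
  qed
  have twist: "(\<integral>\<^sup>+R. K R \<partial>N) = (\<integral>\<^sup>+R. G R \<partial>N)"
    unfolding K_def
  proof (rule nn_integral_flow_twist[where \<tau> = \<tau>])
    fix s t R assume R: "R \<in> space N"
    show "g (s, g (t, R)) = g (s + t, R)"
      unfolding g_def prod.case gauge_gauge by (rule arg_cong[where f = "\<lambda>u. gauge_transform V u R"]) auto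
    show "g (0, R) = R"
      using R gauge_const[of R V 0] by (simp add: g_def space fun_upd_idem)
  next
    show "AE R in N. \<forall>s. \<tau> (g (s, R)) = \<tau> R + s"
      using pos by eventually_elim (simp add: \<tau>_def exit_g ln_mult)
  next
    fix s and F :: "('a \<times> 'a \<Rightarrow> real) \<Rightarrow> ennreal" assume "F \<in> borel_measurable N"
    then have "F \<in> borel_measurable (PiM (V \<times> V) (\<lambda>_. borel))"
      by (simp cong: measurable_cong_sets)
    then show "(\<integral>\<^sup>+R. F (g (s, R)) * ennreal (exp (total V R - total V (g (s, R)))) \<partial>N) = (\<integral>\<^sup>+R. F R \<partial>N)"
      using cov \<theta> by (simp add: gauge_covariant_def g_def)
  qed (use N c_g in auto)
  have "(\<integral>\<^sup>+R. F (gauge_transform V u R) * ennreal (exp (total V R - total V (gauge_transform V u R)))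
        \<partial>distr N (PiM (V \<times> V) (\<lambda>_. borel)) (eliminate V x)) =
      (\<integral>\<^sup>+R. F (gauge_transform V u (eliminate V x R)) *
        ennreal (exp (total V (eliminate V x R) - total V (gauge_transform V u (eliminate V x R)))) \<partial>N)"
    by (rule nn_integral_distr) measurable
  also have "\<dots> = (\<integral>\<^sup>+R. K (gauge_transform V u0 R) * ennreal (exp (total V R - total V (gauge_transform V u0 R))) \<partial>N)"
  proof (rule nn_integral_cong_AE)
    show "AE R in N. F (gauge_transform V u (eliminate V x R)) *
        ennreal (exp (total V (eliminate V x R) - total V (gauge_transform V u (eliminate V x R)))) =
      K (gauge_transform V u0 R) * ennreal (exp (total V R - total V (gauge_transform V u0 R)))"
      using pos AE_space
    proof eventually_elim
      case (elim R)
      define R' where "R' = gauge_transform V u0 R"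
      define s where "s = c R'"
      have undo: "gauge_transform V (\<lambda>v. - u0 v) R' = R"
        unfolding R'_def gauge_gauge using gauge_const[of R V 0] elim by (simp add: space)
      obtain z where z: "z \<in> V - {x}" "0 < R (x, z)"
        using elim V unfolding exit_rate_def by (meson finite_Diff leI less_le_not_le sum_nonpos)
      have "0 < exit_rate V x R'"
        unfolding R'_def exit_rate_gauge[OF V(2)] using z elim V
        by (intro mult_pos_pos sum_pos2[of _ z]) auto
      then have exp_s: "exp s * exit_rate V x R' = exit_rate V x R"
        using elim by (simp add: s_def c_def undo)
      have gR': "g (s, R') = gauge_transform V (u(x := s)) R"
        unfolding g_def R'_def prod.case gauge_gauge u0_def
        by (rule arg_cong[where f = "\<lambda>u. gauge_transform V u R"]) auto
      have exit: "exit_rate V x (gauge_transform V (u(x := s)) R) = exit_rate V x R"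
        using exp_s exit_rate_gauge_upd[OF V(2), of u s R] by (simp add: R'_def u0_def)
      have elim_eq: "eliminate V x (gauge_transform V (u(x := s)) R) = gauge_transform V u (eliminate V x R)"
        using V(2) exit by (rule eliminate_gauge)
      have "total V (eliminate V x R) = total V R - exit_rate V x R - R (x, x)"
        using V elim by (intro total_eliminate) auto
      moreover have "total V (gauge_transform V u (eliminate V x R)) =
          total V (gauge_transform V (u(x := s)) R) - exit_rate V x R - R (x, x)"
        unfolding elim_eq[symmetric] using V elim exit by (subst total_eliminate) (auto simp: gauge_transform_def)
      \<comment> \<open>The amounts lost by elimination agree for both matrices and drop out;
        \<open>total V R'\<close> is inserted to split the exponent between the random-time flow and
        the constant gauge.\<close>
      ultimately have "total V (eliminate V x R) - total V (gauge_transform V u (eliminate V x R)) =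
          (total V R' - total V (g (s, R'))) + (total V R - total V R')"
        by (simp add: gR')
      then show ?case
        unfolding R'_def[symmetric] K_def s_def[symmetric] G_def
        by (simp only: gR' elim_eq exp_add ennreal_mult''[OF exp_ge_zero] mult.assoc)
    qed
  qed
  also have "\<dots> = ennreal (exp (- \<theta> u0)) * (\<integral>\<^sup>+R. K R \<partial>N)"
    using cov \<open>K \<in> borel_measurable N\<close> by (simp add: gauge_covariant_def cong: measurable_cong_sets)
  also have "\<dots> = ennreal (exp (- \<theta> u)) * (\<integral>\<^sup>+R. F (eliminate V x R) \<partial>N)"
    by (simp add: twist G_def u0_def \<theta>)
  also have "(\<integral>\<^sup>+R. F (eliminate V x R) \<partial>N) =
      (\<integral>\<^sup>+R. F R \<partial>distr N (PiM (V \<times> V) (\<lambda>_. borel)) (eliminate V x))"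
    by (rule nn_integral_distr[symmetric]) measurable
  finally show "(\<integral>\<^sup>+R. F (gauge_transform V u R) * ennreal (exp (total V R - total V (gauge_transform V u R)))
        \<partial>distr N (PiM (V \<times> V) (\<lambda>_. borel)) (eliminate V x)) =
      ennreal (exp (- \<theta> u)) * (\<integral>\<^sup>+R. F R \<partial>distr N (PiM (V \<times> V) (\<lambda>_. borel)) (eliminate V x))" .
qed

text \<open>Only finitely many cuts and edges occur. Measurability is what allows the almost sure
  statement to be carried over to image measures.\<close>

lemma measurable_irreducible_on:
  assumes V: "finite V" "W \<subseteq> V"
  shows "Measurable.pred (PiM (V \<times> V) (\<lambda>_. borel)) (\<lambda>R. irreducible_on W R \<and> (\<forall>e\<in>V \<times> V. 0 \<le> R e))"
proof -
  have "finite W" using V finite_subset by blast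
  let ?S = "{A. A \<subseteq> W \<and> A \<noteq> {} \<and> A \<noteq> W}"
  have irr: "irreducible_on W R \<longleftrightarrow> (\<forall>A\<in>?S. \<exists>e\<in>A \<times> (W - A). 0 < R e)" for R
    unfolding irreducible_on_def by (simp add: Bex_def split_paired_all) blast
  have pred: "Measurable.pred (PiM (V \<times> V) (\<lambda>_. borel)) (\<lambda>R. (0::real) < R e)"
    "Measurable.pred (PiM (V \<times> V) (\<lambda>_. borel)) (\<lambda>R. (0::real) \<le> R e)" if "e \<in> V \<times> V" for e :: "'a \<times> 'a"
    using that by measurable
  have "Measurable.pred (PiM (V \<times> V) (\<lambda>_. borel)) (\<lambda>R. \<exists>e\<in>A \<times> (W - A). (0::real) < R e)" if "A \<in> ?S" for A
  proof (rule pred_intros_finite(4))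
    show "finite (A \<times> (W - A))"
      using that \<open>finite W\<close> by (auto intro: finite_subset)
    fix e assume "e \<in> A \<times> (W - A)"
    then have "e \<in> V \<times> V" using that V by auto
    then show "Measurable.pred (PiM (V \<times> V) (\<lambda>_. borel)) (\<lambda>R. (0::real) < R e)"
      by (rule pred)
  qed
  moreover have "finite ?S"
    using \<open>finite W\<close> by simp
  ultimately have "Measurable.pred (PiM (V \<times> V) (\<lambda>_. borel)) (\<lambda>R. irreducible_on W R)"
    unfolding irr by (intro pred_intros_finite(3))
  moreover have "Measurable.pred (PiM (V \<times> V) (\<lambda>_. borel)) (\<lambda>R. \<forall>e\<in>V \<times> V. (0::real) \<le> R e)"
    using V pred(2) by (intro pred_intros_finite(3)) auto
  ultimately show ?thesis
    by (rule pred_intros_logic)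
qed

text \<open>Irreducibility travels with the induction because it supplies the positive exit rate of
  the next vertex; a nonempty \<open>B\<close> guarantees that there is something to exit
  to.\<close>

lemma gauge_covariant_fold_eliminate:
  assumes V: "finite V" "B \<union> set xs \<subseteq> V" and xs: "distinct xs" "B \<inter> set xs = {}" "B \<noteq> {}"
    and N: "prob_space N" "sets N = sets (PiM (V \<times> V) (\<lambda>_. borel))"
    and \<theta>: "\<theta> (\<lambda>_. 0) = 0" "\<And>u x s. x \<in> set xs \<Longrightarrow> \<theta> (u(x := s)) = \<theta> u"
    and irr: "AE R in N. irreducible_on (B \<union> set xs) R \<and> (\<forall>e\<in>V \<times> V. 0 \<le> R e)"
    and cov: "gauge_covariant V N \<theta>"
  shows "gauge_covariant V (distr N (PiM (V \<times> V) (\<lambda>_. borel)) (fold (eliminate V) xs)) \<theta>"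
  using assms
proof (induction xs arbitrary: N)
  case Nil
  then have "distr N (PiM (V \<times> V) (\<lambda>_. borel)) (\<lambda>R. R) = N"
    by (intro distr_id2) simp
  with Nil show ?case by (simp add: id_def)
next
  case (Cons x xs)
  note sets [measurable_cong] = Cons.prems(7)
  have x: "x \<in> V" using Cons.prems by auto
  note [measurable] = measurable_eliminate[OF x]
  let ?P = "PiM (V \<times> V) (\<lambda>_. borel :: real measure)"
  let ?N = "distr N ?P (eliminate V x)"
  interpret N: prob_space N by fact
  let ?W = "B \<union> set (x # xs)"
  have W: "?W - {x} = B \<union> set xs" "?W \<noteq> {x}" "x \<in> ?W" "?W \<subseteq> V" using Cons.prems by auto
  have "gauge_covariant V ?N \<theta>"
  proof (rule gauge_covariant_eliminate)
    show "AE R in N. (\<forall>e\<in>V \<times> V. 0 \<le> R e) \<and> 0 < exit_rate V x R"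
      using Cons.prems(10)
      by eventually_elim (use exit_rate_pos[OF Cons.prems(1) W(4,3,2)] in blast)
    show "\<theta> (u(x := s)) = \<theta> u" for u s
      by (rule Cons.prems(9)) simp
  qed (fact Cons.prems x N.sigma_finite_measure_axioms)+
  moreover have "prob_space ?N"
    by (rule N.prob_space_distr) measurable
  moreover have "AE R in ?N. irreducible_on (B \<union> set xs) R \<and> (\<forall>e\<in>V \<times> V. 0 \<le> R e)"
  proof (subst AE_distr_iff)
    show "eliminate V x \<in> measurable N ?P" by measurable
    show "{R \<in> space ?P. irreducible_on (B \<union> set xs) R \<and> (\<forall>e\<in>V \<times> V. 0 \<le> R e)} \<in> sets ?P"
      using measurable_irreducible_on[of V "B \<union> set xs"] Cons.prems by (auto simp: pred_def)
    show "AE R in N. irreducible_on (B \<union> set xs) (eliminate V x R) \<and> (\<forall>e\<in>V \<times> V. 0 \<le> eliminate V x R e)"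
      using Cons.prems(10)
    proof eventually_elim
      case (elim R)
      then show ?case
        using irreducible_on_eliminate[OF Cons.prems(1) W(4,3,2)] eliminate_nonneg[of V R, OF _ x] W(1)
        by metis
    qed
  qed
  ultimately have "gauge_covariant V (distr ?N ?P (fold (eliminate V) xs)) \<theta>"
  proof (intro Cons.IH)
    show "\<theta> (u(y := s)) = \<theta> u" if "y \<in> set xs" for u y s
      using that by (intro Cons.prems(9)) simp
  qed (use Cons.prems(1-6,8) in simp_all)
  also have "distr ?N ?P (fold (eliminate V) xs) = distr N ?P (fold (eliminate V) (x # xs))"
    using Cons.prems measurable_fold_eliminate[of xs V] by (subst distr_distr) (auto simp: comp_def)
  finally show ?case .
qed

subsection \<open>Escape probabilities\<close>

lemma sets_chain_law [measurable_cong]: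
  "sets (chain_law G \<omega> x) = sets (PiM UNIV (\<lambda>_. count_space UNIV))"
proof -
  interpret IT: Ionescu_Tulcea "chain_kernel G \<omega> x" "\<lambda>_. count_space UNIV"
    by (rule Ionescu_Tulcea_chain_kernel)
  show ?thesis
    unfolding chain_law_def by (rule IT.PF.sets_lim)
qed

lemma space_chain_law [simp]: "space (chain_law G \<omega> x) = UNIV"
  using sets_eq_imp_space_eq[OF sets_chain_law[of G \<omega> x]] by (simp add: space_PiM)

lemma prob_space_chain_law: "prob_space (chain_law G \<omega> x)"
proof
  interpret IT: Ionescu_Tulcea "chain_kernel G \<omega> x" "\<lambda>_. count_space UNIV"
    by (rule Ionescu_Tulcea_chain_kernel)
  let ?M = "\<lambda>_. count_space UNIV :: 'a measure"
  interpret CI: prob_space "IT.CI {}"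
    by (rule IT.PF.prob_space_P) auto
  have CI: "space (IT.CI {}) = space (PiM {} ?M)"
    by (rule IT.PF.space_P) auto
  have emb: "UNIV = prod_emb UNIV ?M {} (space (PiM {} ?M))"
    by (auto simp: prod_emb_def space_PiM)
  have "emeasure IT.PF.lim (prod_emb UNIV ?M {} (space (PiM {} ?M))) = emeasure (IT.CI {}) (space (PiM {} ?M))"
    by (rule IT.lim) (rule finite.emptyI sets.top)+
  then have "emeasure (chain_law G \<omega> x) UNIV = emeasure (IT.CI {}) (space (PiM {} ?M))"
    unfolding chain_law_def emb[symmetric] .
  then show "emeasure (chain_law G \<omega> x) (space (chain_law G \<omega> x)) = 1"
    using CI.emeasure_space_1 CI by simp
qed

lemma pred_coordinate_eq [measurable]:
  "Measurable.pred (PiM UNIV (\<lambda>_. count_space UNIV)) (\<lambda>X :: nat \<Rightarrow> 'a. X k = c)"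
proof -
  have "(\<lambda>X :: nat \<Rightarrow> 'a. X k) \<in> measurable (PiM UNIV (\<lambda>_. count_space UNIV)) (count_space UNIV)"
    by (rule measurable_component_singleton) simp
  from measurable_sets[OF this, of "{c}"] show ?thesis
    by (simp add: pred_def space_PiM vimage_def)
qed

lemma cylinder_measurable [measurable]:
  "{X :: nat \<Rightarrow> 'a. \<forall>k\<le>m. X k = xs k} \<in> sets (PiM UNIV (\<lambda>_. count_space UNIV))"
proof -
  have "Measurable.pred (PiM UNIV (\<lambda>_. count_space UNIV)) (\<lambda>X :: nat \<Rightarrow> 'a. \<forall>k\<le>m. X k = xs k)"
    by measurable
  then show ?thesis by (simp add: pred_def space_PiM)
qed

text \<open>Comparing two possibly infinite infima becomes a countable quantification over
  coordinates, the form that measurability and path arguments can use.\<close>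

lemma hitting_time_less_return_time:
  "hitting_time j X < return_time i X \<longleftrightarrow>
    (\<exists>n. X n = j \<and> (\<forall>t. 1 \<le> t \<longrightarrow> X (t - 1) \<noteq> i \<longrightarrow> X t = i \<longrightarrow> n < t))"
proof -
  have "enat n < return_time i X \<longleftrightarrow> (\<forall>t. 1 \<le> t \<longrightarrow> X (t - 1) \<noteq> i \<longrightarrow> X t = i \<longrightarrow> n < t)" for n
  proof
    assume n: "enat n < return_time i X"
    show "\<forall>t. 1 \<le> t \<longrightarrow> X (t - 1) \<noteq> i \<longrightarrow> X t = i \<longrightarrow> n < t"
    proof (intro allI impI)
      fix t assume "1 \<le> t" "X (t - 1) \<noteq> i" "X t = i"
      then have "return_time i X \<le> enat t"
        unfolding return_time_def by (intro Inf_lower) auto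
      with n show "n < t" using less_le_trans by fastforce
    qed
  next
    assume "\<forall>t. 1 \<le> t \<longrightarrow> X (t - 1) \<noteq> i \<longrightarrow> X t = i \<longrightarrow> n < t"
    then have "enat (Suc n) \<le> return_time i X"
      unfolding return_time_def by (intro Inf_greatest) (auto simp: Suc_le_eq)
    moreover have "enat n < enat (Suc n)" by simp
    ultimately show "enat n < return_time i X" by (rule less_le_trans[rotated])
  qed
  then show ?thesis
    unfolding hitting_time_def by (auto simp: Inf_less_iff)
qed

text \<open>Once the first step leaves i, the first later visit to i is entered from another vertex
  and hence is a return. After a loop step at i this would fail.\<close>

lemma escape_event:
  assumes "X 0 = i" "X 1 \<noteq> i" "i \<noteq> j"
  shows "hitting_time j X < return_time i X \<longleftrightarrow>
    (\<exists>n. X (1 + n) = j \<and> (\<forall>k. 1 \<le> k \<longrightarrow> k < 1 + n \<longrightarrow> X k \<noteq> i \<and> X k \<noteq> j))"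
  unfolding hitting_time_less_return_time
proof
  assume "\<exists>n. X n = j \<and> (\<forall>t. 1 \<le> t \<longrightarrow> X (t - 1) \<noteq> i \<longrightarrow> X t = i \<longrightarrow> n < t)"
  then obtain n where n: "X n = j" "\<And>t. 1 \<le> t \<Longrightarrow> X (t - 1) \<noteq> i \<Longrightarrow> X t = i \<Longrightarrow> n < t"
    by blast
  \<comment> \<open>The witness n may be a later visit to j; the right-hand side describes the first
    one.\<close>
  define m where "m = (LEAST m. X m = j)"
  have m: "X m = j" "m \<le> n" and least: "\<And>k. k < m \<Longrightarrow> X k \<noteq> j"
    unfolding m_def using n by (auto intro: LeastI Least_le dest: not_less_Least)
  have "m \<noteq> 0" using m assms by metis
  \<comment> \<open>By strong induction: a visit to i at time k would have k at least 2 and X (k -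
    1) different from i, so it would be a return before time n.\<close>
  have "X k \<noteq> i" if "1 \<le> k" "k < m" for k
    using that
  proof (induction k rule: nat_less_induct)
    case (1 k)
    show ?case
    proof
      assume "X k = i"
      with assms 1 have "2 \<le> k" by (cases "k = 1") auto
      then have "X (k - 1) \<noteq> i" using 1 by auto
      with \<open>X k = i\<close> 1 m n(2)[of k] show False by simp
    qed
  qed
  with least m \<open>m \<noteq> 0\<close> show "\<exists>n. X (1 + n) = j \<and> (\<forall>k. 1 \<le> k \<longrightarrow> k < 1 + n \<longrightarrow> X k \<noteq> i \<and> X k \<noteq> j)"
    by (intro exI[of _ "m - 1"]) auto
next
  assume "\<exists>n. X (1 + n) = j \<and> (\<forall>k. 1 \<le> k \<longrightarrow> k < 1 + n \<longrightarrow> X k \<noteq> i \<and> X k \<noteq> j)"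
  then obtain n where n: "X (1 + n) = j" "\<And>k. 1 \<le> k \<Longrightarrow> k < 1 + n \<Longrightarrow> X k \<noteq> i"
    by auto
  have "1 + n < t" if "1 \<le> t" "X t = i" for t
    using that n assms by (metis linorder_neqE_nat)
  with n show "\<exists>n. X n = j \<and> (\<forall>t. 1 \<le> t \<longrightarrow> X (t - 1) \<noteq> i \<longrightarrow> X t = i \<longrightarrow> n < t)"
    by blast
qed

text \<open>Probability, starting from x, that the first visit to j is at time n and no visit to i precedes it.\<close>

fun hitting_weight :: "('v \<Rightarrow> 'v \<Rightarrow> real) \<Rightarrow> 'v set \<Rightarrow> 'v \<Rightarrow> 'v \<Rightarrow> nat \<Rightarrow> 'v \<Rightarrow> real" where
  "hitting_weight p V i j 0 x = (if x = j then 1 else 0)"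
| "hitting_weight p V i j (Suc n) x =
     (if x = i \<or> x = j then 0 else (\<Sum>y\<in>V. p x y * hitting_weight p V i j n y))"

section \<open>First-step analysis of the chain in a fixed environment\<close>

locale environment_digraph = pair_fin_digraph +
  fixes \<omega> :: "'a \<times> 'a \<Rightarrow> real"
  assumes environment: "environment G \<omega>"
begin

definition p :: "'a \<Rightarrow> 'a \<Rightarrow> real" where
  "p x y = (if (x, y) \<in> parcs G then \<omega> (x, y) else 0)"

lemma p_nonneg: "0 \<le> p x y"
  using environment by (auto simp: p_def environment_def less_imp_le)

lemma pmf_transition_p: "x \<in> pverts G \<Longrightarrow> pmf (transition G \<omega> x) y = p x y"
  unfolding p_def by (rule pmf_transition[OF pair_fin_digraph_axioms environment])

lemma sum_out_arcs:
  assumes "x \<in> pverts G"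
  shows "(\<Sum>e\<in>out_arcs (with_proj G) x. f e) = (\<Sum>y\<in>pverts G. if (x, y) \<in> parcs G then f (x, y) else 0)"
proof -
  have "out_arcs (with_proj G) x = Pair x ` {y \<in> pverts G. (x, y) \<in> parcs G}"
    using arc_snd_in_verts by (force simp: out_arcs_def)
  then have "(\<Sum>e\<in>out_arcs (with_proj G) x. f e) = (\<Sum>y | y \<in> pverts G \<and> (x, y) \<in> parcs G. f (x, y))"
    by (simp add: sum.reindex inj_on_def)
  then show ?thesis
    using pair_finite_verts by (simp add: sum.inter_filter)
qed

lemma sum_p: "x \<in> pverts G \<Longrightarrow> (\<Sum>y\<in>pverts G. p x y) = 1"
  using environment sum_out_arcs[of x \<omega>] by (simp add: environment_def p_def)

lemma emeasure_cylinder_Suc: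
  assumes "xs m \<in> pverts G"
  shows "emeasure (chain_law G \<omega> i) {X. \<forall>k\<le>Suc m. X k = (xs(Suc m := y)) k} =
    emeasure (chain_law G \<omega> i) {X. \<forall>k\<le>m. X k = xs k} * ennreal (p (xs m) y)"
proof -
  have "(\<Prod>k<m. ennreal (pmf (transition G \<omega> ((xs(Suc m := y)) k)) ((xs(Suc m := y)) (Suc k)))) =
      (\<Prod>k<m. ennreal (pmf (transition G \<omega> (xs k)) (xs (Suc k))))"
    by (intro prod.cong) auto
  then show ?thesis
    unfolding emeasure_chain_law using assms by (simp add: pmf_transition_p)
qed

text \<open>Trajectories take values in the whole vertex type. The one-step extensions inside the
  graph exhaust the mass of the cylinder because the rows of \<open>p\<close> sum to 1.\<close>

lemma AE_cylinder_stays: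
  assumes "xs m \<in> pverts G"
  shows "AE X in chain_law G \<omega> i. (\<forall>k\<le>m. X k = xs k) \<longrightarrow> X (Suc m) \<in> pverts G"
proof -
  let ?M = "chain_law G \<omega> i"
  interpret prob_space ?M by (rule prob_space_chain_law)
  let ?C = "{X. \<forall>k\<le>m. X k = xs k}"
  define D where "D y = {X. \<forall>k\<le>Suc m. X k = (xs(Suc m := y)) k}" for y
  have D_Suc: "X (Suc m) = y" if "X \<in> D y" for X y
    using that unfolding D_def by (elim CollectE allE[of _ "Suc m"]) simp
  have D_Un: "(\<Union>y\<in>pverts G. D y) = {X. (\<forall>k\<le>m. X k = xs k) \<and> X (Suc m) \<in> pverts G}"
    by (auto simp: D_def le_Suc_eq)
  have "emeasure ?M (\<Union>y\<in>pverts G. D y) = (\<Sum>y\<in>pverts G. emeasure ?M (D y))"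
  proof (rule sum_emeasure[symmetric])
    show "disjoint_family_on D (pverts G)"
      unfolding disjoint_family_on_def using D_Suc by blast
    show "D ` pverts G \<subseteq> sets ?M"
      by (rule image_subsetI) (simp only: D_def sets_chain_law cylinder_measurable)
  qed (rule pair_finite_verts)
  also have "\<dots> = emeasure ?M ?C * (\<Sum>y\<in>pverts G. ennreal (p (xs m) y))"
    unfolding D_def emeasure_cylinder_Suc[of xs, OF assms] by (rule sum_distrib_left[symmetric])
  also have "(\<Sum>y\<in>pverts G. ennreal (p (xs m) y)) = 1"
    using p_nonneg sum_p[OF assms] by (simp add: sum_ennreal)
  finally have "emeasure ?M (\<Union>y\<in>pverts G. D y) = emeasure ?M ?C"
    by simp
  moreover have sets: "?C \<in> sets ?M" "(\<Union>y\<in>pverts G. D y) \<in> sets ?M"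
    unfolding sets_chain_law D_def by (intro sets.finite_UN pair_finite_verts cylinder_measurable)+
  ultimately have "emeasure ?M (?C - (\<Union>y\<in>pverts G. D y)) = 0"
    by (subst emeasure_Diff) (auto simp: D_Un)
  with sets have "?C - (\<Union>y\<in>pverts G. D y) \<in> null_sets ?M"
    by auto
  then show ?thesis
    by (rule AE_I') (auto simp: D_Un)
qed

lemma hitting_weight_nonneg: "0 \<le> hitting_weight p V i j n x"
  by (induction n arbitrary: x) (auto intro!: sum_nonneg mult_nonneg_nonneg p_nonneg)

text \<open>The Markov property is used without shifting trajectories: the fixed initial segment
  grows by one state while n decreases, and summing over the next state reproduces the recursion of
  \<open>hitting_weight\<close>.\<close>

lemma emeasure_first_hit:
  assumes "xs m \<in> pverts G" "i \<noteq> j"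
  shows "emeasure (chain_law G \<omega> i)
      {X. (\<forall>k\<le>m. X k = xs k) \<and> X (m + n) = j \<and> (\<forall>k. m \<le> k \<longrightarrow> k < m + n \<longrightarrow> X k \<noteq> i \<and> X k \<noteq> j)} =
    emeasure (chain_law G \<omega> i) {X. \<forall>k\<le>m. X k = xs k} * ennreal (hitting_weight p (pverts G) i j n (xs m))"
  using assms
proof (induction n arbitrary: m xs)
  case 0
  have "{X. (\<forall>k\<le>m. X k = xs k) \<and> X (m + 0) = j \<and> (\<forall>k. m \<le> k \<longrightarrow> k < m + 0 \<longrightarrow> X k \<noteq> i \<and> X k \<noteq> j)} =
      (if xs m = j then {X. \<forall>k\<le>m. X k = xs k} else {})"
    by auto
  then show ?case by simp
next
  case (Suc n)
  let ?M = "chain_law G \<omega> i"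
  let ?h = "hitting_weight p (pverts G) i j"
  define A where "A m n xs = {X. (\<forall>k\<le>m. X k = xs k) \<and> X (m + n) = j \<and>
    (\<forall>k. m \<le> k \<longrightarrow> k < m + n \<longrightarrow> X k \<noteq> i \<and> X k \<noteq> j)}" for m n :: nat and xs
  have A_sets: "A m n xs \<in> sets ?M" for m n xs
  proof -
    have "{X \<in> space (PiM UNIV (\<lambda>_. count_space UNIV)). (\<forall>k\<le>m. X k = xs k) \<and> X (m + n) = j \<and>
        (\<forall>k. m \<le> k \<longrightarrow> k < m + n \<longrightarrow> X k \<noteq> i \<and> X k \<noteq> j)} \<in> sets (PiM UNIV (\<lambda>_. count_space UNIV))"
      by measurable
    then show ?thesis by (simp add: space_PiM sets_chain_law A_def)
  qed
  have A_Suc: "X (Suc m) = y" if "X \<in> A (Suc m) n (xs(Suc m := y))" for X m n y and xs :: "nat \<Rightarrow> 'a"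
  proof -
    from that have "\<forall>k\<le>Suc m. X k = (xs(Suc m := y)) k" by (simp add: A_def)
    from this[rule_format, of "Suc m"] show ?thesis by simp
  qed
  show ?case
  proof (cases "xs m = i \<or> xs m = j")
    case True
    then have "A m (Suc n) xs = {}" by (auto simp: A_def)
    with True show ?thesis
      unfolding A_def[symmetric] by simp
  next
    case False
    note hn = hitting_weight_nonneg
    have "emeasure ?M (A m (Suc n) xs) = emeasure ?M (\<Union>y\<in>pverts G. A (Suc m) n (xs(Suc m := y)))"
    proof (rule emeasure_eq_AE)
      have split: "X \<in> A m (Suc n) xs \<longleftrightarrow> X \<in> A (Suc m) n (xs(Suc m := X (Suc m)))" for X
      proof -
        have "(\<forall>k\<le>Suc m. X k = (xs(Suc m := X (Suc m))) k) \<longleftrightarrow> (\<forall>k\<le>m. X k = xs k)"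
          by (auto simp: le_Suc_eq)
        moreover have "m \<le> k \<longleftrightarrow> k = m \<or> Suc m \<le> k" for k
          by auto
        ultimately show ?thesis
          using False by (auto simp: A_def)
      qed
      show "AE X in ?M. X \<in> A m (Suc n) xs \<longleftrightarrow> X \<in> (\<Union>y\<in>pverts G. A (Suc m) n (xs(Suc m := y)))"
        using AE_cylinder_stays[of xs, OF Suc.prems(1)]
      proof eventually_elim
        case (elim X)
        have "X (Suc m) \<in> pverts G" if "X \<in> A m (Suc n) xs"
          using that elim by (simp add: A_def)
        then show ?case using split A_Suc by blast
      qed
    qed (use A_sets pair_finite_verts in auto)
    also have "\<dots> = (\<Sum>y\<in>pverts G. emeasure ?M (A (Suc m) n (xs(Suc m := y))))"
    proof (rule sum_emeasure[symmetric])
      show "disjoint_family_on (\<lambda>y. A (Suc m) n (xs(Suc m := y))) (pverts G)"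
        unfolding disjoint_family_on_def using A_Suc by blast
    qed (use A_sets pair_finite_verts in auto)
    also have "\<dots> = (\<Sum>y\<in>pverts G. emeasure ?M {X. \<forall>k\<le>m. X k = xs k} * ennreal (p (xs m) y * ?h n y))"
    proof (rule sum.cong[OF refl])
      fix y assume "y \<in> pverts G"
      then show "emeasure ?M (A (Suc m) n (xs(Suc m := y))) =
          emeasure ?M {X. \<forall>k\<le>m. X k = xs k} * ennreal (p (xs m) y * ?h n y)"
        using Suc.IH[of "xs(Suc m := y)" "Suc m"] Suc.prems emeasure_cylinder_Suc[of xs m i y]
        by (simp add: A_def ennreal_mult p_nonneg hn mult.assoc)
    qed
    also have "\<dots> = emeasure ?M {X. \<forall>k\<le>m. X k = xs k} * ennreal (?h (Suc n) (xs m))"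
      using False by (simp add: sum_distrib_left[symmetric] sum_ennreal p_nonneg hn)
    finally show ?thesis unfolding A_def .
  qed
qed

text \<open>The partial sum is the probability of reaching j before time m and before i. First-step
  analysis gives the bound by induction on m, without reference to path space.\<close>

lemma sum_hitting_weight_le:
  assumes "x \<in> pverts G"
  shows "(\<Sum>n<m. hitting_weight p (pverts G) i j n x) \<le> 1"
  using assms
proof (induction m arbitrary: x)
  case (Suc m)
  let ?h = "hitting_weight p (pverts G) i j"
  have "(\<Sum>n<Suc m. ?h n x) = ?h 0 x + (\<Sum>n<m. ?h (Suc n) x)"
    by (rule sum.lessThan_Suc_shift)
  also have "\<dots> \<le> 1"
  proof (cases "x = i \<or> x = j")
    case False
    have "(\<Sum>n<m. ?h (Suc n) x) = (\<Sum>y\<in>pverts G. p x y * (\<Sum>n<m. ?h n y))"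
      using False by (simp add: sum_distrib_left sum.swap[of _ "{..<m}"])
    also have "\<dots> \<le> (\<Sum>y\<in>pverts G. p x y * 1)"
      using Suc.IH by (intro sum_mono mult_left_mono p_nonneg)
    finally show ?thesis
      using False sum_p[OF Suc.prems] by simp
  qed auto
  finally show ?case .
qed simp

lemma summable_hitting_weight:
  "x \<in> pverts G \<Longrightarrow> summable (\<lambda>n. hitting_weight p (pverts G) i j n x)"
  using sum_hitting_weight_le[where x = x and i = i and j = j] hitting_weight_nonneg
  by (intro bounded_imp_summable[of _ 1]) (simp_all flip: lessThan_Suc_atMost del: sum.lessThan_Suc)

text \<open>The witness h x is the probability of reaching j before i, built as the series of
  \<open>hitting_weight\<close>; its recursion is the harmonic equation. Without a loop at i the
  chain leaves i at once, so the escape event splits according to the state at time 1. With a loop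
  the last sum would have to be divided by 1 - p i i, because waiting on the loop does not count as
  a return.\<close>

lemma escape_prob_harmonic:
  assumes i: "i \<in> pverts G" and ij: "i \<noteq> j" and loop: "(i, i) \<notin> parcs G"
  obtains h where "h i = 0" "h j = 1"
    "\<And>x. x \<in> pverts G - {i, j} \<Longrightarrow> (\<Sum>y\<in>pverts G. p x y * h y) = h x"
    "escape_prob G \<omega> i j = (\<Sum>y\<in>pverts G. p i y * h y)"
proof -
  let ?M = "chain_law G \<omega> i"
  let ?h = "hitting_weight p (pverts G) i j"
  define h where "h x = (\<Sum>n. ?h n x)" for x
  interpret prob_space ?M by (rule prob_space_chain_law)
  have ends: "?h n i = 0" "?h (Suc n) j = 0" for n
    using ij by (cases n; simp)+
  have hi: "h i = 0"
    by (simp add: h_def ends)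
  have "h j = (\<Sum>n\<in>{0}. ?h n j)"
    unfolding h_def
  proof (rule suminf_finite)
    show "?h n j = 0" if "n \<notin> {0}" for n
      using that ends(2)[of "n - 1"] by simp
  qed simp
  then have hj: "h j = 1" by simp
  have summable: "summable (\<lambda>n. p x y * ?h n y)" if "y \<in> pverts G" for x y
    using that by (intro summable_mult summable_hitting_weight)
  have summable_p: "summable (\<lambda>n. \<Sum>y\<in>pverts G. p x y * ?h n y)" for x
    by (intro summable_sum summable)
  have suminf_p: "(\<Sum>n. \<Sum>y\<in>pverts G. p x y * ?h n y) = (\<Sum>y\<in>pverts G. p x y * h y)" for x
    using summable by (subst suminf_sum) (auto simp: h_def intro!: sum.cong suminf_mult summable_hitting_weight)
  have harmonic: "(\<Sum>y\<in>pverts G. p x y * h y) = h x" if x: "x \<in> pverts G - {i, j}" for x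
  proof -
    have "(\<Sum>n. ?h (Suc n) x) = (\<Sum>n. ?h n x) - ?h 0 x"
      using x by (intro suminf_split_head summable_hitting_weight) auto
    then show ?thesis
      using x suminf_p[of x] by (simp add: h_def)
  qed
  \<comment> \<open>First visit to j at time 1 + n, with no visit to i after the start.\<close>
  define A where "A n = {X. (\<forall>k\<le>0. X k = i) \<and> X (1 + n) = j \<and> (\<forall>k. 1 \<le> k \<longrightarrow> k < 1 + n \<longrightarrow> X k \<noteq> i \<and> X k \<noteq> j)}" for n :: nat
  \<comment> \<open>\<open>A n\<close> refined by the state y at time 1, in the form to which
    \<open>emeasure_first_hit\<close> applies with m = 1.\<close>
  define B where "B n y = {X. (\<forall>k\<le>1. X k = ((\<lambda>_. i)(Suc 0 := y)) k) \<and> X (1 + n) = j \<and>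
      (\<forall>k. 1 \<le> k \<longrightarrow> k < 1 + n \<longrightarrow> X k \<noteq> i \<and> X k \<noteq> j)}" for n :: nat and y
  have sets: "A n \<in> sets ?M" "B n y \<in> sets ?M" for n y
  proof -
    have "Measurable.pred (PiM UNIV (\<lambda>_. count_space UNIV)) (\<lambda>X. (\<forall>k\<le>0. X k = i) \<and> X (1 + n) = j \<and>
        (\<forall>k. 1 \<le> k \<longrightarrow> k < 1 + n \<longrightarrow> X k \<noteq> i \<and> X k \<noteq> j))"
      by measurable
    then show "A n \<in> sets ?M"
      by (simp add: A_def pred_def space_PiM sets_chain_law)
    have "Measurable.pred (PiM UNIV (\<lambda>_. count_space UNIV)) (\<lambda>X. (\<forall>k\<le>1. X k = ((\<lambda>_. i)(Suc 0 := y)) k) \<and> X (1 + n) = j \<and>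
        (\<forall>k. 1 \<le> k \<longrightarrow> k < 1 + n \<longrightarrow> X k \<noteq> i \<and> X k \<noteq> j))"
      by measurable
    then show "B n y \<in> sets ?M"
      by (simp add: B_def pred_def space_PiM sets_chain_law)
  qed
  have start: "AE X in ?M. X 0 = i"
  proof (rule AE_I_eq_1)
    show "emeasure ?M {X \<in> space ?M. X 0 = i} = 1"
      using emeasure_chain_law[of G \<omega> i 0 "\<lambda>_. i"] by simp
    show "{X \<in> space ?M. X 0 = i} \<in> sets ?M"
      using cylinder_measurable[of 0 "\<lambda>_. i"] by (simp add: sets_chain_law)
  qed
  have "emeasure ?M {X. \<forall>k\<le>Suc 0. X k = ((\<lambda>_. i)(Suc 0 := i)) k} = 0"
    using emeasure_cylinder_Suc[of "\<lambda>_. i" 0 i i] i loop by (simp add: p_def)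
  then have "{X. \<forall>k\<le>Suc 0. X k = ((\<lambda>_. i)(Suc 0 := i)) k} \<in> null_sets ?M"
    using cylinder_measurable by (simp add: null_sets_def sets_chain_law)
  then have "AE X in ?M. \<not> (\<forall>k\<le>Suc 0. X k = ((\<lambda>_. i)(Suc 0 := i)) k)"
    by (rule AE_I') auto
  with start have leave: "AE X in ?M. X 1 \<noteq> i"
    by eventually_elim (auto simp: le_Suc_eq)
  have stay: "AE X in ?M. (\<forall>k\<le>0. X k = i) \<longrightarrow> X (Suc 0) \<in> pverts G"
    using AE_cylinder_stays[of "\<lambda>_. i" 0 i] i by simp
  have B_Suc: "X 1 = y" if "X \<in> B n y" for X n y
  proof -
    from that have "\<forall>k\<le>1. X k = ((\<lambda>_. i)(Suc 0 := y)) k" by (simp add: B_def)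
    from this[rule_format, of 1] show ?thesis by simp
  qed
  have A: "emeasure ?M (A n) = ennreal (\<Sum>y\<in>pverts G. p i y * ?h n y)" for n
  proof -
    have split: "X \<in> A n \<longleftrightarrow> X \<in> B n (X 1)" for X
    proof -
      have "(\<forall>k\<le>1. X k = ((\<lambda>_. i)(Suc 0 := X 1)) k) \<longleftrightarrow> X 0 = i"
        by (auto simp: le_Suc_eq)
      then show ?thesis by (simp add: A_def B_def)
    qed
    have "emeasure ?M (A n) = emeasure ?M (\<Union>y\<in>pverts G. B n y)"
    proof (rule emeasure_eq_AE)
      show "AE X in ?M. X \<in> A n \<longleftrightarrow> X \<in> (\<Union>y\<in>pverts G. B n y)"
        using stay
      proof eventually_elim
        case (elim X)
        have "X 1 \<in> pverts G" if "X \<in> A n"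
          using that elim by (simp add: A_def)
        then show ?case using split B_Suc by blast
      qed
    qed (use sets pair_finite_verts in auto)
    also have "\<dots> = (\<Sum>y\<in>pverts G. emeasure ?M (B n y))"
    proof (rule sum_emeasure[symmetric])
      show "disjoint_family_on (B n) (pverts G)"
        unfolding disjoint_family_on_def using B_Suc by blast
    qed (use sets pair_finite_verts in auto)
    also have "\<dots> = (\<Sum>y\<in>pverts G. ennreal (p i y * ?h n y))"
    proof (rule sum.cong[OF refl])
      fix y assume y: "y \<in> pverts G"
      have "emeasure ?M (B n y) = emeasure ?M {X. \<forall>k\<le>1. X k = ((\<lambda>_. i)(Suc 0 := y)) k} * ennreal (?h n y)"
        using emeasure_first_hit[of "(\<lambda>_. i)(Suc 0 := y)" 1 i j n] y ij unfolding B_def by simp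
      also have "emeasure ?M {X. \<forall>k\<le>1. X k = ((\<lambda>_. i)(Suc 0 := y)) k} = ennreal (p i y)"
        using emeasure_cylinder_Suc[of "\<lambda>_. i" 0 i y] emeasure_chain_law[of G \<omega> i 0 "\<lambda>_. i"] i
        unfolding One_nat_def by simp
      finally show "emeasure ?M (B n y) = ennreal (p i y * ?h n y)"
        by (simp add: ennreal_mult p_nonneg hitting_weight_nonneg)
    qed
    also have "\<dots> = ennreal (\<Sum>y\<in>pverts G. p i y * ?h n y)"
      by (intro sum_ennreal mult_nonneg_nonneg p_nonneg hitting_weight_nonneg)
    finally show ?thesis .
  qed
  have "AE X in ?M. X \<in> {X. hitting_time j X < return_time i X} \<longleftrightarrow> X \<in> (\<Union>n. A n)"
    using start leave
  proof eventually_elim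
    case (elim X)
    then show ?case using escape_event[of X i j] ij by (simp add: A_def)
  qed
  then have "emeasure ?M {X. hitting_time j X < return_time i X} = emeasure ?M (\<Union>n. A n)"
  proof (rule emeasure_eq_AE)
    have "Measurable.pred (PiM UNIV (\<lambda>_. count_space UNIV))
        (\<lambda>X :: nat \<Rightarrow> 'a. \<exists>n. X n = j \<and> (\<forall>t. 1 \<le> t \<longrightarrow> X (t - 1) \<noteq> i \<longrightarrow> X t = i \<longrightarrow> n < t))"
      by measurable
    then show "{X. hitting_time j X < return_time i X} \<in> sets ?M"
      unfolding hitting_time_less_return_time by (simp only: pred_def space_PiM sets_chain_law space_count_space PiE_UNIV_domain Pi_UNIV UNIV_I simp_thms)
  qed (use sets in auto)
  also have "\<dots> = (\<Sum>n. emeasure ?M (A n))"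
  proof (rule suminf_emeasure[symmetric])
    show "disjoint_family A"
      unfolding disjoint_family_on_def
    proof (intro ballI impI)
      fix m n :: nat assume "m \<noteq> n"
      have "X \<notin> A n" if "X \<in> A m" "m < n" for X m n
        using that unfolding A_def mem_Collect_eq by (metis add_less_cancel_left le_add1)
      with \<open>m \<noteq> n\<close> show "A m \<inter> A n = {}"
        by (metis disjoint_iff linorder_neqE_nat)
    qed
  qed (use sets in auto)
  also have "\<dots> = ennreal (\<Sum>y\<in>pverts G. p i y * h y)"
    unfolding A suminf_p[symmetric]
    by (intro suminf_ennreal_eq summable_sums summable_p sum_nonneg mult_nonneg_nonneg p_nonneg hitting_weight_nonneg)
  finally have "escape_prob G \<omega> i j = (\<Sum>y\<in>pverts G. p i y * h y)"
    unfolding escape_prob_def measure_def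
    by (simp add: suminf_p[symmetric] suminf_nonneg summable_p sum_nonneg p_nonneg hitting_weight_nonneg)
  with hi hj harmonic show thesis
    by (rule that)
qed

end

section \<open>Escape probabilities as entries of the eliminated matrix\<close>

lemma (in pair_wf_digraph) irreducible_on_strongly_connected:
  assumes sc: "strongly_connected (with_proj G)" and pos: "\<And>e. e \<in> parcs G \<Longrightarrow> 0 < R e"
  shows "irreducible_on (pverts G) R"
  unfolding irreducible_on_def
proof (intro allI impI, rule ccontr)
  fix A assume A: "A \<subseteq> pverts G" "A \<noteq> {}" "A \<noteq> pverts G"
    and no: "\<not> (\<exists>y\<in>A. \<exists>z\<in>pverts G - A. 0 < R (y, z))"
  obtain a b where ab: "a \<in> A" "b \<in> pverts G" "b \<notin> A" using A by blast
  then have "a \<rightarrow>\<^sup>*\<^bsub>with_proj G\<^esub> b"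
    using sc A by (auto simp: strongly_connected_def)
  then have "b \<in> A"
  proof (induction rule: reachable_induct)
    case (step x y)
    then have "(x, y) \<in> parcs G" by simp
    moreover from this have "y \<in> pverts G" using arc_snd_in_verts[of "(x, y)"] by simp
    ultimately show ?case using no pos step by blast
  qed (rule ab)
  with ab show False by simp
qed

lemma irreducible_on_pair:
  assumes "irreducible_on {i, j} R" "i \<noteq> j"
  shows "0 < R (i, j)"
  using assms unfolding irreducible_on_def by (auto dest!: spec[of _ "{i}"])

text \<open>The columns of eliminated vertices vanish, which leaves a single term with the factor h
  j - h i = 1.\<close>

lemma laplacian_fold_eliminate_pair:
  assumes V: "finite V" "i \<in> V" "j \<in> V" "i \<noteq> j" and xs: "set xs = V - {i, j}" and h: "h i = 0" "h j = 1"
  shows "laplacian V (fold (eliminate V) xs R) h i = fold (eliminate V) xs R (i, j)"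
proof -
  let ?R = "fold (eliminate V) xs R"
  have "?R (i, z) = 0" if "z \<in> V - {i, j}" for z
    using fold_eliminate_zero(2)[of xs V z i R] that V xs by auto
  then have "laplacian V ?R h i = (\<Sum>z\<in>{i, j}. ?R (i, z) * (h z - h i))"
    unfolding laplacian_def using V by (intro sum.mono_neutral_right) auto
  then show ?thesis using V h by simp
qed

context environment_digraph
begin

text \<open>The Laplacian of h at i is computed twice: after the elimination it is the entry (i, j),
  before it is c i times the escape probability. The row factors \<open>c\<close> cancel in the
  harmonic equation at the eliminated vertices, so only c i survives.\<close>

lemma fold_eliminate_escape_prob:
  assumes sc: "strongly_connected (with_proj G)"
    and ij: "i \<in> pverts G" "j \<in> pverts G" "i \<noteq> j" and loop: "(i, i) \<notin> parcs G"
    and xs: "distinct xs" "set xs = pverts G - {i, j}"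
    and c: "\<And>x. x \<in> pverts G \<Longrightarrow> 0 < c x"
    and R: "\<And>x y. x \<in> pverts G \<Longrightarrow> y \<in> pverts G \<Longrightarrow> R (x, y) = c x * p x y"
  shows "fold (eliminate (pverts G)) xs R (i, j) = c i * escape_prob G \<omega> i j"
proof -
  let ?V = "pverts G"
  obtain h where h: "h i = 0" "h j = 1"
    and harm: "\<And>x. x \<in> ?V - {i, j} \<Longrightarrow> (\<Sum>y\<in>?V. p x y * h y) = h x"
    and esc: "escape_prob G \<omega> i j = (\<Sum>y\<in>?V. p i y * h y)"
    using escape_prob_harmonic[OF ij(1,3) loop] by metis
  have lap: "laplacian ?V R h x = c x * ((\<Sum>y\<in>?V. p x y * h y) - h x)" if x: "x \<in> ?V" for x
  proof -
    have "laplacian ?V R h x = (\<Sum>y\<in>?V. c x * (p x y * h y) - c x * (p x y * h x))"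
      unfolding laplacian_def using x R by (intro sum.cong) (auto simp: algebra_simps)
    also have "\<dots> = c x * (\<Sum>y\<in>?V. p x y * h y) - c x * ((\<Sum>y\<in>?V. p x y) * h x)"
      by (simp add: sum_subtractf sum_distrib_left sum_distrib_right)
    finally show ?thesis
      using sum_p[OF x] by (simp add: algebra_simps)
  qed
  have nn: "\<forall>e\<in>?V \<times> ?V. 0 \<le> R e"
    using c p_nonneg by (auto simp: R intro!: mult_nonneg_nonneg intro: less_imp_le)
  have "0 < R e" if "e \<in> parcs G" for e
  proof -
    obtain x y where e: "e = (x, y)" by (cases e)
    have "x \<in> ?V" "y \<in> ?V" using arc_fst_in_verts[OF that] arc_snd_in_verts[OF that] by (simp_all add: e)
    then show ?thesis
      using that c environment by (simp add: e R p_def environment_def)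
  qed
  then have irr: "irreducible_on ({i, j} \<union> set xs) R"
    using irreducible_on_strongly_connected[OF sc] ij xs by (simp add: insert_absorb)
  have "fold (eliminate ?V) xs R (i, j) = laplacian ?V (fold (eliminate ?V) xs R) h i"
    using ij xs h pair_finite_verts by (intro laplacian_fold_eliminate_pair[symmetric]) auto
  also have "\<dots> = laplacian ?V R h i"
    by (rule fold_eliminate(2)[of _ "{i, j}"]) (use pair_finite_verts ij xs irr nn lap harm in auto)
  also have "\<dots> = c i * escape_prob G \<omega> i j"
    using lap[OF ij(1)] h esc by simp
  finally show ?thesis .
qed

end

text \<open>The chain stands still at i. This fixes the value off the set of environments, where
  measurability of the escape probability still has to hold.\<close>

lemma escape_prob_not_environment:
  assumes "\<not> environment G \<omega>" "i \<noteq> j"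
  shows "escape_prob G \<omega> i j = 0"
proof -
  let ?M = "chain_law G \<omega> i"
  interpret prob_space ?M by (rule prob_space_chain_law)
  have "AE X in ?M. X n = i" for n
  proof -
    have "AE X in ?M. X \<in> {X. \<forall>k\<le>n. X k = (\<lambda>_. i) k}"
    proof (rule AE_prob_1)
      show "prob {X. \<forall>k\<le>n. X k = (\<lambda>_. i) k} = 1"
        unfolding measure_def emeasure_chain_law using assms(1) by (simp add: transition_def)
    qed
    then show ?thesis by eventually_elim auto
  qed
  then have "AE X in ?M. \<forall>n. X n = i"
    by (simp add: AE_all_countable)
  then have "AE X in ?M. \<not> hitting_time j X < return_time i X"
    by eventually_elim (use assms(2) in \<open>auto simp: hitting_time_less_return_time\<close>)
  then show ?thesis
    unfolding escape_prob_def measure_def using emeasure_eq_0_AE[of "\<lambda>X. hitting_time j X < return_time i X" ?M]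
    by simp
qed

text \<open>Absent arcs become zero entries, which gauge transformations preserve. The full square
  is required because elimination creates positive entries where there was no arc.\<close>

definition matrix_of_arcs :: "'v pair_pre_digraph \<Rightarrow> ('v \<times> 'v \<Rightarrow> real) \<Rightarrow> 'v \<times> 'v \<Rightarrow> real" where
  "matrix_of_arcs G W = (\<lambda>e\<in>pverts G \<times> pverts G. if e \<in> parcs G then W e else 0)"

section \<open>Arc weights as matrices: measurability and the initial quasi-invariance\<close>

context pair_fin_digraph
begin

lemma arcs_subset: "parcs G \<subseteq> pverts G \<times> pverts G"
  using arc_fst_in_verts arc_snd_in_verts by (auto simp: subset_iff mem_Times_iff)

lemma measurable_matrix_of_arcs [measurable]:
  "matrix_of_arcs G \<in> measurable (PiM (parcs G) (\<lambda>_. borel)) (PiM (pverts G \<times> pverts G) (\<lambda>_. borel))"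
  unfolding matrix_of_arcs_def[abs_def]
proof (rule measurable_restrict)
  fix e show "(\<lambda>W. if e \<in> parcs G then W e else 0) \<in> borel_measurable (PiM (parcs G) (\<lambda>_. borel))"
    by (cases "e \<in> parcs G") auto
qed

lemma measurable_fold_eliminate_entry:
  assumes "set xs \<subseteq> pverts G" "e \<in> pverts G \<times> pverts G"
  shows "(\<lambda>W. fold (eliminate (pverts G)) xs (matrix_of_arcs G W) e) \<in> borel_measurable (PiM (parcs G) (\<lambda>_. borel))"
proof -
  note [measurable] = measurable_fold_eliminate[OF assms(1)]
  show ?thesis
    using assms(2) by (intro measurable_compose[OF _ measurable_component_singleton[of e]]) measurable
qed

lemma finite_out_arcs: "finite (out_arcs (with_proj G) x)"
  and out_arcs_subset: "out_arcs (with_proj G) x \<subseteq> parcs G"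
  using pair_finite_arcs by (auto simp: out_arcs_def)

lemma measurable_environment: "Measurable.pred (PiM (parcs G) (\<lambda>_. borel)) (environment G)"
proof -
  have "(\<lambda>\<omega>. \<Sum>e\<in>out_arcs (with_proj G) x. \<omega> e) \<in> borel_measurable (PiM (parcs G) (\<lambda>_. borel :: real measure))" for x
    using out_arcs_subset by (intro borel_measurable_sum measurable_component_singleton) auto
  note [measurable] = this
  show ?thesis
    unfolding environment_def using pair_finite_arcs pair_finite_verts by measurable
qed

text \<open>On environments, elimination writes the escape probability as an explicit rational
  expression in the entries; this replaces a study of how \<open>chain_law\<close> depends on the
  environment.\<close>

lemma measurable_escape_prob:
  assumes sc: "strongly_connected (with_proj G)"
    and ij: "i \<in> pverts G" "j \<in> pverts G" "i \<noteq> j" and loop: "(i, i) \<notin> parcs G"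
  shows "(\<lambda>\<omega>. escape_prob G \<omega> i j) \<in> borel_measurable (PiM (parcs G) (\<lambda>_. borel))"
proof -
  obtain xs where xs: "distinct xs" "set xs = pverts G - {i, j}"
    using finite_distinct_list[of "pverts G - {i, j}"] pair_finite_verts by auto
  have esc: "escape_prob G \<omega> i j =
      (if environment G \<omega> then fold (eliminate (pverts G)) xs (matrix_of_arcs G \<omega>) (i, j) else 0)" for \<omega>
  proof (cases "environment G \<omega>")
    case True
    interpret environment_digraph G \<omega>
      by unfold_locales (fact True)
    show ?thesis
      using fold_eliminate_escape_prob[OF sc ij loop xs, of "\<lambda>_. 1" "matrix_of_arcs G \<omega>"] True
      by (simp add: matrix_of_arcs_def p_def)
  qed (simp add: escape_prob_not_environment ij)
  show ?thesis
    unfolding esc using xs ij measurable_environment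
    by (intro measurable_If measurable_const measurable_fold_eliminate_entry) (auto simp: pred_def)
qed

text \<open>Summation by parts: the arcs are grouped once by tail and once by head.\<close>

lemma sum_divergence:
  "(\<Sum>e\<in>parcs G. a e * (u (fst e) - u (snd e))) = (\<Sum>x\<in>pverts G. u x * divergence (with_proj G) a x)"
proof -
  have "(\<Sum>e\<in>parcs G. a e * u (fst e)) = (\<Sum>x\<in>pverts G. \<Sum>e | e \<in> parcs G \<and> fst e = x. a e * u (fst e))"
    using pair_finite_arcs pair_finite_verts by (intro sum.group[symmetric]) (auto dest: arc_fst_in_verts)
  also have "\<dots> = (\<Sum>x\<in>pverts G. u x * (\<Sum>e\<in>out_arcs (with_proj G) x. a e))"
    by (intro sum.cong) (auto simp: out_arcs_def sum_distrib_left mult.commute intro!: sum.cong)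
  finally have 1: "(\<Sum>e\<in>parcs G. a e * u (fst e)) = \<dots>" .
  have "(\<Sum>e\<in>parcs G. a e * u (snd e)) = (\<Sum>x\<in>pverts G. \<Sum>e | e \<in> parcs G \<and> snd e = x. a e * u (snd e))"
    using pair_finite_arcs pair_finite_verts by (intro sum.group[symmetric]) (auto dest: arc_snd_in_verts)
  also have "\<dots> = (\<Sum>x\<in>pverts G. u x * (\<Sum>e\<in>in_arcs (with_proj G) x. a e))"
    by (intro sum.cong) (auto simp: in_arcs_def sum_distrib_left mult.commute intro!: sum.cong)
  finally have 2: "(\<Sum>e\<in>parcs G. a e * u (snd e)) = \<dots>" .
  show ?thesis
    using 1 2 by (simp add: divergence_def right_diff_distrib sum_subtractf)
qed

text \<open>On the arcs a gauge scales each coordinate by exp of the decrease of u along the arc, so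
  the Gamma scaling applies; \<open>sum_divergence\<close> turns the resulting exponent into
  divergences.\<close>

lemma gauge_covariant_gamma:
  assumes a: "\<And>e. e \<in> parcs G \<Longrightarrow> 0 < a e"
  shows "gauge_covariant (pverts G)
    (distr (PiM (parcs G) (\<lambda>e. gamma_law (a e))) (PiM (pverts G \<times> pverts G) (\<lambda>_. borel)) (matrix_of_arcs G))
    (\<lambda>u. \<Sum>x\<in>pverts G. u x * divergence (with_proj G) a x)"
  unfolding gauge_covariant_def
proof (intro allI ballI)
  fix u :: "'a \<Rightarrow> real" and F :: "('a \<times> 'a \<Rightarrow> real) \<Rightarrow> ennreal"
  let ?V = "pverts G" let ?P = "PiM (?V \<times> ?V) (\<lambda>_. borel :: real measure)"
  let ?N = "PiM (parcs G) (\<lambda>e. gamma_law (a e))"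
  assume F [measurable]: "F \<in> borel_measurable ?P"
  let ?s = "\<lambda>W. \<lambda>e\<in>parcs G. exp (u (fst e) - u (snd e)) * W e"
  have gauge: "gauge_transform ?V u (matrix_of_arcs G W) = matrix_of_arcs G (?s W)" for W
    by (auto simp: gauge_transform_def matrix_of_arcs_def restrict_def fun_eq_iff)
  have total: "total ?V (matrix_of_arcs G W) = (\<Sum>e\<in>parcs G. W e)" for W
  proof -
    have "total ?V (matrix_of_arcs G W) = (\<Sum>e\<in>?V \<times> ?V. if e \<in> parcs G then W e else 0)"
      unfolding total_def by (intro sum.cong) (auto simp: matrix_of_arcs_def)
    also have "\<dots> = (\<Sum>e\<in>parcs G. W e)"
      using pair_finite_verts arcs_subset by (simp add: sum.If_cases Int_absorb1)
    finally show ?thesis .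
  qed
  have "(\<integral>\<^sup>+R. F (gauge_transform ?V u R) * ennreal (exp (total ?V R - total ?V (gauge_transform ?V u R)))
        \<partial>distr ?N ?P (matrix_of_arcs G)) =
      (\<integral>\<^sup>+W. F (gauge_transform ?V u (matrix_of_arcs G W)) *
        ennreal (exp (total ?V (matrix_of_arcs G W) - total ?V (gauge_transform ?V u (matrix_of_arcs G W)))) \<partial>?N)"
    by (rule nn_integral_distr) measurable
  also have "\<dots> = (\<integral>\<^sup>+W. F (matrix_of_arcs G (?s W)) *
        ennreal (exp (\<Sum>e\<in>parcs G. W e - exp (u (fst e) - u (snd e)) * W e)) \<partial>?N)"
    unfolding gauge total by (simp add: sum_subtractf)
  also have "\<dots> = ennreal (exp (- (\<Sum>e\<in>parcs G. a e * (u (fst e) - u (snd e))))) * (\<integral>\<^sup>+W. F (matrix_of_arcs G W) \<partial>?N)"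
    by (rule nn_integral_PiM_gamma_law_scale[OF pair_finite_arcs a]) measurable
  also have "(\<integral>\<^sup>+W. F (matrix_of_arcs G W) \<partial>?N) = (\<integral>\<^sup>+R. F R \<partial>distr ?N ?P (matrix_of_arcs G))"
    by (rule nn_integral_distr[symmetric]) measurable
  finally show "(\<integral>\<^sup>+R. F (gauge_transform ?V u R) * ennreal (exp (total ?V R - total ?V (gauge_transform ?V u R)))
        \<partial>distr ?N ?P (matrix_of_arcs G)) =
      ennreal (exp (- (\<Sum>x\<in>?V. u x * divergence (with_proj G) a x))) * (\<integral>\<^sup>+R. F R \<partial>distr ?N ?P (matrix_of_arcs G))"
    unfolding sum_divergence .
qed

end

subsection \<open>Reduction to independent Gamma weights\<close>

text \<open>Lets independent variables at all vertices stand in for the two at i and j: the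
  remaining factors have mass 1.\<close>

lemma distr_PiM_pair:
  assumes V: "finite V" "i \<in> V" "j \<in> V" "i \<noteq> j"
    and N: "product_sigma_finite N" "\<And>x. x \<in> V \<Longrightarrow> prob_space (N x)"
  shows "distr (PiM V N) (N i \<Otimes>\<^sub>M N j) (\<lambda>b. (b i, b j)) = N i \<Otimes>\<^sub>M N j"
proof (rule pair_measure_eqI[symmetric])
  interpret product_sigma_finite N by fact
  show "sigma_finite_measure (N i)" "sigma_finite_measure (N j)"
    by (rule sigma_finite_measures)+
  fix A B assume AB: "A \<in> sets (N i)" "B \<in> sets (N j)"
  let ?C = "\<lambda>x. if x = i then A else if x = j then B else space (N x)"
  have rv: "(\<lambda>b. (b i, b j)) \<in> measurable (PiM V N) (N i \<Otimes>\<^sub>M N j)"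
    using V by measurable
  have "(\<lambda>b. (b i, b j)) -` (A \<times> B) \<inter> space (PiM V N) = PiE V ?C"
    using V AB[THEN sets.sets_into_space] by (auto simp: space_PiM PiE_iff subset_eq split: if_splits)
  then have "emeasure (distr (PiM V N) (N i \<Otimes>\<^sub>M N j) (\<lambda>b. (b i, b j))) (A \<times> B) = emeasure (PiM V N) (PiE V ?C)"
    using AB rv by (subst emeasure_distr) auto
  also have "\<dots> = (\<Prod>x\<in>V. emeasure (N x) (?C x))"
    using V AB by (intro emeasure_PiM) auto
  also have "\<dots> = emeasure (N i) A * (emeasure (N j) B * (\<Prod>x\<in>V - {i} - {j}. emeasure (N x) (?C x)))"
    using V by (subst prod.remove[of V i], simp, simp, subst prod.remove[of "V - {i}" j]) auto
  also have "(\<Prod>x\<in>V - {i} - {j}. emeasure (N x) (?C x)) = 1"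
    using N(2) by (intro prod.neutral) (auto simp: prob_space.emeasure_space_1)
  finally show "emeasure (N i) A * emeasure (N j) B =
      emeasure (distr (PiM V N) (N i \<Otimes>\<^sub>M N j) (\<lambda>b. (b i, b j))) (A \<times> B)"
    by simp
qed simp

text \<open>A vertex without outgoing arcs would give its Gamma variable the degenerate parameter
  0.\<close>

locale dirichlet_digraph = pair_fin_digraph +
  fixes a :: "'a \<times> 'a \<Rightarrow> real"
  assumes weight_pos: "\<And>e. e \<in> parcs G \<Longrightarrow> 0 < a e"
    and out_arcs_nonempty: "\<And>x. x \<in> pverts G \<Longrightarrow> out_arcs (with_proj G) x \<noteq> {}"
begin

abbreviation "out \<equiv> out_arcs (with_proj G)"
abbreviation "row_law \<equiv> PiM (pverts G) (\<lambda>x. dirichlet_law (out x) a)"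
abbreviation "beta_law \<equiv> PiM (pverts G) (\<lambda>x. gamma_law (vertex_weight (with_proj G) a x))"

lemma vertex_weight_pos: "x \<in> pverts G \<Longrightarrow> 0 < vertex_weight (with_proj G) a x"
  unfolding vertex_weight_def using out_arcs_subset
  by (intro sum_pos finite_out_arcs out_arcs_nonempty weight_pos) auto

lemma prob_space_row: "prob_space (dirichlet_law (out x) a)"
  using out_arcs_subset by (intro prob_space_dirichlet_law finite_out_arcs weight_pos) auto

lemma product_sigma_finite_row_law: "product_sigma_finite (\<lambda>x. dirichlet_law (out x) a)"
  by (intro product_sigma_finite.intro prob_space_imp_sigma_finite prob_space_row)

lemma prob_space_row_law: "prob_space row_law"
  by (intro prob_space_PiM prob_space_row)

lemma sets_row_law [measurable_cong]: "sets row_law = sets (PiM (pverts G) (\<lambda>x. PiM (out x) (\<lambda>_. borel)))"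
  by (intro sets_PiM_cong) auto

lemma measurable_row_entry:
  assumes "e \<in> parcs G"
  shows "(\<lambda>\<eta>. \<eta> (fst e) e) \<in> borel_measurable (PiM (pverts G) (\<lambda>x. PiM (out x) (\<lambda>_. borel)))"
proof -
  have "(\<lambda>\<eta>. \<eta> (fst e)) \<in> measurable (PiM (pverts G) (\<lambda>x. PiM (out x) (\<lambda>_. borel))) (PiM (out (fst e)) (\<lambda>_. borel))"
    by (rule measurable_component_singleton) (rule arc_fst_in_verts[OF assms])
  then show ?thesis
    by (rule measurable_compose[OF _ measurable_component_singleton]) (simp add: assms)
qed

lemma measurable_glue [measurable]:
  "(\<lambda>\<eta>. \<lambda>e\<in>parcs G. \<eta> (fst e) e) \<in> measurable row_law (PiM (parcs G) (\<lambda>_. borel))"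
proof -
  note [measurable] = measurable_row_entry
  show ?thesis by measurable
qed

lemma sets_dirichlet_environment [measurable_cong]:
  "sets (dirichlet_environment G a) = sets (PiM (parcs G) (\<lambda>_. borel))"
  by (simp add: dirichlet_environment_def)

lemma prob_space_dirichlet_environment: "prob_space (dirichlet_environment G a)"
  unfolding dirichlet_environment_def
  by (intro prob_space.prob_space_distr prob_space_row_law measurable_glue)

lemma AE_dirichlet_environment: "AE \<omega> in dirichlet_environment G a. environment G \<omega>"
proof -
  have "AE \<eta> in row_law. \<forall>x\<in>pverts G. (\<forall>e\<in>out x. 0 < \<eta> x e \<and> \<eta> x e \<le> 1) \<and> (\<Sum>e\<in>out x. \<eta> x e) = 1"
  proof (rule AE_finite_allI[OF pair_finite_verts])
    fix x assume x: "x \<in> pverts G"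
    have "AE \<eta> in dirichlet_law (out x) a. (\<forall>e\<in>out x. 0 < \<eta> e \<and> \<eta> e \<le> 1) \<and> (\<Sum>e\<in>out x. \<eta> e) = 1"
      using out_arcs_subset x by (intro AE_dirichlet_law finite_out_arcs out_arcs_nonempty weight_pos) auto
    with x show "AE \<eta> in row_law. (\<forall>e\<in>out x. 0 < \<eta> x e \<and> \<eta> x e \<le> 1) \<and> (\<Sum>e\<in>out x. \<eta> x e) = 1"
      by (intro AE_PiM_component[where P = "\<lambda>\<eta>. (\<forall>e\<in>out x. 0 < \<eta> e \<and> \<eta> e \<le> 1) \<and> (\<Sum>e\<in>out x. \<eta> e) = 1"] prob_space_row)
  qed
  then have "AE \<eta> in row_law. environment G (\<lambda>e\<in>parcs G. \<eta> (fst e) e)"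
  proof eventually_elim
    case (elim \<eta>)
    have "0 < \<eta> (fst e) e \<and> \<eta> (fst e) e \<le> 1" if "e \<in> parcs G" for e
    proof -
      have "e \<in> out (fst e)" using that by (simp add: out_arcs_def)
      then show ?thesis using elim arc_fst_in_verts[OF that] by blast
    qed
    moreover have "(\<Sum>e\<in>out x. (\<lambda>e\<in>parcs G. \<eta> (fst e) e) e) = (\<Sum>e\<in>out x. \<eta> x e)" for x
      by (intro sum.cong) (auto simp: out_arcs_def)
    ultimately show ?case
      using elim by (auto simp: environment_def)
  qed
  then show ?thesis
    unfolding dirichlet_environment_def using measurable_environment
    by (subst AE_distr_iff) (auto simp: pred_def intro: measurable_glue)
qed

text \<open>Rows are independent, so on boxes the integrand factors over the vertices and each
  factor is \<open>nn_integral_gamma_dirichlet\<close>; grouping the arcs by tail reassembles the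
  product over all arcs.\<close>

lemma nn_integral_gamma_dirichlet_environment:
  assumes F [measurable]: "F \<in> borel_measurable (PiM (parcs G) (\<lambda>_. borel))"
  shows "(\<integral>\<^sup>+b. \<integral>\<^sup>+\<omega>. F (\<lambda>e\<in>parcs G. b (fst e) * \<omega> e) \<partial>dirichlet_environment G a \<partial>beta_law) =
    (\<integral>\<^sup>+W. F W \<partial>PiM (parcs G) (\<lambda>e. gamma_law (a e)))"
proof -
  interpret rl: prob_space row_law by (rule prob_space_row_law)
  interpret g: product_sigma_finite "\<lambda>e. gamma_law (a e)"
    by (rule product_sigma_finite_gamma_law)
  interpret b: product_sigma_finite "\<lambda>x. gamma_law (vertex_weight (with_proj G) a x)"
    by (rule product_sigma_finite_gamma_law)
  interpret d: product_sigma_finite "\<lambda>x. dirichlet_law (out x) a"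
    by (rule product_sigma_finite_row_law)
  let ?P = "PiM (parcs G) (\<lambda>_. borel :: real measure)"
  let ?f = "\<lambda>(b, \<eta>). \<lambda>e\<in>parcs G. b (fst e) * \<eta> (fst e) e"
  have f [measurable]: "?f \<in> measurable (beta_law \<Otimes>\<^sub>M row_law) ?P"
  proof -
    have entry: "(\<lambda>b. b (fst e)) \<in> borel_measurable (PiM (pverts G) (\<lambda>_. borel :: real measure))" if "e \<in> parcs G" for e
      by (rule measurable_component_singleton) (rule arc_fst_in_verts[OF that])
    note [measurable] = this measurable_row_entry
    show ?thesis by measurable
  qed
  define D where "D = distr (beta_law \<Otimes>\<^sub>M row_law) ?P ?f"
  have "D = PiM (parcs G) (\<lambda>e. gamma_law (a e))"
  proof (rule g.PiM_eqI)
    fix A assume "\<And>e. e \<in> parcs G \<Longrightarrow> A e \<in> sets (gamma_law (a e))"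
    then have A: "A e \<in> sets borel" if "e \<in> parcs G" for e using that by simp
    have box [measurable]: "PiE (parcs G) A \<in> sets ?P"
      using A by (intro sets_PiM_I_finite pair_finite_arcs)
    have outA [measurable]: "PiE (out x) A \<in> sets (PiM (out x) (\<lambda>_. borel))" for x
      using A out_arcs_subset by (intro sets_PiM_I_finite finite_out_arcs) auto
    let ?K = "\<lambda>x c \<eta>. indicator (PiE (out x) A) (\<lambda>e\<in>out x. c * \<eta> e) :: ennreal"
    have K: "?K x c \<in> borel_measurable (dirichlet_law (out x) a)" for x c
      by (rule measurable_compose[OF _ borel_measurable_indicator[OF outA]]) measurable
    have "emeasure D (PiE (parcs G) A) = (\<integral>\<^sup>+W. indicator (PiE (parcs G) A) W \<partial>D)"
      by (subst nn_integral_indicator) (auto simp: D_def box)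
    also have "\<dots> = (\<integral>\<^sup>+z. indicator (PiE (parcs G) A) (?f z) \<partial>(beta_law \<Otimes>\<^sub>M row_law))"
      unfolding D_def by (rule nn_integral_distr) measurable
    also have "\<dots> = (\<integral>\<^sup>+b. \<integral>\<^sup>+\<eta>. indicator (PiE (parcs G) A) (?f (b, \<eta>)) \<partial>row_law \<partial>beta_law)"
      by (rule rl.nn_integral_fst[symmetric]) measurable
    also have "\<dots> = (\<integral>\<^sup>+b. \<integral>\<^sup>+\<eta>. (\<Prod>x\<in>pverts G. ?K x (b x) (\<eta> x)) \<partial>row_law \<partial>beta_law)"
    proof (intro nn_integral_cong)
      fix b \<eta>
      show "indicator (PiE (parcs G) A) (?f (b, \<eta>)) = (\<Prod>x\<in>pverts G. ?K x (b x) (\<eta> x))"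
      proof (cases "\<forall>e\<in>parcs G. b (fst e) * \<eta> (fst e) e \<in> A e")
        case True
        then have "?K x (b x) (\<eta> x) = 1" for x
          by (auto simp: out_arcs_def indicator_def)
        with True show ?thesis by (simp add: indicator_def)
      next
        case False
        then obtain e where e: "e \<in> parcs G" "b (fst e) * \<eta> (fst e) e \<notin> A e" by blast
        then have "?K (fst e) (b (fst e)) (\<eta> (fst e)) = 0"
          by (auto simp: out_arcs_def indicator_def)
        then have "(\<Prod>x\<in>pverts G. ?K x (b x) (\<eta> x)) = 0"
          using arc_fst_in_verts[OF e(1)] pair_finite_verts by (intro prod_zero) auto
        moreover have "?f (b, \<eta>) \<notin> PiE (parcs G) A" using e by auto
        ultimately show ?thesis by simp
      qed
    qed
    also have "\<dots> = (\<integral>\<^sup>+b. (\<Prod>x\<in>pverts G. \<integral>\<^sup>+\<eta>. ?K x (b x) \<eta> \<partial>dirichlet_law (out x) a) \<partial>beta_law)"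
      by (intro nn_integral_cong d.product_nn_integral_prod pair_finite_verts K)
    also have "\<dots> = (\<Prod>x\<in>pverts G. \<integral>\<^sup>+c. \<integral>\<^sup>+\<eta>. ?K x c \<eta> \<partial>dirichlet_law (out x) a \<partial>gamma_law (vertex_weight (with_proj G) a x))"
    proof (rule b.product_nn_integral_prod[OF pair_finite_verts])
      fix x
      interpret prob_space "dirichlet_law (out x) a" by (rule prob_space_row)
      show "(\<lambda>c. \<integral>\<^sup>+\<eta>. ?K x c \<eta> \<partial>dirichlet_law (out x) a) \<in> borel_measurable (gamma_law (vertex_weight (with_proj G) a x))"
        by measurable
    qed
    also have "\<dots> = (\<Prod>x\<in>pverts G. \<Prod>e\<in>out x. emeasure (gamma_law (a e)) (A e))"
    proof (rule prod.cong[OF refl])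
      fix x assume x: "x \<in> pverts G"
      have "(\<integral>\<^sup>+c. \<integral>\<^sup>+\<eta>. ?K x c \<eta> \<partial>dirichlet_law (out x) a \<partial>gamma_law (vertex_weight (with_proj G) a x)) =
          (\<integral>\<^sup>+W. indicator (PiE (out x) A) W \<partial>PiM (out x) (\<lambda>e. gamma_law (a e)))"
        unfolding vertex_weight_def using x out_arcs_subset
        by (intro nn_integral_gamma_dirichlet finite_out_arcs out_arcs_nonempty weight_pos) auto
      also have "\<dots> = emeasure (PiM (out x) (\<lambda>e. gamma_law (a e))) (PiE (out x) A)"
        by (rule nn_integral_indicator) (simp add: outA)
      also have "\<dots> = (\<Prod>e\<in>out x. emeasure (gamma_law (a e)) (A e))"
        using A out_arcs_subset by (intro g.emeasure_PiM finite_out_arcs) auto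
      finally show "(\<integral>\<^sup>+c. \<integral>\<^sup>+\<eta>. ?K x c \<eta> \<partial>dirichlet_law (out x) a \<partial>gamma_law (vertex_weight (with_proj G) a x)) =
          (\<Prod>e\<in>out x. emeasure (gamma_law (a e)) (A e))" .
    qed
    also have "\<dots> = (\<Prod>x\<in>pverts G. \<Prod>e | e \<in> parcs G \<and> fst e = x. emeasure (gamma_law (a e)) (A e))"
      by (simp add: out_arcs_def)
    also have "\<dots> = (\<Prod>e\<in>parcs G. emeasure (gamma_law (a e)) (A e))"
      using pair_finite_arcs pair_finite_verts by (intro prod.group) (auto dest: arc_fst_in_verts)
    finally show "emeasure D (PiE (parcs G) A) = (\<Prod>e\<in>parcs G. emeasure (gamma_law (a e)) (A e))" .
  qed (simp_all add: D_def pair_finite_arcs)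
  then have "(\<integral>\<^sup>+W. F W \<partial>PiM (parcs G) (\<lambda>e. gamma_law (a e))) = (\<integral>\<^sup>+W. F W \<partial>D)"
    by simp
  also have "\<dots> = (\<integral>\<^sup>+z. F (?f z) \<partial>(beta_law \<Otimes>\<^sub>M row_law))"
    unfolding D_def by (rule nn_integral_distr) measurable
  also have "\<dots> = (\<integral>\<^sup>+b. \<integral>\<^sup>+\<eta>. F (?f (b, \<eta>)) \<partial>row_law \<partial>beta_law)"
    by (rule rl.nn_integral_fst[symmetric]) measurable
  also have "\<dots> = (\<integral>\<^sup>+b. \<integral>\<^sup>+\<omega>. F (\<lambda>e\<in>parcs G. b (fst e) * \<omega> e) \<partial>dirichlet_environment G a \<partial>beta_law)"
  proof (rule nn_integral_cong)
    fix b
    have "(\<lambda>\<omega>. F (\<lambda>e\<in>parcs G. b (fst e) * \<omega> e)) \<in> borel_measurable ?P"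
      by measurable
    then show "(\<integral>\<^sup>+\<eta>. F (?f (b, \<eta>)) \<partial>row_law) =
        (\<integral>\<^sup>+\<omega>. F (\<lambda>e\<in>parcs G. b (fst e) * \<omega> e) \<partial>dirichlet_environment G a)"
      unfolding dirichlet_environment_def
      by (subst nn_integral_distr) (auto cong: restrict_cong intro: measurable_glue)
  qed
  finally show ?thesis ..
qed

end

lemma (in pair_wf_digraph) out_arcs_nonempty_strongly_connected:
  assumes sc: "strongly_connected (with_proj G)" and x: "x \<in> pverts G" "y \<in> pverts G" "x \<noteq> y"
  shows "\<exists>e. e \<in> parcs G \<and> fst e = x"
proof -
  have "irreducible_on (pverts G) (\<lambda>e. if e \<in> parcs G then 1 else 0)"
    by (rule irreducible_on_strongly_connected[OF sc]) simp
  then have "\<exists>y\<in>{x}. \<exists>z\<in>pverts G - {x}. (0::real) < (if (y, z) \<in> parcs G then 1 else 0)"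
    unfolding irreducible_on_def using x by (elim allE[of _ "{x}"]) (auto split: if_splits)
  then show ?thesis by (auto split: if_splits)
qed

section \<open>Elimination applied to independent Gamma weights\<close>

context dirichlet_digraph
begin

text \<open>By \<open>fold_eliminate_escape_prob\<close> the two entries see only the row factors b
  i and b j, so further independent Gamma factors at the other vertices change nothing. With them
  every row is a Gamma total times a Dirichlet vector, hence a family of independent Gamma
  weights.\<close>

lemma nn_integral_escape_prob:
  assumes sc: "strongly_connected (with_proj G)"
    and ij: "i \<in> pverts G" "j \<in> pverts G" "i \<noteq> j"
    and loops: "(i, i) \<notin> parcs G" "(j, j) \<notin> parcs G"
    and xs: "distinct xs" "set xs = pverts G - {i, j}"
    and F [measurable]: "F \<in> borel_measurable (borel \<Otimes>\<^sub>M borel)"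
  shows "(\<integral>\<^sup>+z. \<integral>\<^sup>+\<omega>. F (fst z * escape_prob G \<omega> i j, snd z * escape_prob G \<omega> j i) \<partial>dirichlet_environment G a
        \<partial>(gamma_law (vertex_weight (with_proj G) a i) \<Otimes>\<^sub>M gamma_law (vertex_weight (with_proj G) a j))) =
    (\<integral>\<^sup>+W. F (fold (eliminate (pverts G)) xs (matrix_of_arcs G W) (i, j),
        fold (eliminate (pverts G)) xs (matrix_of_arcs G W) (j, i)) \<partial>PiM (parcs G) (\<lambda>e. gamma_law (a e)))"
proof -
  interpret DE: prob_space "dirichlet_environment G a" by (rule prob_space_dirichlet_environment)
  let ?w = "vertex_weight (with_proj G) a"
  let ?H = "\<lambda>W. fold (eliminate (pverts G)) xs (matrix_of_arcs G W)"
  note [measurable] = measurable_escape_prob[OF sc ij loops(1)]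
    measurable_escape_prob[OF sc ij(2,1) ij(3)[symmetric] loops(2)]
  have "(\<lambda>W. ?H W (i, j)) \<in> borel_measurable (PiM (parcs G) (\<lambda>_. borel))"
    "(\<lambda>W. ?H W (j, i)) \<in> borel_measurable (PiM (parcs G) (\<lambda>_. borel))"
    using xs ij by (auto intro!: measurable_fold_eliminate_entry)
  note [measurable] = this
  have proj [measurable]: "(\<lambda>b. (b i, b j)) \<in> measurable beta_law (gamma_law (?w i) \<Otimes>\<^sub>M gamma_law (?w j))"
    using ij by measurable
  have "(\<integral>\<^sup>+z. \<integral>\<^sup>+\<omega>. F (fst z * escape_prob G \<omega> i j, snd z * escape_prob G \<omega> j i) \<partial>dirichlet_environment G a
        \<partial>(gamma_law (?w i) \<Otimes>\<^sub>M gamma_law (?w j))) =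
      (\<integral>\<^sup>+z. \<integral>\<^sup>+\<omega>. F (fst z * escape_prob G \<omega> i j, snd z * escape_prob G \<omega> j i) \<partial>dirichlet_environment G a
        \<partial>distr beta_law (gamma_law (?w i) \<Otimes>\<^sub>M gamma_law (?w j)) (\<lambda>b. (b i, b j)))"
    by (subst distr_PiM_pair[OF pair_finite_verts ij product_sigma_finite_gamma_law])
      (simp_all add: prob_space_gamma_law vertex_weight_pos)
  also have "\<dots> = (\<integral>\<^sup>+b. \<integral>\<^sup>+\<omega>. F (b i * escape_prob G \<omega> i j, b j * escape_prob G \<omega> j i) \<partial>dirichlet_environment G a \<partial>beta_law)"
  proof -
    have "(\<lambda>z. \<integral>\<^sup>+\<omega>. F (fst z * escape_prob G \<omega> i j, snd z * escape_prob G \<omega> j i) \<partial>dirichlet_environment G a)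
        \<in> borel_measurable (borel \<Otimes>\<^sub>M borel)"
      by measurable
    then show ?thesis
      by (subst nn_integral_distr[OF proj]) (simp_all cong: measurable_cong_sets sets_pair_measure_cong)
  qed
  also have "\<dots> = (\<integral>\<^sup>+b. \<integral>\<^sup>+\<omega>. (\<lambda>W. F (?H W (i, j), ?H W (j, i))) (\<lambda>e\<in>parcs G. b (fst e) * \<omega> e) \<partial>dirichlet_environment G a \<partial>beta_law)"
  proof (rule nn_integral_cong_AE)
    have "AE b in beta_law. \<forall>x\<in>pverts G. 0 < b x"
      by (intro AE_PiM_gamma_law_pos pair_finite_verts vertex_weight_pos)
    then show "AE b in beta_law.
        (\<integral>\<^sup>+\<omega>. F (b i * escape_prob G \<omega> i j, b j * escape_prob G \<omega> j i) \<partial>dirichlet_environment G a) =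
        (\<integral>\<^sup>+\<omega>. (\<lambda>W. F (?H W (i, j), ?H W (j, i))) (\<lambda>e\<in>parcs G. b (fst e) * \<omega> e) \<partial>dirichlet_environment G a)"
    proof eventually_elim
      case (elim b)
      show ?case
      proof (rule nn_integral_cong_AE)
        show "AE \<omega> in dirichlet_environment G a. F (b i * escape_prob G \<omega> i j, b j * escape_prob G \<omega> j i) =
            (\<lambda>W. F (?H W (i, j), ?H W (j, i))) (\<lambda>e\<in>parcs G. b (fst e) * \<omega> e)"
          using AE_dirichlet_environment
        proof eventually_elim
          fix \<omega> assume env: "environment G \<omega>"
          interpret environment_digraph G \<omega>
            by unfold_locales (fact env)
          have R: "matrix_of_arcs G (\<lambda>e\<in>parcs G. b (fst e) * \<omega> e) (x, y) = b x * p x y"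
            if "x \<in> pverts G" "y \<in> pverts G" for x y
            using that by (simp add: matrix_of_arcs_def p_def)
          have "?H (\<lambda>e\<in>parcs G. b (fst e) * \<omega> e) (i, j) = b i * escape_prob G \<omega> i j"
            using elim R by (intro fold_eliminate_escape_prob[OF sc ij loops(1) xs]) auto
          \<comment> \<open>The same elimination serves the reversed pair, as \<open>xs\<close>
            enumerates the complement of the unordered pair.\<close>
          moreover have "?H (\<lambda>e\<in>parcs G. b (fst e) * \<omega> e) (j, i) = b j * escape_prob G \<omega> j i"
            using elim R xs by (intro fold_eliminate_escape_prob[OF sc ij(2,1) ij(3)[symmetric] loops(2)]) auto
          ultimately show "F (b i * escape_prob G \<omega> i j, b j * escape_prob G \<omega> j i) =
            (\<lambda>W. F (?H W (i, j), ?H W (j, i))) (\<lambda>e\<in>parcs G. b (fst e) * \<omega> e)"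
            by simp
        qed
      qed
    qed
  qed
  also have "\<dots> = (\<integral>\<^sup>+W. F (?H W (i, j), ?H W (j, i)) \<partial>PiM (parcs G) (\<lambda>e. gamma_law (a e)))"
    by (rule nn_integral_gamma_dirichlet_environment) measurable
  finally show ?thesis .
qed

text \<open>All divergence sits at i and j, so every other vertex can be eliminated. The gauge equal
  to t at i and 0 elsewhere then acts on the two remaining off-diagonal entries by exp t and exp (-
  t).\<close>

lemma nn_integral_eliminated_gauge:
  assumes sc: "strongly_connected (with_proj G)"
    and ij: "i \<in> pverts G" "j \<in> pverts G" "i \<noteq> j"
    and xs: "distinct xs" "set xs = pverts G - {i, j}"
    and div: "\<And>x. x \<in> pverts G \<Longrightarrow> divergence (with_proj G) a x = \<gamma> * (indicator {i} x - indicator {j} x)"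
    and F [measurable]: "F \<in> borel_measurable (borel \<Otimes>\<^sub>M borel)"
  defines "N \<equiv> PiM (parcs G) (\<lambda>e. gamma_law (a e))"
    and "H \<equiv> \<lambda>W. fold (eliminate (pverts G)) xs (matrix_of_arcs G W)"
  shows "(\<integral>\<^sup>+W. F (exp t * H W (i, j), exp (- t) * H W (j, i)) *
        ennreal (exp (H W (i, j) + H W (j, i) - exp t * H W (i, j) - exp (- t) * H W (j, i))) \<partial>N) =
      ennreal (exp (- \<gamma> * t)) * (\<integral>\<^sup>+W. F (H W (i, j), H W (j, i)) \<partial>N)"
    and "AE W in N. 0 < H W (i, j) \<and> 0 < H W (j, i)"
proof -
  let ?V = "pverts G"
  let ?P = "PiM (?V \<times> ?V) (\<lambda>_. borel :: real measure)"
  have [measurable_cong, simp]: "sets N = sets (PiM (parcs G) (\<lambda>_. borel))"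
    by (simp add: N_def)
  have V: "{i, j} \<union> set xs = ?V" using ij xs by auto
  have pos: "AE W in N. \<forall>e\<in>parcs G. 0 < W e"
    unfolding N_def by (intro AE_PiM_gamma_law_pos pair_finite_arcs weight_pos)
  then have irr: "AE W in N. irreducible_on ?V (matrix_of_arcs G W) \<and> (\<forall>e\<in>?V \<times> ?V. 0 \<le> matrix_of_arcs G W e)"
  proof eventually_elim
    case (elim W)
    have "irreducible_on ?V (matrix_of_arcs G W)"
    proof (rule irreducible_on_strongly_connected[OF sc])
      fix e assume "e \<in> parcs G"
      then show "0 < matrix_of_arcs G W e"
        using elim subsetD[OF arcs_subset] by (simp add: matrix_of_arcs_def)
    qed
    then show ?case
      using elim by (auto simp: matrix_of_arcs_def intro: less_imp_le)
  qed
  then show "AE W in N. 0 < H W (i, j) \<and> 0 < H W (j, i)"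
  proof eventually_elim
    case (elim W)
    have "irreducible_on {i, j} (H W)"
      unfolding H_def by (rule fold_eliminate(1)[OF pair_finite_verts]) (use elim V xs ij in auto)
    then show ?case
      using irreducible_on_pair[of i j "H W"] irreducible_on_pair[of j i "H W"] ij by (simp add: insert_commute)
  qed
  define N0 where "N0 = distr N ?P (matrix_of_arcs G)"
  define N1 where "N1 = distr N0 ?P (fold (eliminate ?V) xs)"
  have fe: "fold (eliminate ?V) xs \<in> measurable ?P ?P"
    using xs by (intro measurable_fold_eliminate) auto
  note [measurable] = this
  \<comment> \<open>Only the gauge difference between i and j enters, hence the invariance under
    updates at eliminated vertices.\<close>
  have theta: "(\<Sum>x\<in>?V. u x * divergence (with_proj G) a x) = \<gamma> * (u i - u j)" for u
  proof -
    have "(\<Sum>x\<in>?V. u x * divergence (with_proj G) a x) = (\<Sum>x\<in>?V. \<gamma> * (u x * indicator {i} x) - \<gamma> * (u x * indicator {j} x))"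
      by (intro sum.cong) (simp_all add: div algebra_simps)
    also have "\<dots> = \<gamma> * (u i - u j)"
      using ij pair_finite_verts by (simp add: sum_subtractf sum_distrib_left[symmetric] right_diff_distrib indicator_def sum.delta' if_distrib cong: if_cong)
    finally show ?thesis .
  qed
  have cov: "gauge_covariant ?V N1 (\<lambda>u. \<gamma> * (u i - u j))"
    unfolding N1_def
  proof (rule gauge_covariant_fold_eliminate[where B = "{i, j}"])
    show "prob_space N0"
      unfolding N0_def N_def by (intro prob_space.prob_space_distr prob_space_PiM_gamma_law weight_pos) measurable
    show "gauge_covariant ?V N0 (\<lambda>u. \<gamma> * (u i - u j))"
      unfolding N0_def N_def using gauge_covariant_gamma[of a, OF weight_pos] by (simp add: theta)
    show "AE R in N0. irreducible_on ({i, j} \<union> set xs) R \<and> (\<forall>e\<in>?V \<times> ?V. 0 \<le> R e)"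
      unfolding V N0_def using measurable_irreducible_on[of ?V ?V] pair_finite_verts irr
      by (subst AE_distr_iff) (auto simp: pred_def)
  qed (use xs ij V pair_finite_verts in \<open>auto simp: N0_def\<close>)
  have N1: "(\<integral>\<^sup>+R. f R \<partial>N1) = (\<integral>\<^sup>+W. f (H W) \<partial>N)" if [measurable]: "f \<in> borel_measurable ?P" for f
  proof -
    have "(\<integral>\<^sup>+R. f R \<partial>N1) = (\<integral>\<^sup>+R. f (fold (eliminate ?V) xs R) \<partial>N0)"
      unfolding N1_def by (rule nn_integral_distr) (auto simp: N0_def fe cong: measurable_cong_sets)
    also have "\<dots> = (\<integral>\<^sup>+W. f (H W) \<partial>N)"
      unfolding N0_def H_def by (rule nn_integral_distr) measurable
    finally show ?thesis .
  qed
  define u where "u = (\<lambda>x. if x = i then t else 0)"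
  have comp [measurable]: "(\<lambda>R. R (i, j)) \<in> borel_measurable ?P" "(\<lambda>R. R (j, i)) \<in> borel_measurable ?P"
    using ij by (auto intro!: measurable_component_singleton)
  have gauge_entry: "gauge_transform ?V u R (i, j) = exp t * R (i, j)" "gauge_transform ?V u R (j, i) = exp (- t) * R (j, i)" for R
    using ij by (auto simp: gauge_transform_def u_def)
  have zero: "H W (y, z) = 0" if "y \<in> ?V" "z \<in> ?V" "y \<notin> {i, j} \<or> z \<notin> {i, j}" for W y z
    using that xs fold_eliminate_zero[of xs ?V y z "matrix_of_arcs G W"] fold_eliminate_zero[of xs ?V z y "matrix_of_arcs G W"]
    unfolding H_def by auto
  \<comment> \<open>Elimination can produce diagonal entries at i and j even without loops there;
    gauges fix them, so they cancel in the difference.\<close>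
  have total: "total ?V (H W) - total ?V (gauge_transform ?V u (H W)) =
      H W (i, j) + H W (j, i) - exp t * H W (i, j) - exp (- t) * H W (j, i)" for W
  proof -
    have "total ?V R = (\<Sum>e\<in>{i, j} \<times> {i, j}. R e)" if "\<And>y z. y \<in> ?V \<Longrightarrow> z \<in> ?V \<Longrightarrow> y \<notin> {i, j} \<or> z \<notin> {i, j} \<Longrightarrow> R (y, z) = 0" for R
      unfolding total_def using ij that pair_finite_verts by (intro sum.mono_neutral_right) auto
    note tot = this
    have "total ?V (H W) = (\<Sum>e\<in>{i, j} \<times> {i, j}. H W e)"
      using zero by (intro tot) blast
    moreover have "total ?V (gauge_transform ?V u (H W)) = (\<Sum>e\<in>{i, j} \<times> {i, j}. gauge_transform ?V u (H W) e)"
      using zero by (intro tot) (simp add: gauge_transform_def)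
    moreover have "gauge_transform ?V u (H W) (x, x) = H W (x, x)" if "x \<in> ?V" for x
      using that by (simp add: gauge_transform_def)
    moreover have "(\<Sum>e\<in>{i, j} \<times> {i, j}. f e) = f (i, i) + f (i, j) + f (j, i) + f (j, j)" for f :: "'a \<times> 'a \<Rightarrow> real"
      using ij by (simp add: sum.cartesian_product[symmetric])
    ultimately show ?thesis
      using ij by (simp add: gauge_entry)
  qed
  have "(\<integral>\<^sup>+W. F (exp t * H W (i, j), exp (- t) * H W (j, i)) *
        ennreal (exp (H W (i, j) + H W (j, i) - exp t * H W (i, j) - exp (- t) * H W (j, i))) \<partial>N) =
      (\<integral>\<^sup>+R. F (gauge_transform ?V u R (i, j), gauge_transform ?V u R (j, i)) *
        ennreal (exp (total ?V R - total ?V (gauge_transform ?V u R))) \<partial>N1)"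
    by (subst N1) (simp_all add: gauge_entry total)
  also have "\<dots> = ennreal (exp (- (\<gamma> * (u i - u j)))) * (\<integral>\<^sup>+R. F (R (i, j), R (j, i)) \<partial>N1)"
    using cov[unfolded gauge_covariant_def, rule_format, of "\<lambda>R. F (R (i, j), R (j, i))" u] by measurable
  also have "(\<integral>\<^sup>+R. F (R (i, j), R (j, i)) \<partial>N1) = (\<integral>\<^sup>+W. F (H W (i, j), H W (j, i)) \<partial>N)"
    by (rule N1) measurable
  finally show "(\<integral>\<^sup>+W. F (exp t * H W (i, j), exp (- t) * H W (j, i)) *
        ennreal (exp (H W (i, j) + H W (j, i) - exp t * H W (i, j) - exp (- t) * H W (j, i))) \<partial>N) =
      ennreal (exp (- \<gamma> * t)) * (\<integral>\<^sup>+W. F (H W (i, j), H W (j, i)) \<partial>N)"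
    using ij by (simp add: u_def)
qed

end

subsection \<open>Bessel densities and conditional laws\<close>

lemma borel_measurable_cosh [measurable (raw)]:
  fixes f :: "'a \<Rightarrow> real"
  assumes [measurable]: "f \<in> borel_measurable M"
  shows "(\<lambda>x. cosh (f x)) \<in> borel_measurable M"
  unfolding cosh_field_def by measurable

text \<open>A Gaussian dominates: cosh t is at least t^2 / 4, and completing the square in \<gamma>
  * t - c * t^2 with c = x / 4 gives the mean \<open>\<mu>\<close> and the standard deviation
  \<open>\<sigma>\<close>.\<close>

lemma integrable_bessel_K:
  fixes x :: real
  assumes x: "0 < x"
  shows "integrable lborel (\<lambda>t. exp (\<gamma> * t) * exp (- x * cosh t))"
proof -
  define c where "c = x / 4"
  have c: "0 < c" using x by (simp add: c_def)
  define \<sigma> where "\<sigma> = sqrt (1 / (2 * c))"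
  define \<mu> where "\<mu> = \<gamma> / (2 * c)"
  have \<sigma>: "\<sigma>\<^sup>2 = 1 / (2 * c)" using c by (simp add: \<sigma>_def)
  have \<sigma>_pos: "0 < \<sigma>" using c by (simp add: \<sigma>_def)
  let ?b = "\<lambda>t. exp (\<gamma>\<^sup>2 / (4 * c)) * sqrt (2 * pi * \<sigma>\<^sup>2) * normal_density \<mu> \<sigma> t"
  have b: "?b t = exp (\<gamma> * t - c * t\<^sup>2)" for t
  proof -
    have e1: "- (t - \<mu>)\<^sup>2 / (2 * \<sigma>\<^sup>2) = - (c * (t - \<mu>)\<^sup>2)"
      using c unfolding \<sigma> by simp
    have e2: "\<gamma> * t - c * t\<^sup>2 = \<gamma>\<^sup>2 / (4 * c) + - (c * (t - \<mu>)\<^sup>2)"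
      using c by (simp add: \<mu>_def power2_eq_square field_simps)
    have "exp (\<gamma> * t - c * t\<^sup>2) = exp (\<gamma>\<^sup>2 / (4 * c)) * exp (- (t - \<mu>)\<^sup>2 / (2 * \<sigma>\<^sup>2))"
      by (simp only: e1 e2 exp_add)
    then show ?thesis using \<sigma>_pos by (simp add: normal_density_def)
  qed
  have cosh: "t\<^sup>2 / 4 \<le> cosh t" for t :: real
  proof -
    have "1 + \<bar>t\<bar> + \<bar>t\<bar>\<^sup>2 / 2 \<le> exp \<bar>t\<bar>" by (rule exp_lower_Taylor_quadratic) simp
    moreover have "exp \<bar>t\<bar> \<le> exp t + exp (- t)"
      by (cases "0 \<le> t") (auto simp: less_imp_le)
    ultimately show ?thesis by (simp add: cosh_field_def)
  qed
  show ?thesis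
  proof (rule Bochner_Integration.integrable_bound)
    show "integrable lborel ?b"
      by (intro integrable_mult_right integrable_normal_density \<sigma>_pos)
    show "AE t in lborel. norm (exp (\<gamma> * t) * exp (- x * cosh t)) \<le> norm (?b t)"
    proof (rule AE_I2)
      fix t
      have "x * (t\<^sup>2 / 4) \<le> x * cosh t"
        using x cosh by (intro mult_left_mono) auto
      then show "norm (exp (\<gamma> * t) * exp (- x * cosh t)) \<le> norm (?b t)"
        unfolding b by (simp add: c_def flip: exp_add)
    qed
  qed measurable
qed

lemma bessel_K_pos:
  assumes x: "0 < x"
  shows "0 < bessel_K \<gamma> x"
    and "(\<integral>\<^sup>+t. ennreal (exp (\<gamma> * t - x * cosh t)) \<partial>lborel) = ennreal (2 * bessel_K \<gamma> x)"
proof -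
  let ?f = "\<lambda>t. exp (\<gamma> * t) * exp (- x * cosh t)"
  have f: "?f t = exp (\<gamma> * t - x * cosh t)" for t
    by (simp flip: exp_add)
  have eq: "(\<integral>\<^sup>+t. ennreal (?f t) \<partial>lborel) = ennreal (2 * bessel_K \<gamma> x)"
    using integrable_bessel_K[OF x] by (subst nn_integral_eq_integral) (auto simp: bessel_K_def)
  then show "(\<integral>\<^sup>+t. ennreal (exp (\<gamma> * t - x * cosh t)) \<partial>lborel) = ennreal (2 * bessel_K \<gamma> x)"
    unfolding f .
  have "\<not> (AE t in lborel. ennreal (?f t) = 0)"
    by (subst AE_iff_measurable[of UNIV]) (auto simp: ennreal_eq_0_iff not_le)
  then have "(\<integral>\<^sup>+t. ennreal (?f t) \<partial>lborel) \<noteq> 0"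
    by (subst nn_integral_0_iff_AE) auto
  then show "0 < bessel_K \<gamma> x"
    using eq by (cases "0 < bessel_K \<gamma> x") (auto simp: ennreal_neg not_less)
qed

lemma measurable_bessel_K [measurable]: "bessel_K \<gamma> \<in> borel_measurable borel"
  unfolding bessel_K_def[abs_def] by measurable

text \<open>The sigma-algebra of Y consists of preimages of Borel sets, so integrals over the events
  that Y lies in B characterise the conditional expectation. The criterion is phrased with
  nonnegative integrals to suit Tonelli arguments; the kernel being a probability almost surely
  turns them into Bochner integrals.\<close>

lemma conditional_lawI:
  assumes M: "prob_space M" and [measurable]: "Y \<in> borel_measurable M" "X \<in> borel_measurable M"
    and \<kappa>: "AE w in M. prob_space (\<kappa> (Y w))"
    and meas: "\<And>A. A \<in> sets borel \<Longrightarrow> (\<lambda>y. measure (\<kappa> y) A) \<in> borel_measurable borel"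
    and eq: "\<And>A B. A \<in> sets borel \<Longrightarrow> B \<in> sets borel \<Longrightarrow>
      (\<integral>\<^sup>+w. indicator B (Y w) * indicator A (X w) \<partial>M) = (\<integral>\<^sup>+w. indicator B (Y w) * emeasure (\<kappa> (Y w)) A \<partial>M)"
  shows "conditional_law M Y X \<kappa>"
  unfolding conditional_law_def
proof (intro conjI ballI)
  fix A :: "real set" assume A [measurable]: "A \<in> sets borel"
  interpret prob_space M by fact
  let ?F = "vimage_algebra (space M) Y borel"
  note [measurable] = meas[OF A]
  have sub: "subalgebra M ?F"
    using measurable_sets[of Y M borel] by (auto simp: subalgebra_def sets_vimage_algebra2)
  interpret finite_measure_subalgebra M ?F
    by unfold_locales (rule sub)
  have YF: "Y \<in> borel_measurable ?F"
    by (rule measurable_vimage_algebra1) simp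
  have le1: "AE w in M. measure (\<kappa> (Y w)) A \<le> 1"
    using \<kappa> by eventually_elim (rule prob_space.prob_le_1)
  show "AE w in M. real_cond_exp M ?F (\<lambda>w. indicator A (X w)) w = measure (\<kappa> (Y w)) A"
  proof (rule real_cond_exp_charact)
    show "integrable M (\<lambda>w. indicator A (X w) :: real)"
      by (rule integrable_const_bound[of _ 1]) (auto simp: indicator_def)
    show "integrable M (\<lambda>w. measure (\<kappa> (Y w)) A)"
      by (rule integrable_const_bound[of _ 1]) (use le1 in auto)
    show "(\<lambda>w. measure (\<kappa> (Y w)) A) \<in> borel_measurable ?F"
      using measurable_compose[OF YF meas[OF A]] .
    fix B' assume "B' \<in> sets ?F"
    then obtain B where B: "B' = Y -` B \<inter> space M" and [measurable]: "B \<in> sets borel"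
      by (auto simp: sets_vimage_algebra2)
    have ind: "indicator B' w = (indicator B (Y w) :: real)" if "w \<in> space M" for w
      using that by (simp add: B indicator_def)
    have "(\<integral>w\<in>B'. indicator A (X w) \<partial>M) = (\<integral>w. (indicator B (Y w) * indicator A (X w) :: real) \<partial>M)"
      unfolding set_lebesgue_integral_def by (intro Bochner_Integration.integral_cong) (auto simp: ind)
    also have "\<dots> = enn2real (\<integral>\<^sup>+w. ennreal (indicator B (Y w) * indicator A (X w)) \<partial>M)"
      by (intro integral_eq_nn_integral) auto
    also have "(\<integral>\<^sup>+w. ennreal (indicator B (Y w) * indicator A (X w)) \<partial>M) =
        (\<integral>\<^sup>+w. indicator B (Y w) * indicator A (X w) \<partial>M)"
      by (intro nn_integral_cong) (simp add: indicator_def)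
    also have "\<dots> = (\<integral>\<^sup>+w. indicator B (Y w) * emeasure (\<kappa> (Y w)) A \<partial>M)"
      by (rule eq) auto
    also have "\<dots> = (\<integral>\<^sup>+w. ennreal (indicator B (Y w) * measure (\<kappa> (Y w)) A) \<partial>M)"
    proof (rule nn_integral_cong_AE)
      show "AE w in M. indicator B (Y w) * emeasure (\<kappa> (Y w)) A = ennreal (indicator B (Y w) * measure (\<kappa> (Y w)) A)"
        using \<kappa>
      proof eventually_elim
        case (elim w)
        interpret K: prob_space "\<kappa> (Y w)" by fact
        show ?case by (simp add: K.emeasure_eq_measure indicator_def)
      qed
    qed
    also have "enn2real \<dots> = (\<integral>w. indicator B (Y w) * measure (\<kappa> (Y w)) A \<partial>M)"
      by (intro integral_eq_nn_integral[symmetric]) auto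
    also have "\<dots> = (\<integral>w\<in>B'. measure (\<kappa> (Y w)) A \<partial>M)"
      unfolding set_lebesgue_integral_def by (intro Bochner_Integration.integral_cong) (auto simp: ind)
    finally show "(\<integral>w\<in>B'. indicator A (X w) \<partial>M) = (\<integral>w\<in>B'. measure (\<kappa> (Y w)) A \<partial>M)" .
  qed
qed fact+

definition bessel_density :: "real \<Rightarrow> real \<Rightarrow> real \<Rightarrow> real" where
  "bessel_density \<gamma> g s = 1 / (2 * bessel_K \<gamma> (2 * g)) * exp (\<gamma> * s - 2 * g * cosh s)"

lemma borel_measurable_bessel_density [measurable (raw)]:
  assumes [measurable]: "f \<in> borel_measurable N" "h \<in> borel_measurable N"
  shows "(\<lambda>x. bessel_density \<gamma> (f x) (h x)) \<in> borel_measurable N"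
  unfolding bessel_density_def by measurable

lemma nn_integral_bessel_density:
  assumes "0 < g"
  shows "(\<integral>\<^sup>+s. ennreal (bessel_density \<gamma> g s) \<partial>lborel) = 1"
proof -
  have K: "0 < bessel_K \<gamma> (2 * g)"
    using assms by (intro bessel_K_pos) simp
  have [measurable]: "(\<lambda>s. ennreal (exp (\<gamma> * s - 2 * g * cosh s))) \<in> borel_measurable borel"
    by measurable
  have "(\<integral>\<^sup>+s. ennreal (bessel_density \<gamma> g s) \<partial>lborel) =
      (\<integral>\<^sup>+s. ennreal (1 / (2 * bessel_K \<gamma> (2 * g))) * ennreal (exp (\<gamma> * s - 2 * g * cosh s)) \<partial>lborel)"
    using K by (simp add: bessel_density_def flip: ennreal_mult')
  also have "\<dots> = ennreal (1 / (2 * bessel_K \<gamma> (2 * g))) * ennreal (2 * bessel_K \<gamma> (2 * g))"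
    using assms by (subst nn_integral_cmult) (simp_all add: bessel_K_pos(2))
  also have "\<dots> = 1"
    using K by (simp flip: ennreal_mult')
  finally show ?thesis .
qed

text \<open>Under x = exp s the exponent (2 * g * x + 2 * g / x) / 2 is 2 * g * cosh s, and the
  Jacobian raises the power \<gamma> - 1 to \<gamma>; the normalising integral is therefore 2 *
  bessel_K \<gamma> (2 * g).\<close>

lemma distr_exp_bessel_density:
  assumes g: "0 < g"
  shows "distr (density lborel (\<lambda>s. ennreal (bessel_density \<gamma> g s))) borel exp = gig_law \<gamma> (2 * g) (2 * g)"
proof (rule measure_eqI)
  define f where "f x = (if 0 < x then x powr (\<gamma> - 1) * exp (- (1 / 2) * (2 * g * x + 2 * g / x)) else 0)" for x
  have [measurable]: "f \<in> borel_measurable borel"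
    unfolding f_def[abs_def] by measurable
  have f_exp: "f (exp r) * exp r = exp (\<gamma> * r - 2 * g * cosh r)" for r
  proof -
    have "f (exp r) * exp r = exp ((\<gamma> - 1) * r + - (1 / 2) * (2 * g * exp r + 2 * g / exp r) + r)"
    proof -
      have "f (exp r) = exp ((\<gamma> - 1) * r) * exp (- (1 / 2) * (2 * g * exp r + 2 * g / exp r))"
        by (simp add: f_def powr_def)
      then show ?thesis by (simp only: exp_add)
    qed
    also have "(\<gamma> - 1) * r + - (1 / 2) * (2 * g * exp r + 2 * g / exp r) + r = \<gamma> * r - 2 * g * cosh r"
    proof -
      have "2 * g / exp r = 2 * g * exp (- r)"
        by (simp add: exp_minus divide_inverse)
      moreover have "(\<gamma> - 1) * r + - (1 / 2) * (2 * g * a + 2 * g * b) + r = \<gamma> * r - 2 * g * ((a + b) / 2)" for a b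
        by (simp add: field_simps)
      ultimately show ?thesis
        by (simp only: cosh_field_def)
    qed
    finally show ?thesis .
  qed
  have f_nn: "0 \<le> f x" for x by (simp add: f_def)
  have subst: "(\<integral>\<^sup>+x. ennreal (f x) * h x \<partial>lborel) = (\<integral>\<^sup>+r. ennreal (exp (\<gamma> * r - 2 * g * cosh r)) * h (exp r) \<partial>lborel)"
    if [measurable]: "h \<in> borel_measurable borel" for h
  proof -
    have "(\<integral>\<^sup>+x. ennreal (f x) * h x \<partial>lborel) = (\<integral>\<^sup>+x. (ennreal (f x) * h x) * indicator {0<..} x \<partial>lborel)"
      by (intro nn_integral_cong) (auto simp: f_def indicator_def)
    also have "\<dots> = (\<integral>\<^sup>+r. (ennreal (f (exp r)) * h (exp r)) * ennreal (exp r) \<partial>lborel)"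
      by (rule nn_integral_exp_substitution) measurable
    also have "\<dots> = (\<integral>\<^sup>+r. ennreal (f (exp r) * exp r) * h (exp r) \<partial>lborel)"
      unfolding ennreal_mult''[OF exp_ge_zero] by (intro nn_integral_cong) (simp only: mult_ac)
    finally show ?thesis unfolding f_exp .
  qed
  have "(\<integral>\<^sup>+x. ennreal (f x) \<partial>lborel) = ennreal (2 * bessel_K \<gamma> (2 * g))"
    using subst[of "\<lambda>_. 1"] g by (simp add: bessel_K_pos(2))
  then have int: "(\<integral>x. f x \<partial>lborel) = 2 * bessel_K \<gamma> (2 * g)"
    using bessel_K_pos(1)[of "2 * g" \<gamma>] g f_nn by (subst integral_eq_nn_integral) auto
  have gig: "gig_law \<gamma> (2 * g) (2 * g) = density lborel (\<lambda>x. ennreal (f x / (2 * bessel_K \<gamma> (2 * g))))"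
  proof -
    have "gig_law \<gamma> (2 * g) (2 * g) = (let f = f in density lborel (\<lambda>x. ennreal (f x / (\<integral>x. f x \<partial>lborel))))"
      unfolding gig_law_def f_def[abs_def] ..
    then show ?thesis by (simp only: Let_def int)
  qed
  show "sets (distr (density lborel (\<lambda>s. ennreal (bessel_density \<gamma> g s))) borel exp) = sets (gig_law \<gamma> (2 * g) (2 * g))"
    by (simp add: gig)
  fix A assume "A \<in> sets (distr (density lborel (\<lambda>s. ennreal (bessel_density \<gamma> g s))) borel exp)"
  then have [measurable]: "A \<in> sets borel" by simp
  let ?c = "ennreal (1 / (2 * bessel_K \<gamma> (2 * g)))"
  have c: "0 \<le> 1 / (2 * bessel_K \<gamma> (2 * g))"
    using bessel_K_pos(1)[of "2 * g" \<gamma>] g by simp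
  have "emeasure (distr (density lborel (\<lambda>s. ennreal (bessel_density \<gamma> g s))) borel exp) A =
      (\<integral>\<^sup>+s. ennreal (bessel_density \<gamma> g s) * indicator A (exp s) \<partial>lborel)"
  proof -
    have "exp -` A \<in> sets (borel :: real measure)"
      using measurable_sets[of exp "borel :: real measure" borel A] by simp
    moreover have "indicator (exp -` A) s = (indicator A (exp s) :: ennreal)" for s :: real
      by (simp add: indicator_def)
    ultimately show ?thesis
      by (simp add: emeasure_distr emeasure_density)
  qed
  also have "\<dots> = (\<integral>\<^sup>+s. ennreal (exp (\<gamma> * s - 2 * g * cosh s)) * (?c * indicator A (exp s)) \<partial>lborel)"
    unfolding bessel_density_def ennreal_mult'[OF c] by (intro nn_integral_cong) (simp add: mult_ac)
  also have "\<dots> = (\<integral>\<^sup>+x. ennreal (f x) * (?c * indicator A x) \<partial>lborel)"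
    by (rule subst[symmetric]) measurable
  also have "\<dots> = (\<integral>\<^sup>+x. ennreal (f x / (2 * bessel_K \<gamma> (2 * g))) * indicator A x \<partial>lborel)"
  proof -
    have "ennreal (f x / (2 * bessel_K \<gamma> (2 * g))) = ennreal (f x) * ?c" for x
      using ennreal_mult''[OF c, of "f x"] by simp
    then show ?thesis by (simp only: mult.assoc)
  qed
  also have "\<dots> = emeasure (gig_law \<gamma> (2 * g) (2 * g)) A"
    unfolding gig by (subst emeasure_density) auto
  finally show "emeasure (distr (density lborel (\<lambda>s. ennreal (bessel_density \<gamma> g s))) borel exp) A =
      emeasure (gig_law \<gamma> (2 * g) (2 * g)) A" .
qed

lemma prob_space_bessel_density:
  assumes "0 < g"
  shows "prob_space (density lborel (\<lambda>s. ennreal (bessel_density \<gamma> g s)))"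
  by (rule prob_spaceI) (simp add: emeasure_density nn_integral_bessel_density[OF assms])

section \<open>From hyperbolic quasi-invariance of a positive pair to its conditional law\<close>

locale gauge_covariant_pair = prob_space +
  fixes Hp Hm :: "'a \<Rightarrow> real" and \<gamma> :: real
  assumes measurable_Hp [measurable]: "Hp \<in> borel_measurable M"
    and measurable_Hm [measurable]: "Hm \<in> borel_measurable M"
    and pos: "AE w in M. 0 < Hp w \<and> 0 < Hm w"
    and covariant: "\<And>t F. F \<in> borel_measurable (borel \<Otimes>\<^sub>M borel) \<Longrightarrow>
      (\<integral>\<^sup>+w. F (exp t * Hp w, exp (- t) * Hm w) *
        ennreal (exp (Hp w + Hm w - exp t * Hp w - exp (- t) * Hm w)) \<partial>M) =
      ennreal (exp (- \<gamma> * t)) * (\<integral>\<^sup>+w. F (Hp w, Hm w) \<partial>M)"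
begin

definition \<Gamma> :: "'a \<Rightarrow> real" where "\<Gamma> w = sqrt (Hp w * Hm w)"
definition S :: "'a \<Rightarrow> real" where "S w = ln (sqrt (Hp w / Hm w))"

lemma measurable_\<Gamma> [measurable]: "\<Gamma> \<in> borel_measurable M"
  unfolding \<Gamma>_def[abs_def] by measurable

lemma measurable_S [measurable]: "S \<in> borel_measurable M"
  unfolding S_def[abs_def] by measurable

text \<open>\<open>\<Gamma>\<close> and \<open>S\<close> are hyperbolic polar coordinates for (Hp,
  Hm) on the positive quadrant: multiplication by (exp t, exp (- t)) fixes the first and translates
  the second.\<close>

lemma recover:
  assumes "0 < Hp w" "0 < Hm w"
  shows "0 < \<Gamma> w" "\<Gamma> w * exp (S w) = Hp w" "\<Gamma> w * exp (- S w) = Hm w"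
    and "sqrt ((exp t * Hp w) * (exp (- t) * Hm w)) = \<Gamma> w"
    and "ln (sqrt ((exp t * Hp w) / (exp (- t) * Hm w))) = S w + t"
    and "exp t * Hp w + exp (- t) * Hm w = 2 * \<Gamma> w * cosh (S w + t)"
proof -
  have exp_S: "exp (S w) = sqrt (Hp w / Hm w)"
    using assms by (simp add: S_def)
  show "0 < \<Gamma> w" using assms by (simp add: \<Gamma>_def)
  have "\<Gamma> w * exp (S w) = sqrt (Hp w * Hp w)"
    unfolding exp_S \<Gamma>_def real_sqrt_mult[symmetric] using assms by simp
  then show p: "\<Gamma> w * exp (S w) = Hp w"
    using assms by simp
  have "exp (- S w) = sqrt (Hm w / Hp w)"
    using assms by (simp add: exp_minus exp_S real_sqrt_divide)
  then have "\<Gamma> w * exp (- S w) = sqrt (Hm w * Hm w)"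
    unfolding \<Gamma>_def using assms by (simp add: real_sqrt_mult[symmetric] del: real_sqrt_mult_self)
  then show m: "\<Gamma> w * exp (- S w) = Hm w"
    using assms by simp
  have "(exp t * Hp w) * (exp (- t) * Hm w) = Hp w * Hm w"
    by (simp add: exp_minus)
  then show "sqrt ((exp t * Hp w) * (exp (- t) * Hm w)) = \<Gamma> w"
    by (simp only: \<Gamma>_def)
  have "(exp t * Hp w) / (exp (- t) * Hm w) = (exp t)\<^sup>2 * (Hp w / Hm w)"
    by (simp add: exp_minus power2_eq_square divide_inverse)
  then have "sqrt ((exp t * Hp w) / (exp (- t) * Hm w)) = exp t * exp (S w)"
    by (simp only: exp_S real_sqrt_mult real_sqrt_abs) simp
  then show "ln (sqrt ((exp t * Hp w) / (exp (- t) * Hm w))) = S w + t"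
    by (simp only: exp_add[symmetric] ln_exp add.commute)
  show "exp t * Hp w + exp (- t) * Hm w = 2 * \<Gamma> w * cosh (S w + t)"
    unfolding p[symmetric] m[symmetric] cosh_field_def minus_add_distrib exp_add by (simp add: algebra_simps)
qed

lemma nn_integral_shift:
  assumes F [measurable]: "F \<in> borel_measurable (borel \<Otimes>\<^sub>M borel)"
  shows "(\<integral>\<^sup>+w. F (\<Gamma> w, S w + t) * ennreal (exp (2 * \<Gamma> w * cosh (S w) - 2 * \<Gamma> w * cosh (S w + t))) \<partial>M) =
    ennreal (exp (- \<gamma> * t)) * (\<integral>\<^sup>+w. F (\<Gamma> w, S w) \<partial>M)"
proof -
  let ?F = "\<lambda>h. F (sqrt (fst h * snd h), ln (sqrt (fst h / snd h)))"
  have "(\<integral>\<^sup>+w. F (\<Gamma> w, S w + t) * ennreal (exp (2 * \<Gamma> w * cosh (S w) - 2 * \<Gamma> w * cosh (S w + t))) \<partial>M) =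
      (\<integral>\<^sup>+w. ?F (exp t * Hp w, exp (- t) * Hm w) *
        ennreal (exp (Hp w + Hm w - exp t * Hp w - exp (- t) * Hm w)) \<partial>M)"
  proof (rule nn_integral_cong_AE)
    show "AE w in M. F (\<Gamma> w, S w + t) * ennreal (exp (2 * \<Gamma> w * cosh (S w) - 2 * \<Gamma> w * cosh (S w + t))) =
        ?F (exp t * Hp w, exp (- t) * Hm w) * ennreal (exp (Hp w + Hm w - exp t * Hp w - exp (- t) * Hm w))"
      using pos
    proof eventually_elim
      case (elim w)
      have "Hp w + Hm w = 2 * \<Gamma> w * cosh (S w)"
        using recover(6)[of w 0] elim by simp
      then have "Hp w + Hm w - exp t * Hp w - exp (- t) * Hm w = 2 * \<Gamma> w * cosh (S w) - 2 * \<Gamma> w * cosh (S w + t)"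
        using recover(6)[of w t] elim by linarith
      then show ?case
        using elim by (simp only: fst_conv snd_conv recover)
    qed
  qed
  also have "\<dots> = ennreal (exp (- \<gamma> * t)) * (\<integral>\<^sup>+w. ?F (Hp w, Hm w) \<partial>M)"
    by (rule covariant) measurable
  finally show ?thesis
    by (simp add: \<Gamma>_def S_def)
qed

text \<open>Averaging over translations: put s = S w + t on the right and exchange the integrals;
  the shift identity moves t from the argument of \<open>F\<close> to the kernel, whose integral
  over t is 1. The exponent of \<open>bessel_density\<close> is the one that absorbs both the factor
  exp (- \<gamma> * t) and the cosh terms.\<close>

lemma nn_integral_bessel_kernel:
  assumes F [measurable]: "F \<in> borel_measurable (borel \<Otimes>\<^sub>M borel)"
  shows "(\<integral>\<^sup>+w. F (\<Gamma> w, S w) \<partial>M) =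
    (\<integral>\<^sup>+w. \<integral>\<^sup>+s. F (\<Gamma> w, s) * ennreal (bessel_density \<gamma> (\<Gamma> w) s) \<partial>lborel \<partial>M)"
proof -
  interpret MS: pair_sigma_finite M lborel ..
  let ?k = "\<lambda>g s. ennreal (bessel_density \<gamma> g s)"
  have "(\<integral>\<^sup>+w. \<integral>\<^sup>+s. F (\<Gamma> w, s) * ?k (\<Gamma> w) s \<partial>lborel \<partial>M) =
      (\<integral>\<^sup>+w. \<integral>\<^sup>+t. F (\<Gamma> w, S w + t) * ?k (\<Gamma> w) (S w + t) \<partial>lborel \<partial>M)"
  proof (rule nn_integral_cong)
    fix w
    have "(\<lambda>s. F (\<Gamma> w, s) * ?k (\<Gamma> w) s) \<in> borel_measurable borel"
      by measurable
    from nn_integral_lborel_shift[OF this, of "S w"]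
    show "(\<integral>\<^sup>+s. F (\<Gamma> w, s) * ?k (\<Gamma> w) s \<partial>lborel) = (\<integral>\<^sup>+t. F (\<Gamma> w, S w + t) * ?k (\<Gamma> w) (S w + t) \<partial>lborel)" ..
  qed
  also have "\<dots> = (\<integral>\<^sup>+t. \<integral>\<^sup>+w. F (\<Gamma> w, S w + t) * ?k (\<Gamma> w) (S w + t) \<partial>M \<partial>lborel)"
    by (rule MS.Fubini'[symmetric]) measurable
  also have "\<dots> = (\<integral>\<^sup>+t. \<integral>\<^sup>+w. F (\<Gamma> w, S w) * ?k (\<Gamma> w) (S w - t) \<partial>M \<partial>lborel)"
  proof (rule nn_integral_cong)
    fix t :: real
    \<comment> \<open>Evaluated at S w + t, the last factor cancels the reweighting of
      \<open>nn_integral_shift\<close>; evaluated at S w, together with exp (- \<gamma> * t), it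
      turns the kernel into its translate.\<close>
    let ?\<Phi> = "\<lambda>z. F z * ?k (fst z) (snd z) * ennreal (exp (2 * fst z * cosh (snd z) - 2 * fst z * cosh (snd z - t)))"
    have "(\<integral>\<^sup>+w. F (\<Gamma> w, S w + t) * ?k (\<Gamma> w) (S w + t) \<partial>M) =
        (\<integral>\<^sup>+w. ?\<Phi> (\<Gamma> w, S w + t) * ennreal (exp (2 * \<Gamma> w * cosh (S w) - 2 * \<Gamma> w * cosh (S w + t))) \<partial>M)"
    proof (rule nn_integral_cong)
      fix w
      have "ennreal (exp (2 * \<Gamma> w * cosh (S w + t) - 2 * \<Gamma> w * cosh (S w + t - t))) *
          ennreal (exp (2 * \<Gamma> w * cosh (S w) - 2 * \<Gamma> w * cosh (S w + t))) = 1"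
        by (simp flip: ennreal_mult' exp_add)
      then show "F (\<Gamma> w, S w + t) * ?k (\<Gamma> w) (S w + t) =
          ?\<Phi> (\<Gamma> w, S w + t) * ennreal (exp (2 * \<Gamma> w * cosh (S w) - 2 * \<Gamma> w * cosh (S w + t)))"
        by (simp only: fst_conv snd_conv mult.assoc mult_1_right)
    qed
    also have "\<dots> = ennreal (exp (- \<gamma> * t)) * (\<integral>\<^sup>+w. ?\<Phi> (\<Gamma> w, S w) \<partial>M)"
      by (rule nn_integral_shift) measurable
    also have "\<dots> = (\<integral>\<^sup>+w. ennreal (exp (- \<gamma> * t)) * ?\<Phi> (\<Gamma> w, S w) \<partial>M)"
      by (rule nn_integral_cmult[symmetric]) measurable
    also have "\<dots> = (\<integral>\<^sup>+w. F (\<Gamma> w, S w) * ?k (\<Gamma> w) (S w - t) \<partial>M)"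
    proof (rule nn_integral_cong)
      fix w
      have factors: "exp (- \<gamma> * t) * (exp (\<gamma> * S w - 2 * \<Gamma> w * cosh (S w)) * exp (2 * \<Gamma> w * cosh (S w) - 2 * \<Gamma> w * cosh (S w - t))) =
          exp (\<gamma> * (S w - t) - 2 * \<Gamma> w * cosh (S w - t))"
        unfolding exp_add[symmetric] by (rule arg_cong[where f = exp]) (simp add: algebra_simps)
      have "bessel_density \<gamma> (\<Gamma> w) (S w - t) = exp (- \<gamma> * t) *
          (bessel_density \<gamma> (\<Gamma> w) (S w) * exp (2 * \<Gamma> w * cosh (S w) - 2 * \<Gamma> w * cosh (S w - t)))"
        unfolding bessel_density_def factors[symmetric] by (simp only: mult_ac)
      then show "ennreal (exp (- \<gamma> * t)) * ?\<Phi> (\<Gamma> w, S w) = F (\<Gamma> w, S w) * ?k (\<Gamma> w) (S w - t)"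
        by (simp only: fst_conv snd_conv ennreal_mult'[OF exp_ge_zero] ennreal_mult''[OF exp_ge_zero] mult.assoc mult.left_commute)
    qed
    finally show "(\<integral>\<^sup>+w. F (\<Gamma> w, S w + t) * ?k (\<Gamma> w) (S w + t) \<partial>M) =
        (\<integral>\<^sup>+w. F (\<Gamma> w, S w) * ?k (\<Gamma> w) (S w - t) \<partial>M)" .
  qed
  also have "\<dots> = (\<integral>\<^sup>+w. \<integral>\<^sup>+t. F (\<Gamma> w, S w) * ?k (\<Gamma> w) (S w - t) \<partial>lborel \<partial>M)"
    by (rule MS.Fubini') measurable
  also have "\<dots> = (\<integral>\<^sup>+w. F (\<Gamma> w, S w) \<partial>M)"
  proof (rule nn_integral_cong_AE)
    show "AE w in M. (\<integral>\<^sup>+t. F (\<Gamma> w, S w) * ?k (\<Gamma> w) (S w - t) \<partial>lborel) = F (\<Gamma> w, S w)"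
      using pos
    proof eventually_elim
      case (elim w)
      then have "(\<integral>\<^sup>+t. ?k (\<Gamma> w) (S w - t) \<partial>lborel) = 1"
        using nn_integral_lborel_reflect[of "?k (\<Gamma> w)" "S w"] by (simp add: nn_integral_bessel_density recover)
      then show ?case
        by (subst nn_integral_cmult) auto
    qed
  qed
  finally show ?thesis ..
qed

lemma measurable_kernel_integral:
  assumes "A \<in> sets borel"
  shows "(\<lambda>g. measure (density lborel (\<lambda>s. ennreal (bessel_density \<gamma> g s))) A) \<in> borel_measurable borel"
proof -
  note [measurable] = assms
  have "measure (density lborel (\<lambda>s. ennreal (bessel_density \<gamma> g s))) A =
      enn2real (\<integral>\<^sup>+s. ennreal (bessel_density \<gamma> g s) * indicator A s \<partial>lborel)" for g
    using assms by (simp add: measure_def emeasure_density)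
  then show ?thesis by simp
qed

lemma conditional_law_S:
  "conditional_law M \<Gamma> S (\<lambda>g. density lborel (\<lambda>s. ennreal (bessel_density \<gamma> g s)))"
proof (rule conditional_lawI)
  show "AE w in M. prob_space (density lborel (\<lambda>s. ennreal (bessel_density \<gamma> (\<Gamma> w) s)))"
    using pos by eventually_elim (simp add: prob_space_bessel_density recover)
  fix A B :: "real set" assume [measurable]: "A \<in> sets borel" "B \<in> sets borel"
  have "(\<integral>\<^sup>+w. indicator B (\<Gamma> w) * indicator A (S w) \<partial>M) =
      (\<integral>\<^sup>+w. \<integral>\<^sup>+s. indicator B (\<Gamma> w) * indicator A s * ennreal (bessel_density \<gamma> (\<Gamma> w) s) \<partial>lborel \<partial>M)"
    using nn_integral_bessel_kernel[of "\<lambda>z. indicator B (fst z) * indicator A (snd z)"] by simp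
  also have "\<dots> = (\<integral>\<^sup>+w. indicator B (\<Gamma> w) * emeasure (density lborel (\<lambda>s. ennreal (bessel_density \<gamma> (\<Gamma> w) s))) A \<partial>M)"
    by (intro nn_integral_cong) (simp add: emeasure_density nn_integral_cmult[symmetric] mult_ac)
  finally show "(\<integral>\<^sup>+w. indicator B (\<Gamma> w) * indicator A (S w) \<partial>M) =
      (\<integral>\<^sup>+w. indicator B (\<Gamma> w) * emeasure (density lborel (\<lambda>s. ennreal (bessel_density \<gamma> (\<Gamma> w) s))) A \<partial>M)" .
qed (simp_all add: measurable_kernel_integral prob_space_axioms)

lemma conditional_law_exp_S: "conditional_law M \<Gamma> (\<lambda>w. exp (S w)) (\<lambda>g. gig_law \<gamma> (2 * g) (2 * g))"
proof (rule conditional_lawI)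
  let ?K = "\<lambda>g. density lborel (\<lambda>s. ennreal (bessel_density \<gamma> g s))"
  show "AE w in M. prob_space (gig_law \<gamma> (2 * \<Gamma> w) (2 * \<Gamma> w))"
    using pos
  proof eventually_elim
    case (elim w)
    interpret K: prob_space "?K (\<Gamma> w)"
      by (rule prob_space_bessel_density) (simp add: recover elim)
    show ?case
      unfolding distr_exp_bessel_density[OF recover(1)[OF elim[THEN conjunct1] elim[THEN conjunct2]], symmetric]
      by (rule K.prob_space_distr) measurable
  qed
  show "(\<lambda>g. measure (gig_law \<gamma> (2 * g) (2 * g)) A) \<in> borel_measurable borel" if [measurable]: "A \<in> sets borel" for A
  proof -
    let ?f = "\<lambda>g x. if 0 < x then x powr (\<gamma> - 1) * exp (- (1 / 2) * (2 * g * x + 2 * g / x)) else (0::real)"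
    have [measurable]: "(\<lambda>(g, x). ?f g x) \<in> borel_measurable (borel \<Otimes>\<^sub>M borel)"
      by measurable
    have "measure (gig_law \<gamma> (2 * g) (2 * g)) A =
        enn2real (\<integral>\<^sup>+x. ennreal (?f g x / (\<integral>y. ?f g y \<partial>lborel)) * indicator A x \<partial>lborel)" for g
      unfolding gig_law_def Let_def measure_def by (subst emeasure_density) auto
    then show ?thesis by simp
  qed
  fix A B :: "real set" assume A [measurable]: "A \<in> sets borel" and [measurable]: "B \<in> sets borel"
  have "(\<integral>\<^sup>+w. indicator B (\<Gamma> w) * indicator A (exp (S w)) \<partial>M) =
      (\<integral>\<^sup>+w. \<integral>\<^sup>+s. indicator B (\<Gamma> w) * indicator A (exp s) * ennreal (bessel_density \<gamma> (\<Gamma> w) s) \<partial>lborel \<partial>M)"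
    using nn_integral_bessel_kernel[of "\<lambda>z. indicator B (fst z) * indicator A (exp (snd z))"] by simp
  also have "\<dots> = (\<integral>\<^sup>+w. indicator B (\<Gamma> w) * emeasure (gig_law \<gamma> (2 * \<Gamma> w) (2 * \<Gamma> w)) A \<partial>M)"
  proof (rule nn_integral_cong_AE)
    show "AE w in M. (\<integral>\<^sup>+s. indicator B (\<Gamma> w) * indicator A (exp s) * ennreal (bessel_density \<gamma> (\<Gamma> w) s) \<partial>lborel) =
        indicator B (\<Gamma> w) * emeasure (gig_law \<gamma> (2 * \<Gamma> w) (2 * \<Gamma> w)) A"
      using pos
    proof eventually_elim
      case (elim w)
      have "emeasure (gig_law \<gamma> (2 * \<Gamma> w) (2 * \<Gamma> w)) A = (\<integral>\<^sup>+x. indicator A x \<partial>distr (?K (\<Gamma> w)) borel exp)"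
      proof -
        have gig: "gig_law \<gamma> (2 * \<Gamma> w) (2 * \<Gamma> w) = distr (?K (\<Gamma> w)) borel exp"
          using elim by (simp add: distr_exp_bessel_density recover)
        show ?thesis
          unfolding gig by (rule nn_integral_indicator[symmetric]) (simp add: A)
      qed
      also have "\<dots> = (\<integral>\<^sup>+s. indicator A (exp s) \<partial>?K (\<Gamma> w))"
        by (rule nn_integral_distr) measurable
      also have "\<dots> = (\<integral>\<^sup>+s. ennreal (bessel_density \<gamma> (\<Gamma> w) s) * indicator A (exp s) \<partial>lborel)"
        by (rule nn_integral_density) measurable
      finally show ?case
        by (simp add: nn_integral_cmult[symmetric] mult_ac)
    qed
  qed
  finally show "(\<integral>\<^sup>+w. indicator B (\<Gamma> w) * indicator A (exp (S w)) \<partial>M) =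
      (\<integral>\<^sup>+w. indicator B (\<Gamma> w) * emeasure (gig_law \<gamma> (2 * \<Gamma> w) (2 * \<Gamma> w)) A \<partial>M)" .
qed (simp_all add: prob_space_axioms)

text \<open>For \<gamma> = 0 the kernel is even in s. The reflection is proved jointly with
  \<open>\<Gamma>\<close>, since Hp = \<Gamma> * exp S and Hm = \<Gamma> * exp (- S) depend on both
  coordinates.\<close>

lemma symmetric_laws:
  assumes "\<gamma> = 0"
  shows "distr M borel S = distr M borel (\<lambda>w. - S w)" and "distr M borel Hp = distr M borel Hm"
proof -
  have reflect: "(\<integral>\<^sup>+w. F (\<Gamma> w, - S w) \<partial>M) = (\<integral>\<^sup>+w. F (\<Gamma> w, S w) \<partial>M)"
    if [measurable]: "F \<in> borel_measurable (borel \<Otimes>\<^sub>M borel)" for F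
  proof -
    have even: "bessel_density \<gamma> g (0 - s) = bessel_density \<gamma> g s" for g s
      using assms by (simp add: bessel_density_def)
    have "(\<integral>\<^sup>+w. F (\<Gamma> w, - S w) \<partial>M) = (\<integral>\<^sup>+w. \<integral>\<^sup>+s. F (\<Gamma> w, 0 - s) * ennreal (bessel_density \<gamma> (\<Gamma> w) (0 - s)) \<partial>lborel \<partial>M)"
      using nn_integral_bessel_kernel[of "\<lambda>z. F (fst z, - snd z)"] unfolding even by simp
    also have "\<dots> = (\<integral>\<^sup>+w. \<integral>\<^sup>+s. F (\<Gamma> w, s) * ennreal (bessel_density \<gamma> (\<Gamma> w) s) \<partial>lborel \<partial>M)"
      by (intro nn_integral_cong nn_integral_lborel_reflect) measurable
    also have "\<dots> = (\<integral>\<^sup>+w. F (\<Gamma> w, S w) \<partial>M)"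
      by (rule nn_integral_bessel_kernel[symmetric]) fact
    finally show ?thesis .
  qed
  have distr_eqI: "distr M borel f = distr M borel h"
    if [measurable]: "f \<in> borel_measurable M" "h \<in> borel_measurable M"
      and eq: "\<And>A. A \<in> sets borel \<Longrightarrow> (\<integral>\<^sup>+w. indicator A (f w) \<partial>M) = (\<integral>\<^sup>+w. indicator A (h w) \<partial>M)"
    for f h :: "'a \<Rightarrow> real"
  proof (rule measure_eqI)
    fix A assume "A \<in> sets (distr M borel f)"
    then have A [measurable]: "A \<in> sets borel" by simp
    have "emeasure (distr M borel f) A = (\<integral>\<^sup>+x. indicator A x \<partial>distr M borel f)"
      "emeasure (distr M borel h) A = (\<integral>\<^sup>+x. indicator A x \<partial>distr M borel h)" by simp_all
    then show "emeasure (distr M borel f) A = emeasure (distr M borel h) A"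
      using eq[OF A] by (simp only: nn_integral_distr borel_measurable_indicator[OF A] that measurable_distr_eq1)
  qed simp
  show "distr M borel S = distr M borel (\<lambda>w. - S w)"
  proof (rule distr_eqI)
    fix A :: "real set" assume [measurable]: "A \<in> sets borel"
    show "(\<integral>\<^sup>+w. indicator A (S w) \<partial>M) = (\<integral>\<^sup>+w. indicator A (- S w) \<partial>M)"
      using reflect[of "\<lambda>z. indicator A (snd z)"] by simp
  qed measurable
  show "distr M borel Hp = distr M borel Hm"
  proof (rule distr_eqI)
    fix A :: "real set" assume [measurable]: "A \<in> sets borel"
    have "(\<integral>\<^sup>+w. indicator A (Hp w) \<partial>M) = (\<integral>\<^sup>+w. indicator A (\<Gamma> w * exp (S w)) \<partial>M)"
      by (rule nn_integral_cong_AE) (use pos in \<open>eventually_elim, simp add: recover\<close>)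
    also have "\<dots> = (\<integral>\<^sup>+w. indicator A (\<Gamma> w * exp (- S w)) \<partial>M)"
      using reflect[of "\<lambda>z. indicator A (fst z * exp (snd z))"] by simp
    also have "\<dots> = (\<integral>\<^sup>+w. indicator A (Hm w) \<partial>M)"
      by (rule nn_integral_cong_AE) (use pos in \<open>eventually_elim, simp add: recover\<close>)
    finally show "(\<integral>\<^sup>+w. indicator A (Hp w) \<partial>M) = (\<integral>\<^sup>+w. indicator A (Hm w) \<partial>M)" .
  qed measurable
qed

end

section \<open>Assembly on the given probability space\<close>

theorem lemma2p1:
  fixes G :: "'v pair_pre_digraph"
    and i0 j0 :: 'v
    and \<alpha> :: "'v \<times> 'v \<Rightarrow> real"
    and \<gamma> :: real
    and M :: "'w measure"
    and \<omega> :: "'w \<Rightarrow> 'v \<times> 'v \<Rightarrow> real"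
    and \<beta>i \<beta>j :: "'w \<Rightarrow> real"
  defines "Hp \<equiv> \<lambda>w. \<beta>i w * escape_prob G (\<omega> w) i0 j0"
    and "Hm \<equiv> \<lambda>w. \<beta>j w * escape_prob G (\<omega> w) j0 i0"
  defines "\<Gamma> \<equiv> \<lambda>w. sqrt (Hp w * Hm w)"
    and "S \<equiv> \<lambda>w. ln (sqrt (Hp w / Hm w))"
  assumes "pair_fin_digraph G" and "strongly_connected G"
    and "i0 \<in> pverts G" and "j0 \<in> pverts G" and "i0 \<noteq> j0"
    and "(i0, i0) \<notin> parcs G" and "(j0, j0) \<notin> parcs G"
    and "\<And>e. e \<in> parcs G \<Longrightarrow> 0 < \<alpha> e"
    and "\<And>x. x \<in> pverts G \<Longrightarrow>
           divergence G \<alpha> x = \<gamma> * (indicator {i0} x - indicator {j0} x)"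
    and "prob_space M"
    and "\<omega> \<in> measurable M (PiM (parcs G) (\<lambda>_. borel))"
    and "distr M (PiM (parcs G) (\<lambda>_. borel)) \<omega> = dirichlet_environment G \<alpha>"
    and "\<beta>i \<in> borel_measurable M" and "distr M borel \<beta>i = gamma_law (vertex_weight G \<alpha> i0)"
    and "\<beta>j \<in> borel_measurable M" and "distr M borel \<beta>j = gamma_law (vertex_weight G \<alpha> j0)"
    and "prob_space.indep_var M borel \<beta>i borel \<beta>j"
    and "prob_space.indep_set M
           (sets (vimage_algebra (space M) \<omega> (PiM (parcs G) (\<lambda>_. borel))))
           (sets (vimage_algebra (space M) (\<lambda>w. (\<beta>i w, \<beta>j w)) (borel \<Otimes>\<^sub>M borel)))"
  shows "Hp \<in> borel_measurable M \<and> Hm \<in> borel_measurable M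
    \<and> (AE w in M. 0 < Hp w \<and> 0 < Hm w)
    \<and> conditional_law M \<Gamma> S
        (\<lambda>g. density lborel
          (\<lambda>s. ennreal (1 / (2 * bessel_K \<gamma> (2 * g)) * exp (\<gamma> * s - 2 * g * cosh s))))
    \<and> conditional_law M \<Gamma> (\<lambda>w. exp (S w)) (\<lambda>g. gig_law \<gamma> (2 * g) (2 * g))
    \<and> (\<gamma> = 0 \<longrightarrow>
         distr M borel S = distr M borel (\<lambda>w. - S w) \<and> distr M borel Hp = distr M borel Hm)"
proof -
  note sc = assms(6) and ij = assms(7-9) and loops = assms(10,11) and div = assms(13)
    and \<omega> [measurable] = assms(15) and \<omega>_law = assms(16)
    and \<beta>i [measurable] = assms(17) and \<beta>i_law = assms(18) and \<beta>j [measurable] = assms(19) and \<beta>j_law = assms(20)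
    and indep_\<beta> = assms(21) and indep_\<omega> = assms(22)
  interpret pair_fin_digraph G by fact
  interpret prob_space M by fact
  interpret dirichlet_digraph G \<alpha>
  proof unfold_locales
    fix x assume "x \<in> pverts G"
    moreover obtain y where "y \<in> pverts G" "x \<noteq> y" using ij by metis
    ultimately show "out_arcs (with_proj G) x \<noteq> {}"
      using out_arcs_nonempty_strongly_connected[OF sc] by (fastforce simp: out_arcs_def)
  qed (rule assms(12))
  let ?P = "PiM (parcs G) (\<lambda>_. borel :: real measure)"
  let ?gi = "gamma_law (vertex_weight G \<alpha> i0)" and ?gj = "gamma_law (vertex_weight G \<alpha> j0)"
  interpret DE: prob_space "dirichlet_environment G \<alpha>" by (rule prob_space_dirichlet_environment)
  interpret gi: prob_space ?gi using ij by (intro prob_space_gamma_law vertex_weight_pos)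
  interpret gj: prob_space ?gj using ij by (intro prob_space_gamma_law vertex_weight_pos)
  interpret gij: pair_prob_space ?gi ?gj ..
  interpret DEg: pair_sigma_finite "dirichlet_environment G \<alpha>" "?gi \<Otimes>\<^sub>M ?gj" ..
  obtain xs where xs: "distinct xs" "set xs = pverts G - {i0, j0}"
    using finite_distinct_list[of "pverts G - {i0, j0}"] pair_finite_verts by auto
  define N where "N = PiM (parcs G) (\<lambda>e. gamma_law (\<alpha> e))"
  define R where "R W = fold (eliminate (pverts G)) xs (matrix_of_arcs G W)" for W
  have [measurable_cong]: "sets N = sets ?P"
    by (simp add: N_def)
  have entries: "(\<lambda>W. R W (i0, j0)) \<in> borel_measurable N" "(\<lambda>W. R W (j0, i0)) \<in> borel_measurable N"
    unfolding R_def using xs ij by (auto intro!: measurable_fold_eliminate_entry cong: measurable_cong_sets simp: N_def)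
  note [measurable] = measurable_escape_prob[OF sc ij loops(1)]
    measurable_escape_prob[OF sc ij(2,1) ij(3)[symmetric] loops(2)] entries
  have Hp [measurable]: "Hp \<in> borel_measurable M" and Hm [measurable]: "Hm \<in> borel_measurable M"
    unfolding Hp_def Hm_def by measurable
  let ?\<beta> = "\<lambda>w. (\<beta>i w, \<beta>j w)"
  have \<beta>_law: "distr M (borel \<Otimes>\<^sub>M borel) ?\<beta> = ?gi \<Otimes>\<^sub>M ?gj"
    using indep_\<beta> unfolding indep_var_distribution_eq by (simp add: \<beta>i_law \<beta>j_law)
  \<comment> \<open>The independence of the two Gamma variables and that of \<open>\<omega>\<close>
    from the pair combine into one product law, to which Tonelli applies.\<close>
  have joint: "distr M (?P \<Otimes>\<^sub>M (borel \<Otimes>\<^sub>M borel)) (\<lambda>w. (\<omega> w, ?\<beta> w)) =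
      dirichlet_environment G \<alpha> \<Otimes>\<^sub>M (?gi \<Otimes>\<^sub>M ?gj)"
  proof (rule pair_measure_eqI[symmetric])
    show "sets (dirichlet_environment G \<alpha> \<Otimes>\<^sub>M (?gi \<Otimes>\<^sub>M ?gj)) =
        sets (distr M (?P \<Otimes>\<^sub>M (borel \<Otimes>\<^sub>M borel)) (\<lambda>w. (\<omega> w, ?\<beta> w)))"
      by (simp cong: sets_pair_measure_cong add: sets_dirichlet_environment)
    fix A B assume "A \<in> sets (dirichlet_environment G \<alpha>)" "B \<in> sets (?gi \<Otimes>\<^sub>M ?gj)"
    then have A [measurable]: "A \<in> sets ?P" and B [measurable]: "B \<in> sets (borel \<Otimes>\<^sub>M borel)"
      by (simp_all add: sets_dirichlet_environment cong: sets_pair_measure_cong)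
    have "prob ((\<omega> -` A \<inter> space M) \<inter> (?\<beta> -` B \<inter> space M)) = prob (\<omega> -` A \<inter> space M) * prob (?\<beta> -` B \<inter> space M)"
      by (rule indep_setD[OF indep_\<omega>]) (rule in_vimage_algebra, fact)+
    moreover have "(\<lambda>w. (\<omega> w, ?\<beta> w)) -` (A \<times> B) \<inter> space M = (\<omega> -` A \<inter> space M) \<inter> (?\<beta> -` B \<inter> space M)"
      by auto
    moreover have "emeasure (dirichlet_environment G \<alpha>) A = prob (\<omega> -` A \<inter> space M)"
      unfolding \<omega>_law[symmetric] by (simp add: emeasure_distr emeasure_eq_measure)
    moreover have "emeasure (?gi \<Otimes>\<^sub>M ?gj) B = prob (?\<beta> -` B \<inter> space M)"
      unfolding \<beta>_law[symmetric] by (simp add: emeasure_distr emeasure_eq_measure)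
    ultimately show "emeasure (dirichlet_environment G \<alpha>) A * emeasure (?gi \<Otimes>\<^sub>M ?gj) B =
        emeasure (distr M (?P \<Otimes>\<^sub>M (borel \<Otimes>\<^sub>M borel)) (\<lambda>w. (\<omega> w, ?\<beta> w))) (A \<times> B)"
      by (simp add: emeasure_distr emeasure_eq_measure ennreal_mult')
  qed unfold_locales
  have law: "(\<integral>\<^sup>+w. F (Hp w, Hm w) \<partial>M) = (\<integral>\<^sup>+W. F (R W (i0, j0), R W (j0, i0)) \<partial>N)"
    if [measurable]: "F \<in> borel_measurable (borel \<Otimes>\<^sub>M borel)" for F
  proof -
    let ?F = "\<lambda>(\<eta>, z). F (fst z * escape_prob G \<eta> i0 j0, snd z * escape_prob G \<eta> j0 i0)"
    have "(\<integral>\<^sup>+w. F (Hp w, Hm w) \<partial>M) = (\<integral>\<^sup>+w. ?F (\<omega> w, ?\<beta> w) \<partial>M)"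
      by (simp add: Hp_def Hm_def)
    also have "\<dots> = (\<integral>\<^sup>+v. ?F v \<partial>distr M (?P \<Otimes>\<^sub>M (borel \<Otimes>\<^sub>M borel)) (\<lambda>w. (\<omega> w, ?\<beta> w)))"
      by (rule nn_integral_distr[symmetric]) measurable
    also have "\<dots> = (\<integral>\<^sup>+z. \<integral>\<^sup>+\<eta>. ?F (\<eta>, z) \<partial>dirichlet_environment G \<alpha> \<partial>(?gi \<Otimes>\<^sub>M ?gj))"
      unfolding joint by (rule DEg.nn_integral_snd[symmetric]) measurable
    also have "\<dots> = (\<integral>\<^sup>+W. F (R W (i0, j0), R W (j0, i0)) \<partial>N)"
      unfolding N_def R_def prod.case by (rule nn_integral_escape_prob[OF sc ij loops xs]) fact
    finally show ?thesis .
  qed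
  \<comment> \<open>What \<open>law\<close> transfers is integrals, so almost sure positivity is
    expressed as a vanishing integral of the indicator of the complement of the open
    quadrant.\<close>
  define Q :: "(real \<times> real) set" where "Q = - ({0<..} \<times> {0<..})"
  have "{0<..} \<times> {0<..} \<in> sets (borel \<Otimes>\<^sub>M borel :: (real \<times> real) measure)"
    by (rule pair_measureI) auto
  from sets.compl_sets[OF this] have Q [measurable]: "Q \<in> sets (borel \<Otimes>\<^sub>M borel)"
    by (simp add: Q_def space_pair_measure Compl_eq_Diff_UNIV)
  have "AE W in N. 0 < R W (i0, j0) \<and> 0 < R W (j0, i0)"
    unfolding N_def R_def by (rule nn_integral_eliminated_gauge(2)[OF sc ij xs div]) measurable
  then have "AE W in N. indicator Q (R W (i0, j0), R W (j0, i0)) = (0 :: ennreal)"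
    by eventually_elim (simp add: Q_def)
  then have "(\<integral>\<^sup>+w. indicator Q (Hp w, Hm w) \<partial>M) = 0"
    by (subst law) (simp_all add: nn_integral_0_iff_AE)
  then have "AE w in M. indicator Q (Hp w, Hm w) = (0 :: ennreal)"
    by (simp add: nn_integral_0_iff_AE)
  then have pos: "AE w in M. 0 < Hp w \<and> 0 < Hm w"
    by eventually_elim (simp add: Q_def indicator_def split: if_splits)
  interpret P: gauge_covariant_pair M Hp Hm \<gamma>
  proof
    fix t and F :: "real \<times> real \<Rightarrow> ennreal" assume [measurable]: "F \<in> borel_measurable (borel \<Otimes>\<^sub>M borel)"
    show "(\<integral>\<^sup>+w. F (exp t * Hp w, exp (- t) * Hm w) *
        ennreal (exp (Hp w + Hm w - exp t * Hp w - exp (- t) * Hm w)) \<partial>M) =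
      ennreal (exp (- \<gamma> * t)) * (\<integral>\<^sup>+w. F (Hp w, Hm w) \<partial>M)"
      using law[of "\<lambda>h. F (exp t * fst h, exp (- t) * snd h) *
          ennreal (exp (fst h + snd h - exp t * fst h - exp (- t) * snd h))"] law[of F]
        nn_integral_eliminated_gauge(1)[OF sc ij xs div, of F t]
      by (simp add: N_def R_def)
  qed (fact Hp Hm pos)+
  have "P.\<Gamma> = \<Gamma>" "P.S = S"
    by (simp_all add: \<Gamma>_def S_def P.\<Gamma>_def[abs_def] P.S_def[abs_def])
  then show ?thesis
    using Hp Hm pos P.conditional_law_S P.conditional_law_exp_S P.symmetric_laws
    by (simp add: bessel_density_def)
qed

end
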